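(* Let $n\ge 3$ and $r\ge 1$ be integers, and let $\zeta_n=e^{2\pi i/n}$. Then for each $j\in\mathbb{Z}$ with $(j,n)=1$, $$\mathbb{Q}(\widehat{\mathrm{ct}}^{(r)}_j)=\begin{cases}\mathbb{Q}(\zeta_n), & \text{if } r \text{ is odd};\\ \mathbb{Q}(\zeta_n+\zeta_n^{-1}), & \text{if } r \text{ is even}.\end{cases}$$
   Context: For $j\in\mathbb{Z}$, $(j,n)=1$, put $$d^{(r)}_j=\sum_{m\in\mathbb{Z},\ m\equiv j\ (\mathrm{mod}\ n)}\frac{\mu(|m|)}{m^r},$$ where $\mu$ is the Möbius function; for $r=1$ the series is understood as $\lim_{k\to\infty}\sum_{|m|\le k}$. The inverse cotangent numbers are $\widehat{\mathrm{ct}}^{(r)}_j=\dfrac{-i^r\pi^r}{(r-1)!\,n^r}\,d^{(r)}_j$. *)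

theory Defs
  imports
    "HOL-Analysis.Analysis"
    "HOL-Number_Theory.Cong"
    "HOL-Computational_Algebra.Squarefree"
    "HOL-Algebra.Generated_Fields"
    "HOL-Algebra.Algebraic_Closure_Type"
begin

definition moebius_mu :: "nat \<Rightarrow> int" where
  "moebius_mu n = (if squarefree n then (-1) ^ card (prime_factors n) else 0)"

definition moebius_term :: "nat \<Rightarrow> int \<Rightarrow> real" where
  "moebius_term r m = of_int (moebius_mu (nat \<bar>m\<bar>)) / of_int m ^ r"

text \<open>
  For \<open>r = 1\<close> the series over the residue class is the limit of its symmetric
  partial sums; for \<open>r \<ge> 2\<close> it is absolutely convergent. The term at \<open>m = 0\<close> is
  \<open>0\<close>, because \<open>0\<close> is not squarefree.
\<close>

definition moebius_series :: "nat \<Rightarrow> nat \<Rightarrow> int \<Rightarrow> real" where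
  "moebius_series n r j =
     (if r = 1 then
        lim (\<lambda>k::nat. \<Sum>m | \<bar>m\<bar> \<le> int k \<and> [m = j] (mod int n). moebius_term r m)
      else (\<Sum>\<^sub>\<infinity>m | [m = j] (mod int n). moebius_term r m))"

definition inverse_cot_number :: "nat \<Rightarrow> nat \<Rightarrow> int \<Rightarrow> complex" where
  "inverse_cot_number n r j =
     - (\<i> ^ r * of_real pi ^ r) / (fact (r - 1) * of_nat n ^ r)
       * of_real (moebius_series n r j)"

definition zeta :: "nat \<Rightarrow> complex" where
  "zeta n = exp (2 * of_real pi * \<i> / of_nat n)"

definition rat_adjoin :: "complex \<Rightarrow> complex set" where
  "rat_adjoin x = generate_field ring_of_type_algebra (\<rat> \<union> {x})"

end

theory Submission
  imports
    Defs
    "HOL-Number_Theory.Number_Theory"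
    "HOL-Complex_Analysis.Complex_Analysis"
begin

text \<open>
  Write \<open>\<zeta> = exp (2 \<pi> \<i> / n)\<close>, let \<open>G\<close> be the group of units modulo \<open>n\<close>, let \<open>d j\<close> be the Moebius series of the
  residue class \<open>j\<close>, and put \<open>e j = (\<i> \<pi>) ^ r * d j\<close>. The inverse cotangent number is a non-zero rational
  multiple of \<open>e j\<close>, so both generate the same field.

  Let \<open>c j\<close> be the sum of \<open>1 / m ^ r\<close> over all \<open>m \<equiv> j\<close> modulo \<open>n\<close>. Multiplying the two series and collecting
  the terms with a given product \<open>N\<close> produces the sum of \<open>\<mu> d\<close> over the divisors of \<open>N\<close>, which vanishes
  unless \<open>\<bar>N\<bar> = 1\<close>. Hence the convolution of \<open>d\<close> and \<open>c\<close> over \<open>G\<close> is \<open>2 (\<delta>\<^sub>1 + (-1) ^ r \<delta>\<^sub>-\<^sub>1)\<close>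
  (\<open>moebius_series_convolution\<close>). On the other hand \<open>c j\<close> is, up to a rational factor, a derivative of
  \<open>\<pi> cot (\<pi> x)\<close> at \<open>x = j / n\<close>, and therefore \<open>(\<i> \<pi>) ^ r\<close> times a rational polynomial in \<open>\<zeta> ^ j\<close>
  (\<open>cot_value_cyclotomic\<close>).

  So \<open>e\<close> solves a linear system with coefficients in \<open>\<rat>(\<zeta>)\<close>, and it is the only solution of parity
  \<open>(-1) ^ r\<close> because the system is a convolution with an invertible element. Consequently \<open>e j\<close> lies in
  \<open>\<rat>(\<zeta>)\<close>, and since the automorphism \<open>\<zeta> \<mapsto> \<zeta> ^ t\<close> only permutes the equations, it sends \<open>e j\<close> to
  \<open>e (t\<^sup>-\<^sup>1 j)\<close> (\<open>galois_action\<close>). If it fixes one \<open>e j\<close>, it fixes all of them, so the right-hand side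
  \<open>\<delta>\<^sub>1 + (-1) ^ r \<delta>\<^sub>-\<^sub>1\<close> is invariant under \<open>t\<close>; this forces \<open>t = 1\<close>, or \<open>t = -1\<close> and \<open>r\<close> even
  (\<open>stabilizer\<close>). Thus the minimal polynomial of \<open>\<zeta>\<close> over \<open>\<rat>(e j)\<close> has no root besides \<open>\<zeta>\<close> and, for even
  \<open>r\<close>, \<open>\<zeta>\<^sup>-\<^sup>1\<close>, and its coefficients show that \<open>\<zeta>\<close>, respectively \<open>\<zeta> + \<zeta>\<^sup>-\<^sup>1\<close>, lies in \<open>\<rat>(e j)\<close>
  (\<open>generated_field\<close>).

  For \<open>r \<ge> 2\<close> all series converge absolutely. For \<open>r = 1\<close> the mere existence of the limit that defines \<open>d j\<close>
  is of the depth of the prime number theorem in arithmetic progressions. The indicator of the class \<open>j\<close>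
  minus that of \<open>-j\<close> is a combination of odd characters \<open>\<chi>\<close>. The function \<open>L(s, \<chi>)\<close> is holomorphic for
  \<open>Re s > 0\<close> and has no zero with \<open>Re s = 1\<close> (\<open>L_nonzero_complex\<close>, \<open>L_1_nonzero_real\<close>), so \<open>1 / L(s, \<chi>)\<close>
  is holomorphic around the closed half plane \<open>Re s \<ge> 1\<close>, and Newman's contour argument
  (\<open>newman_tauberian\<close>) shows that its Dirichlet series, whose coefficients are \<open>\<mu> m * \<chi> m\<close>, converges at
  \<open>s = 1\<close>. The limit is the value of \<open>1 / L(s, \<chi>)\<close> there, so the convolution identity passes from \<open>s > 1\<close>
  to \<open>s = 1\<close>.
\<close>

text \<open>
  The names hidden here also denote notions for abstract groups, modules and rings of polynomials; below they
  always mean the type class versions. Absolute summability refers to \<open>Infinite_Sum\<close>.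
\<close>

hide_const (open) Divisibility.prime up_ring.coeff up_ring.monom Polynomials.degree
  Polynomials.lead_coeff Divisibility.irreducible module.smult
no_notation Infinite_Set_Sum.abs_summable_on (infix "abs'_summable'_on" 50)

section \<open>Dirichlet series in a half plane\<close>

lemma powr_diff_mvt:
  fixes u p :: real
  assumes "u > 0"
  obtains \<xi> where "u < \<xi>" "\<xi> < u + 1" "(u + 1) powr p - u powr p = p * \<xi> powr (p - 1)"
proof -
  have "\<exists>z>u. z < u + 1 \<and> (u+1) powr p - u powr p = (u + 1 - u) * (p * z powr (p - 1))"
    by (rule MVT2) (use assms in \<open>auto intro!: derivative_eq_intros simp: powr_diff\<close>)
  then show ?thesis using that by auto
qed

lemma norm_nat_powr: "m > 0 \<Longrightarrow> norm (of_nat m powr s :: complex) = real m powr Re s"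
  by (simp add: norm_powr_real_powr)

text \<open>
  The sum is compared with the integral of \<open>t powr (y - 1)\<close> over \<open>{0..N}\<close>, which is \<open>N powr y / y\<close>. For \<open>y > 1\<close>
  the integrand increases, the comparison is off by one step, and the last term has to be added.
\<close>

lemma sum_nat_powr_le:
  fixes y :: real
  assumes "y > 0" "N \<ge> 1"
  shows "(\<Sum>m=1..N. real m powr (y - 1)) \<le> real N powr y / y + real N powr (y - 1)"
proof (cases "y \<le> 1")
  case True
  have "(\<Sum>m=1..N. real m powr (y - 1)) \<le> real N powr y / y"
    using assms(2)
  proof (induction N rule: dec_induct)
    case base
    then show ?case using True assms by simp
  next
    case (step N)
    obtain \<xi> where x: "real N < \<xi>" "\<xi> < real N + 1"
        "(real N + 1) powr y - real N powr y = y * \<xi> powr (y - 1)"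
      using powr_diff_mvt[of "real N" y] step by auto
    have "(real N + 1) powr (y - 1) \<le> \<xi> powr (y - 1)"
      using x step True by (intro powr_mono2') auto
    then have "(real N + 1) powr (y - 1) \<le> ((real N + 1) powr y - real N powr y) / y"
      using assms x by (simp add: field_simps)
    then show ?case using step by (simp add: diff_divide_distrib add.commute)
  qed
  then show ?thesis by (smt (verit) powr_ge_zero)
next
  case False
  show ?thesis
    using assms(2)
  proof (induction N rule: dec_induct)
    case base
    then show ?case using False by simp
  next
    case (step N)
    obtain \<xi> where x: "real N < \<xi>" "\<xi> < real N + 1"
        "(real N + 1) powr y - real N powr y = y * \<xi> powr (y - 1)"
      using powr_diff_mvt[of "real N" y] step by auto
    have "real N powr (y - 1) \<le> \<xi> powr (y - 1)"
      using x step False by (intro powr_mono2) auto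
    then have "real N powr (y - 1) \<le> ((real N + 1) powr y - real N powr y) / y"
      using assms x by (simp add: field_simps)
    then show ?case using step by (simp add: diff_divide_distrib add.commute)
  qed
qed

text \<open>
  Telescoping majorant for the tail of \<open>\<Sum> m powr (-1 - x)\<close>, giving the bound \<open>N powr (-x) / x\<close> for it.
\<close>

lemma powr_tail_sums:
  fixes x :: real
  assumes "x > 0" "N \<ge> 1"
  shows "(\<lambda>m. (real (m + N) powr (-x) - real (Suc m + N) powr (-x)) / x) sums (real N powr (-x) / x)"
    and "real (Suc m + N) powr (-1-x) \<le> (real (m + N) powr (-x) - real (Suc m + N) powr (-x)) / x"
proof -
  have "(\<lambda>m. real (m + N) powr (-x)) \<longlonglongrightarrow> 0"
    using assms by (intro tendsto_neg_powr filterlim_compose[OF filterlim_real_sequentially])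
      (auto intro: filterlim_add_const_nat_at_top)
  from telescope_sums'[OF this]
  have "(\<lambda>m. real (m + N) powr (-x) - real (Suc m + N) powr (-x)) sums (real N powr (-x))"
    by simp
  from sums_divide[OF this] show "(\<lambda>m. (real (m + N) powr (-x) - real (Suc m + N) powr (-x)) / x)
      sums (real N powr (-x) / x)" .
  obtain \<xi> where xi: "real (m+N) < \<xi>" "\<xi> < real (m+N) + 1"
        "(real (m+N) + 1) powr (-x) - real (m+N) powr (-x) = (-x) * \<xi> powr (-x - 1)"
      using powr_diff_mvt[of "real (m+N)" "-x"] assms by auto
  have "real (Suc m + N) powr (-1-x) \<le> \<xi> powr (-1-x)"
    using xi assms by (intro powr_mono2') auto
  then have "x * real (Suc m + N) powr (-1-x) \<le> x * \<xi> powr (-1-x)"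
    using assms by (intro mult_left_mono) auto
  moreover have "x * \<xi> powr (-1-x) = real (m + N) powr (-x) - real (Suc m + N) powr (-x)"
    using xi(3) by (simp add: minus_diff_commute[of x 1] algebra_simps)
  ultimately show "real (Suc m + N) powr (-1-x) \<le> (real (m + N) powr (-x) - real (Suc m + N) powr (-x)) / x"
    using assms by (simp only: pos_le_divide_eq mult.commute)
qed

text \<open>
  The terms and their derivatives are dominated by a convergent series near every point with \<open>Re s > 1\<close>, so
  that the series may be differentiated term by term.
\<close>

lemma dirichlet_series_half_plane:
  fixes a :: "nat \<Rightarrow> complex"
  assumes "\<And>m. norm (a m) \<le> C"
  obtains F F' where "\<And>s. Re s > 1 \<Longrightarrow> (\<lambda>m. a m * of_nat m powr (-s)) sums F s"
    "\<And>s. Re s > 1 \<Longrightarrow> (\<lambda>m. - of_real (ln (real m)) * a m * of_nat m powr (-s)) sums F' s"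
    "\<And>s. Re s > 1 \<Longrightarrow> (F has_field_derivative F' s) (at s)"
proof -
  have C: "C \<ge> 0" using assms[of 0] by (meson norm_ge_zero order_trans)
  have "\<exists>g g'. \<forall>s\<in>{s. Re s > 1}. ((\<lambda>m. a m * of_nat m powr (-s)) sums g s) \<and>
     ((\<lambda>m. - of_real (ln (real m)) * a m * of_nat m powr (-s)) sums g' s) \<and>
     (g has_field_derivative g' s) (at s)"
  proof (rule series_and_derivative_comparison_complex)
    show "open {s. Re s > 1}" by (rule open_halfspace_Re_gt)
    fix m :: nat and s :: complex
    assume "s \<in> {s. Re s > 1}"
    show "((\<lambda>s. a m * of_nat m powr (-s)) has_field_derivative - of_real (ln (real m)) * a m
        * of_nat m powr (-s)) (at s)"
    proof (cases "m = 0")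
      case False
      then show ?thesis
        by (auto intro!: derivative_eq_intros simp: powr_def Ln_of_nat)
    qed auto
  next
    fix s :: complex
    assume s: "s \<in> {s. Re s > 1}"
    define d where "d = (Re s - 1) / 2"
    have d: "d > 0" using s by (auto simp: d_def)
    define h :: "nat \<Rightarrow> complex" where "h m = of_real (C * real m powr (-1-d))" for m
    have "summable (\<lambda>m. real m powr (-1-d))"
      using d by (subst summable_real_powr_iff) auto
    then have "summable (\<lambda>m. C * real m powr (-1-d))" by (rule summable_mult)
    then have 1: "summable h" unfolding h_def by (rule summable_of_real)
    have 2: "range h \<subseteq> \<real>\<^sub>\<ge>\<^sub>0" using C by (auto simp: h_def)
    have 3: "cmod (a m * of_nat m powr (-y)) \<le> cmod (h m)" if "y \<in> ball s d \<inter> {s. Re s > 1}" for y m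
    proof (cases "m = 0")
      case False
      have "\<bar>Re s - Re y\<bar> \<le> dist s y" by (metis abs_Re_le_cmod dist_norm minus_complex.sel(1))
      then have *: "Re s - Re y \<le> d" using that by auto
      have "Re y \<ge> 1 + d" using * unfolding d_def by (simp add: field_simps)
      then have "real m powr (- Re y) \<le> real m powr (-1-d)"
        using False by (intro powr_mono) auto
      then have "cmod (a m) * real m powr (- Re y) \<le> C * real m powr (-1-d)"
        using assms C by (intro mult_mono) auto
      then show ?thesis using False C by (simp add: norm_mult norm_nat_powr h_def abs_mult)
    qed auto
    show "\<exists>d h. 0 < d \<and> summable h \<and> range h \<subseteq> \<real>\<^sub>\<ge>\<^sub>0 \<and> (\<forall>\<^sub>F m in sequentially.
       \<forall>y\<in>ball s d \<inter> {s. Re s > 1}. cmod (a m * of_nat m powr (-y)) \<le> cmod (h m))"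
      using 1 2 3 d by (intro exI[of _ d] exI[of _ h]) auto
  qed
  then show ?thesis using that by blast
qed

lemma powr_neg_diff_bound:
  fixes u v :: real
  assumes "0 < u" "u \<le> v" "v \<le> u + 1" "Re s > 0"
  shows "cmod (of_real u powr (-s) - of_real v powr (-s)) \<le> cmod s * u powr (-1 - Re s)"
proof -
  let ?S = "closed_segment (of_real u) (of_real v) :: complex set"
  have S: "\<exists>t. z = complex_of_real t \<and> u \<le> t" if "z \<in> ?S" for z
    using that assms by (auto simp: closed_segment_of_real closed_segment_eq_real_ivl)
  have "cmod (of_real u powr (-s) - of_real v powr (-s))
      \<le> (cmod s * u powr (-1 - Re s)) * cmod (of_real u - of_real v)"
  proof (rule field_differentiable_bound[where S = ?S and f' = "\<lambda>z. (-s) * z powr (-s - 1)"])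
    fix z assume "z \<in> ?S"
    then obtain t where t: "z = complex_of_real t" "u \<le> t" using S by blast
    have tpos: "t > 0" using t assms by linarith
    then have "z \<notin> \<real>\<^sub>\<le>\<^sub>0" using t by auto
    then show "((\<lambda>z. z powr (-s)) has_field_derivative (-s) * z powr (-s - 1)) (at z within ?S)"
      by (intro has_field_derivative_powr has_field_derivative_at_within)
    have "cmod (z powr (-s - 1)) = t powr (-1 - Re s)"
      using t tpos norm_powr_real_powr[of z "-s - 1"] by (simp add: minus_diff_commute[of "Re s" 1])
    also have "\<dots> \<le> u powr (-1 - Re s)"
      using t assms by (intro powr_mono2') auto
    finally show "cmod (- s * z powr (- s - 1)) \<le> cmod s * u powr (- 1 - Re s)"
      by (simp add: norm_mult mult_left_mono)
  qed auto
  also have "cmod (of_real u - of_real v) = v - u"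
    using assms by (simp flip: of_real_diff)
  also have "(cmod s * u powr (-1 - Re s)) * (v - u) \<le> (cmod s * u powr (-1 - Re s)) * 1"
    using assms by (intro mult_left_mono) auto
  finally show ?thesis by simp
qed

text \<open>
  Abel summation replaces \<open>m powr (-s)\<close> by the differences \<open>m powr (-s) - (m + 1) powr (-s)\<close>, which are smaller by
  a factor \<open>m\<close>; with bounded partial sums as coefficients the new series converges locally uniformly for
  \<open>Re s > 0\<close>. This continues the L-functions of non-principal characters beyond the line \<open>Re s = 1\<close>.
\<close>

lemma dirichlet_series_bounded_sums:
  fixes f :: "nat \<Rightarrow> complex"
  assumes bd: "\<And>N. norm (\<Sum>m\<le>N. f m) \<le> C" and f0: "f 0 = 0"
  obtains L where "L holomorphic_on {s. Re s > 0}"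
    "\<And>s. Re s > 0 \<Longrightarrow> (\<lambda>m. f m * of_nat m powr (-s)) sums L s"
proof -
  define A where "A N = (\<Sum>m\<le>N. f m)" for N
  have C: "C \<ge> 0" using bd[of 0] by (meson norm_ge_zero order_trans)
  define T where "T m s = A m * (of_nat m powr (-s) - of_nat (Suc m) powr (-s))" for m s
  have A0: "A 0 = 0" using f0 by (simp add: A_def)
  have abel: "(\<Sum>m\<le>N. f m * of_nat m powr (-s)) = A N * of_nat (Suc N) powr (-s) + (\<Sum>m\<le>N. T m s)" for N s
    by (induction N) (auto simp: A0 T_def f0 A_def algebra_simps)
  have bT: "cmod (T m s) \<le> C * (cmod s * real m powr (-1 - Re s))" if "Re s > 0" for m s
  proof (cases "m = 0")
    case False
    have "cmod (T m s) = cmod (A m) * cmod (of_nat m powr (-s) - of_nat (Suc m) powr (-s))"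
      by (simp add: T_def norm_mult)
    also have "\<dots> \<le> C * (cmod s * real m powr (-1 - Re s))"
      using bd C False that powr_neg_diff_bound[of "real m" "real (Suc m)" s]
          by (intro mult_mono) (auto simp: A_def)
    finally show ?thesis .
  qed (auto simp: T_def A0)
  have "\<exists>g g'. \<forall>s\<in>{s. Re s > 0}. ((\<lambda>m. T m s) sums g s) \<and>
     ((\<lambda>m. deriv (T m) s) sums g' s) \<and> (g has_field_derivative g' s) (at s)"
  proof (rule series_and_derivative_comparison_complex)
    show "open {s. Re s > 0}" by (rule open_halfspace_Re_gt)
    fix m :: nat and s :: complex
    have "T m holomorphic_on UNIV"
      unfolding T_def by (cases "m = 0") (auto simp: A0 intro!: holomorphic_intros)
    then show "(T m has_field_derivative deriv (T m) s) (at s)"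
      by (intro holomorphic_derivI[of _ UNIV]) auto
  next
    fix s :: complex
    assume s: "s \<in> {s. Re s > 0}"
    define d where "d = Re s / 2"
    have d: "d > 0" using s by (auto simp: d_def)
    define h :: "nat \<Rightarrow> complex" where "h m = of_real (C * (cmod s + d) * real m powr (-1-d))" for m
    have "summable (\<lambda>m. real m powr (-1-d))"
      using d by (subst summable_real_powr_iff) auto
    then have "summable (\<lambda>m. C * (cmod s + d) * real m powr (-1-d))" by (rule summable_mult)
    then have 1: "summable h" unfolding h_def by (rule summable_of_real)
    have 2: "range h \<subseteq> \<real>\<^sub>\<ge>\<^sub>0" using C d by (auto simp: h_def)
    have 3: "cmod (T m y) \<le> cmod (h m)" if "y \<in> ball s d \<inter> {s. Re s > 0}" for y m
    proof -
      have "\<bar>Re s - Re y\<bar> \<le> dist s y" by (metis abs_Re_le_cmod dist_norm minus_complex.sel(1))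
      then have *: "Re s - Re y \<le> d" using that by auto
      have "Re y \<ge> d" using * unfolding d_def by (simp add: field_simps)
      then have a: "real m powr (-1 - Re y) \<le> real m powr (-1-d)"
        by (cases "m = 0") (auto intro!: powr_mono)
      have "cmod y \<le> cmod s + cmod (y - s)" by (metis add.commute diff_add_cancel norm_triangle_ineq)
      then have b: "cmod y \<le> cmod s + d" using that by (auto simp: dist_norm norm_minus_commute)
      have "cmod (T m y) \<le> C * (cmod y * real m powr (-1 - Re y))" using bT that by auto
      also have "\<dots> \<le> C * ((cmod s + d) * real m powr (-1 - d))"
        using a b C d by (intro mult_left_mono mult_mono) auto
      also have "\<dots> = cmod (h m)" using C d by (simp add: h_def abs_mult norm_mult del: of_real_mult of_real_add)
      finally show ?thesis .
    qed
    show "\<exists>d h. 0 < d \<and> summable h \<and> range h \<subseteq> \<real>\<^sub>\<ge>\<^sub>0 \<and> (\<forall>\<^sub>F m in sequentially.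
       \<forall>y\<in>ball s d \<inter> {s. Re s > 0}. cmod (T m y) \<le> cmod (h m))"
      using 1 2 3 d by (intro exI[of _ d] exI[of _ h]) auto
  qed
  then obtain g g' where g: "\<And>s. Re s > 0 \<Longrightarrow> (\<lambda>m. T m s) sums g s"
    "\<And>s. Re s > 0 \<Longrightarrow> (g has_field_derivative g' s) (at s)" by blast
  show ?thesis
  proof
    show "g holomorphic_on {s. Re s > 0}"
      using g(2) by (auto simp: holomorphic_on_open open_halfspace_Re_gt)
    fix s :: complex assume s: "Re s > 0"
    have "(\<lambda>N. \<Sum>m\<le>N. T m s) \<longlonglongrightarrow> g s" using g(1)[OF s] by (simp add: sums_def_le)
    moreover have "(\<lambda>N. A N * of_nat (Suc N) powr (-s)) \<longlonglongrightarrow> 0"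
    proof (rule Lim_null_comparison)
      show "\<forall>\<^sub>F N in sequentially. norm (A N * of_nat (Suc N) powr (-s)) \<le> C * real (Suc N) powr (- Re s)"
        unfolding norm_mult norm_nat_powr[OF zero_less_Suc] using bd
            by (auto simp: A_def intro!: always_eventually mult_right_mono)
      have "(\<lambda>N. real (Suc N) powr (- Re s)) \<longlonglongrightarrow> 0"
        using s by (intro tendsto_neg_powr filterlim_compose[OF filterlim_real_sequentially] filterlim_Suc) auto
      from tendsto_mult_right_zero[OF this] show "(\<lambda>N. C * real (Suc N) powr (- Re s)) \<longlonglongrightarrow> 0" .
    qed
    ultimately have "(\<lambda>N. A N * of_nat (Suc N) powr (-s) + (\<Sum>m\<le>N. T m s)) \<longlonglongrightarrow> 0 + g s"
      by (intro tendsto_add)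
    then show "(\<lambda>m. f m * of_nat m powr (-s)) sums g s"
      unfolding sums_def_le abel by simp
  qed
qed

section \<open>Newman's Tauberian theorem\<close>

text \<open>
  The factor \<open>exp (z * ln N)\<close> has modulus one on the imaginary axis and oscillates; one integration by parts
  gains the factor \<open>1 / ln N\<close>.
\<close>

lemma riemann_lebesgue_linepath:
  assumes "open V" "W holomorphic_on V" "closed_segment (\<i> * of_real R) (- \<i> * of_real R) \<subseteq> V"
  shows "(\<lambda>N::nat. contour_integral (linepath (\<i> * of_real R) (- \<i> * of_real R)) (\<lambda>z. W z
      * exp (z * of_real (ln (real N))))) \<longlonglongrightarrow> 0"
proof -
  let ?a = "\<i> * of_real R :: complex" and ?b = "- \<i> * of_real R :: complex"
  let ?S = "closed_segment ?a ?b" and ?g = "linepath ?a ?b"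
  have cW: "continuous_on ?S W"
    by (meson assms holomorphic_on_imp_continuous_on holomorphic_on_subset)
  have dW: "deriv W holomorphic_on V" using assms by (intro holomorphic_deriv)
  then have cW': "continuous_on ?S (deriv W)"
    by (meson assms holomorphic_on_imp_continuous_on holomorphic_on_subset)
  obtain B0 where B0: "\<And>z. z \<in> ?S \<Longrightarrow> norm (W z) \<le> B0"
    using compact_imp_bounded[OF compact_continuous_image[OF cW compact_segment]] by (auto simp: bounded_iff)
  obtain B1 where B1: "\<And>z. z \<in> ?S \<Longrightarrow> norm (deriv W z) \<le> B1"
    using compact_imp_bounded[OF compact_continuous_image[OF cW' compact_segment]] by (auto simp: bounded_iff)
  have B1_0: "B1 \<ge> 0" using B1[of ?a] by (meson ends_in_segment(1) norm_ge_zero order_trans)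
  have rez: "Re z = 0" if "z \<in> ?S" for z
    using that by (auto simp: closed_segment_def)
  have unit: "norm (exp (z * of_real l)) = 1" if "z \<in> ?S" for z l
    using rez[OF that] by (simp add: norm_exp_eq_Re)
  define K where "K = 2 * B0 + B1 * norm (?b - ?a)"
  have main: "norm (contour_integral ?g (\<lambda>z. W z * exp (z * of_real l))) \<le> K / l" if l: "l > 0" for l :: real
  proof -
    let ?e = "\<lambda>z. exp (z * of_real l)"
    have hci: "((\<lambda>z. W z * ?e z + deriv W z * ?e z / of_real l) has_contour_integral
        (W (pathfinish ?g) * ?e (pathfinish ?g) / of_real l - W (pathstart ?g)
            * ?e (pathstart ?g) / of_real l)) ?g"
    proof (rule contour_integral_primitive[where S = V])
      fix z assume "z \<in> V"
      then have "(W has_field_derivative deriv W z) (at z within V)"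
        using holomorphic_derivI[OF assms(2,1)] has_field_derivative_at_within by blast
      then show "((\<lambda>z. W z * ?e z / of_real l) has_field_derivative W z * ?e z + deriv W z * ?e z / of_real l)
          (at z within V)"
      proof -
        have "(?e has_field_derivative ?e z * (1 * of_real l)) (at z within V)"
          by (auto intro!: derivative_eq_intros)
        from DERIV_cdivide[OF DERIV_mult[OF \<open>(W has_field_derivative deriv W z) (at z within V)\<close> this], of
            "of_real l"]
        show ?thesis using l by (simp add: add_divide_distrib add.commute mult.commute)
      qed
    qed (use assms in auto)
    have int2: "(\<lambda>z. deriv W z * ?e z / of_real l) contour_integrable_on ?g"
      using cW' l by (intro contour_integrable_continuous_linepath continuous_intros) auto
    have "((\<lambda>z. W z * ?e z) has_contour_integral
        ((W ?b * ?e ?b / of_real l - W ?a * ?e ?a / of_real l) - contour_integral ?g (\<lambda>z. deriv W z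
            * ?e z / of_real l))) ?g"
      using has_contour_integral_diff[OF hci has_contour_integral_integral[OF int2]] by simp
    then have eq: "contour_integral ?g (\<lambda>z. W z * ?e z) =
        (W ?b * ?e ?b / of_real l - W ?a * ?e ?a / of_real l) - contour_integral ?g (\<lambda>z. deriv W z
            * ?e z / of_real l)"
      by (rule contour_integral_unique)
    have n1: "norm (contour_integral ?g (\<lambda>z. deriv W z * ?e z / of_real l)) \<le> (B1 / l) * norm (?b - ?a)"
    proof (rule contour_integral_bound_linepath[OF int2])
      show "0 \<le> B1 / l" using B1_0 l by simp
      show "norm (deriv W x * exp (x * of_real l) / of_real l) \<le> B1 / l" if "x \<in> ?S" for x
        using B1[OF that] l rez[OF that] by (simp add: norm_mult norm_divide divide_right_mono)
    qed
    have "norm (W x * ?e x / of_real l) \<le> B0 / l" if "x \<in> ?S" for x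
      using B0[OF that] l rez[OF that] by (simp add: norm_mult norm_divide divide_right_mono)
    from this[of ?a] this[of ?b]
    have n2: "norm (W ?b * ?e ?b / of_real l - W ?a * ?e ?a / of_real l) \<le> B0/l + B0/l"
      by (intro order_trans[OF norm_triangle_ineq4] add_mono) (simp_all only: ends_in_segment)
    have "norm (contour_integral ?g (\<lambda>z. W z * ?e z)) \<le> (B0/l + B0/l) + (B1 / l) * norm (?b - ?a)"
      unfolding eq by (rule order_trans[OF norm_triangle_ineq4 add_mono[OF n2 n1]])
    also have "\<dots> = K / l" by (simp add: K_def add_divide_distrib)
    finally show ?thesis .
  qed
  show ?thesis
  proof (rule Lim_null_comparison)
    show "\<forall>\<^sub>F N in sequentially. norm (contour_integral ?g (\<lambda>z. W z * exp (z * of_real (ln (real N)))))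
        \<le> K / ln (real N)"
      using eventually_gt_at_top[of 1] by eventually_elim (intro main, simp)
    show "(\<lambda>N. K / ln (real N)) \<longlonglongrightarrow> 0"
      by (intro real_tendsto_divide_at_top[OF tendsto_const] filterlim_compose[OF ln_at_top]
          filterlim_real_sequentially)
  qed
qed

text \<open>
  Newman's contour argument. Near \<open>s = 1\<close> put \<open>s = 1 + z\<close>. The partial sum \<open>s N\<close> is the value at \<open>z = 0\<close> of an
  entire function \<open>S N\<close>, so Cauchy's theorem on the circle of radius \<open>R\<close> expresses it by integrals of \<open>S N z * K z / z\<close>
  over the two half circles, where \<open>K z = N powr z * (1 + z\<^sup>2 / R\<^sup>2)\<close>. On the circle the kernel \<open>K z / z\<close> has modulus
  \<open>N powr (Re z) * 2 * \<bar>Re z\<bar> / R\<^sup>2\<close>; the factor \<open>\<bar>Re z\<bar>\<close> compensates the poles \<open>1 / \<bar>Re z\<bar>\<close> in the bounds for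
  \<open>S N\<close> on the left and for the tail \<open>G - S N\<close> on the right, so both arcs together contribute
  \<open>O(1 / R + 1 / N)\<close>. The integral of
  \<open>G z * K z / z\<close> over the right arc equals the one over the imaginary segment, because \<open>G 0 = 0\<close> removes the
  pole, and the latter tends to zero as \<open>N\<close> grows.
\<close>

lemma newman_zero:
  fixes a :: "nat \<Rightarrow> complex"
  assumes bd: "\<And>m. norm (a m) \<le> C" and U: "open U" "{s. Re s \<ge> 1} \<subseteq> U" and hol: "F holomorphic_on U"
    and sums: "\<And>s. Re s > 1 \<Longrightarrow> (\<lambda>m. a m * of_nat m powr (-s)) sums F s" and F1: "F 1 = 0"
  shows "(\<lambda>m. a m / of_nat m) sums 0"
proof -
  have C: "C \<ge> 0" using bd[of 0] by (meson norm_ge_zero order_trans)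
  define G where "G z = F (1 + z)" for z
  define V where "V = {z. 1 + z \<in> U}"
  have V: "open V" "{z. Re z \<ge> 0} \<subseteq> V"
  proof -
    have "V = (\<lambda>z. 1 + z) -` U" by (auto simp: V_def)
    then show "open V" using U(1) by (auto intro!: open_vimage continuous_intros)
    show "{z. Re z \<ge> 0} \<subseteq> V" using U(2) by (auto simp: V_def)
  qed
  have holG: "G holomorphic_on V" unfolding G_def
    by (rule holomorphic_on_compose_gen[OF _ hol, unfolded o_def]) (auto simp: V_def intro!: holomorphic_intros)
  have G0: "G 0 = 0" by (simp add: G_def F1)
  define H where "H z = (if z = 0 then deriv G 0 else (G z - G 0) / (z - 0))" for z
  have "0 \<in> V" using V by auto
  then have holH: "H holomorphic_on V" unfolding H_def using holG V
    by (intro pole_lemma) (auto simp: interior_open)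
  define S where "S N z = (\<Sum>m=1..N. a m * of_nat m powr (-1-z))" for N z
  define s where "s N = (\<Sum>m=1..N. a m / of_nat m)" for N
  have S0: "S N 0 = s N" for N
    unfolding S_def s_def by (rule sum.cong) (auto simp: powr_minus divide_inverse)
  have bound: "norm (s N) \<le> 2 * C / R + C / real N +
      norm (contour_integral (linepath (\<i> * of_real R) (- \<i> * of_real R))
          (\<lambda>z. (H z * (1 + z\<^sup>2 / of_real (R\<^sup>2))) * exp (z * of_real (ln (real N)))))"
    if R: "R > 0" and N: "N \<ge> 1" for R N
  proof -
    define K where "K z = (1 + z\<^sup>2 / of_real (R\<^sup>2)) * exp (z * of_real (ln (real N)))" for z :: complex
    have holK: "K holomorphic_on A" for A unfolding K_def using R by (auto intro!: holomorphic_intros)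
    have holS: "S N holomorphic_on A" for A unfolding S_def by (auto intro!: holomorphic_intros)
    let ?A = "part_circlepath 0 R (-pi/2) (pi/2)" and ?A' = "part_circlepath 0 R (pi/2) (3*pi/2)"
    let ?L = "linepath (\<i> * of_real R) (- \<i> * of_real R)"
    have cisp: "cis (pi/2) = \<i>" "cis (-pi/2) = -\<i>" "cis (3*pi/2) = -\<i>"
    proof -
      have "cis (3*pi/2) = cis pi * cis (pi/2)" by (subst cis_mult) (simp add: field_simps)
      then show "cis (3*pi/2) = -\<i>" by simp
    qed (auto simp: complex_eq_iff)
    have ends: "pathstart ?A = - \<i> * of_real R" "pathfinish ?A = \<i> * of_real R"
        "pathstart ?A' = \<i> * of_real R" "pathfinish ?A' = - \<i> * of_real R"
      unfolding pathstart_part_circlepath pathfinish_part_circlepath cis_conv_exp[symmetric] cisp by simp_all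
    have arcA: "\<exists>t. z = of_real R * cis t \<and> cos t \<ge> 0" if "z \<in> path_image ?A" for z
    proof -
      from that obtain t where "t \<in> closed_segment (-pi/2) (pi/2)" "z = of_real R * cis t"
        unfolding path_image_part_circlepath' by (auto simp: cis_conv_exp)
      then show ?thesis by (intro exI[of _ t]) (auto simp: closed_segment_eq_real_ivl split: if_splits intro!:
          cos_ge_zero)
    qed
    have arcA': "\<exists>t. z = of_real R * cis t \<and> cos t \<le> 0" if "z \<in> path_image ?A'" for z
    proof -
      from that obtain t where t: "t \<in> closed_segment (pi/2) (3*pi/2)" "z = of_real R * cis t"
        unfolding path_image_part_circlepath' by (auto simp: cis_conv_exp)
      have "- (pi/2) \<le> t - pi" "t - pi \<le> pi/2" using t(1)
          by (auto simp: closed_segment_eq_real_ivl split: if_splits)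
      then have "cos (t - pi) \<ge> 0" by (intro cos_ge_zero) auto
      then show ?thesis using t by (intro exI[of _ t]) (auto simp: cos_diff)
    qed
    have kern: "norm (K z / z) = real N powr (Re z) * (2 * \<bar>Re z\<bar> / R\<^sup>2)" if "z = of_real R * cis t" for z t
    proof -
      have nz: "norm z = R" using that R by (simp add: norm_mult)
      then have z0: "z \<noteq> 0" using R by auto
      have "z * cnj z = of_real (R\<^sup>2)" using nz by (simp add: complex_norm_square[symmetric] del: of_real_power)
      then have "1 + z\<^sup>2 / of_real (R\<^sup>2) = z * (cnj z + z) / of_real (R\<^sup>2)"
        using R by (simp add: field_simps power2_eq_square)
      then have "K z / z = (of_real (2 * Re z) / of_real (R\<^sup>2)) * exp (z * of_real (ln (real N)))"
        using z0 by (simp add: K_def complex_add_cnj add.commute)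
      then show ?thesis using N by (simp add: norm_mult norm_divide norm_power norm_exp_eq_Re powr_def
          mult.commute abs_mult)
    qed
    \<comment> \<open>Right half circle and imaginary segment: \<open>H * K\<close> is holomorphic inside, so the two integrals cancel.\<close>
    have holHK: "(\<lambda>z. H z * K z) holomorphic_on V" using holH holK by (intro holomorphic_intros)
    have pA: "path_image ?A \<subseteq> {z. Re z \<ge> 0}" using arcA R by force
    have pL: "path_image ?L \<subseteq> {z. Re z \<ge> 0}" by (auto simp: closed_segment_def)
    have cHK: "continuous_on {z. Re z \<ge> 0} (\<lambda>z. H z * K z)"
      using holHK V by (meson holomorphic_on_imp_continuous_on holomorphic_on_subset)
    have intA: "(\<lambda>z. H z * K z) contour_integrable_on ?A"
      using cHK pA by (intro contour_integrable_continuous_part_circlepath continuous_on_subset[OF cHK])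
    have intL: "(\<lambda>z. H z * K z) contour_integrable_on ?L"
      using cHK pL by (intro contour_integrable_continuous_linepath continuous_on_subset[OF cHK]) auto
    have "((\<lambda>z. H z * K z) has_contour_integral 0) (?A +++ ?L)"
    proof (rule Cauchy_theorem_convex[where S = "{z. Re z \<ge> 0}" and K = "{}"])
      show "convex {z. Re z \<ge> 0}" by (rule convex_halfspace_Re_ge)
      fix x assume "x \<in> interior {z. Re z \<ge> 0} - {}"
      then have "x \<in> V" using V interior_subset by blast
      then show "(\<lambda>z. H z * K z) field_differentiable at x"
        using holHK V by (meson holomorphic_on_imp_differentiable_at)
    qed (use cHK pA pL ends in \<open>auto intro!: valid_path_join simp: path_image_join\<close>)
    then have z1: "contour_integral ?A (\<lambda>z. H z * K z) + contour_integral ?L (\<lambda>z. H z * K z) = 0"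
      using contour_integral_join[OF intA intL] ends by (simp add: contour_integral_unique)
    \<comment> \<open>Full circle: subtracting the value at \<open>0\<close> removes the pole of \<open>S N z * K z / z\<close>; each half circle contributes \<open>\<i> \<pi>\<close> times that value.\<close>
    define P where "P z = (if z = 0 then deriv (\<lambda>z. S N z * K z) 0 else (S N z * K z - S N 0 * K 0) /
        (z - 0))" for z
    have holP: "P holomorphic_on UNIV" unfolding P_def
      by (rule pole_lemma) (auto intro!: holomorphic_intros holS holK)
    have cP: "continuous_on A P" for A
      using holP holomorphic_on_imp_continuous_on continuous_on_subset by blast
    have intPA: "P contour_integrable_on ?A" "P contour_integrable_on ?A'"
      using cP by (auto intro!: contour_integrable_continuous_part_circlepath)
    have "(P has_contour_integral 0) (?A +++ ?A')"
      by (rule Cauchy_theorem_convex[where S = UNIV and K = "{}"])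
         (use holP cP ends in \<open>auto intro!: valid_path_join simp: holomorphic_on_def\<close>)
    then have z2: "contour_integral ?A P + contour_integral ?A' P = 0"
      using contour_integral_join[OF intPA] ends by (simp add: contour_integral_unique)
    have K0: "K 0 = 1" by (simp add: K_def)
    have inv: "((\<lambda>z. 1 / z) has_contour_integral (\<i> * of_real pi)) (part_circlepath 0 R u v)" if "v = u + pi"
        for u v
    proof -
      have "((\<lambda>t. 1 / (0 + of_real R * cis t) * of_real R * \<i> * cis t) has_integral (\<i> * of_real pi)) {u..v}"
      proof -
        have "((\<lambda>t::real. \<i>) has_integral (v - u) *\<^sub>R \<i>) {u..v}"
          using has_integral_const_real[of \<i> u v] that by simp
        moreover have "(v - u) *\<^sub>R \<i> = \<i> * of_real pi" using that by (simp add: scaleR_conv_of_real)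
        ultimately show ?thesis using R by (simp add: field_simps)
      qed
      then show ?thesis using that by (subst has_contour_integral_part_circlepath_iff) (auto simp: cis_conv_exp)
    qed
    have Pz: "P z = S N z * K z / z - s N * (1 / z)" if "z \<noteq> 0" for z
      using that by (simp add: P_def S0 K0 diff_divide_distrib)
    have nzA: "z \<noteq> 0" if "z \<in> path_image ?A \<or> z \<in> path_image ?A'" for z
      using that arcA arcA' R by fastforce
    have intS: "(\<lambda>z. S N z * K z / z) contour_integrable_on ?A" "(\<lambda>z. S N z * K z / z) contour_integrable_on
        ?A'"
      by (intro contour_integrable_continuous_part_circlepath continuous_on_divide continuous_on_mult
          continuous_on_id
           holomorphic_on_imp_continuous_on[OF holS] holomorphic_on_imp_continuous_on[OF holK]; use nzA in
               blast)+
    have eqA: "contour_integral ?A P = contour_integral ?A (\<lambda>z. S N z * K z / z) - s N * (\<i> * of_real pi)"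
    proof -
      have "((\<lambda>z. S N z * K z / z - s N * (1 / z)) has_contour_integral contour_integral ?A (\<lambda>z. S N z
          * K z / z) - s N * (\<i> * of_real pi)) ?A"
        by (intro has_contour_integral_diff has_contour_integral_integral[OF intS(1)]
            has_contour_integral_lmul inv) simp
      then have "(P has_contour_integral contour_integral ?A (\<lambda>z. S N z * K z / z) - s N * (\<i> * of_real pi)) ?A"
        by (rule has_contour_integral_eq) (use Pz nzA in auto)
      then show ?thesis by (rule contour_integral_unique)
    qed
    have eqA': "contour_integral ?A' P = contour_integral ?A' (\<lambda>z. S N z * K z / z) - s N * (\<i> * of_real pi)"
    proof -
      have "((\<lambda>z. S N z * K z / z - s N * (1 / z)) has_contour_integral contour_integral ?A' (\<lambda>z. S N z
          * K z / z) - s N * (\<i> * of_real pi)) ?A'"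
        by (intro has_contour_integral_diff has_contour_integral_integral[OF intS(2)]
            has_contour_integral_lmul inv) (simp add: field_simps)
      then have "(P has_contour_integral contour_integral ?A' (\<lambda>z. S N z * K z / z) - s N * (\<i> * of_real pi))
          ?A'"
        by (rule has_contour_integral_eq) (use Pz nzA in auto)
      then show ?thesis by (rule contour_integral_unique)
    qed
    have intD: "(\<lambda>z. S N z * K z / z - H z * K z) contour_integrable_on ?A"
      using intS(1) intA by (rule contour_integrable_diff)
    have "2 * (s N * (\<i> * of_real pi)) = contour_integral ?A (\<lambda>z. S N z * K z / z)
        + contour_integral ?A' (\<lambda>z. S N z * K z / z)"
      using z2 unfolding eqA eqA' by (simp add: algebra_simps)
    also have "contour_integral ?A (\<lambda>z. S N z * K z / z)
        = contour_integral ?A (\<lambda>z. S N z * K z / z - H z * K z) - contour_integral ?L (\<lambda>z. H z * K z)"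
      using contour_integral_diff[OF intS(1) intA] z1 by (simp add: algebra_simps add_eq_0_iff)
    finally have id: "2 * (s N * (\<i> * of_real pi)) = contour_integral ?A (\<lambda>z. S N z * K z / z - H z * K z)
       - contour_integral ?L (\<lambda>z. H z * K z) + contour_integral ?A' (\<lambda>z. S N z * K z / z)" .
    have tail: "norm (S N z - G z) \<le> C * (real N powr (- Re z) / Re z)" if z: "Re z > 0" for z
    proof -
      let ?t = "\<lambda>m. a m * of_nat m powr (-1-z)"
      have "?t sums G z" using sums[of "1+z"] z by (simp add: G_def algebra_simps)
      then have "(\<lambda>m. ?t (m + Suc N)) sums (G z - (\<Sum>m<Suc N. ?t m))"
        by (rule sums_split_initial_segment)
      moreover have "(\<Sum>m<Suc N. ?t m) = S N z"
        unfolding S_def lessThan_Suc_atMost atMost_atLeast0 by (simp add: sum.atLeast_Suc_atMost)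
      ultimately have 1: "(\<lambda>m. ?t (m + Suc N)) sums (G z - S N z)" by simp
      have 2: "(\<lambda>m. C * ((real (m + N) powr (-Re z) - real (Suc m + N) powr (-Re z)) / Re z))
          sums (C * (real N powr (-Re z) / Re z))"
        by (intro sums_mult powr_tail_sums z N)
      have "norm (?t (m + Suc N)) \<le> C * ((real (m + N) powr (-Re z) - real (Suc m + N) powr (-Re z)) / Re z)"
          for m
      proof -
        have "norm (?t (m + Suc N)) = norm (a (m + Suc N)) * real (m + Suc N) powr (-1 - Re z)"
          unfolding norm_mult by (subst norm_nat_powr) auto
        also have "\<dots> \<le> C * ((real (m + N) powr (-Re z) - real (Suc m + N) powr (-Re z)) / Re z)"
          using powr_tail_sums(2)[OF z N, of m] bd[of "m + Suc N"] C by (intro mult_mono) auto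
        finally show ?thesis .
      qed
      from norm_sums_le[OF 1 2 this] show ?thesis by (simp add: norm_minus_commute)
    qed
    have head: "norm (S N z) \<le> C * (real N powr (- Re z) / (- Re z) + real N powr (- Re z - 1))"
        if z: "Re z < 0" for z
    proof -
      have "norm (S N z) \<le> (\<Sum>m=1..N. C * real m powr (- Re z - 1))"
        unfolding S_def
      proof (rule sum_norm_le)
        fix m assume "m \<in> {1..N}"
        then show "norm (a m * of_nat m powr (-1-z)) \<le> C * real m powr (- Re z - 1)"
          using bd[of m] by (subst norm_mult, subst norm_nat_powr) (auto simp: minus_diff_commute intro!:
              mult_right_mono)
      qed
      also have "\<dots> \<le> C * (real N powr (- Re z) / (- Re z) + real N powr (- Re z - 1))"
        unfolding sum_distrib_left[symmetric] using z N C by (intro mult_left_mono sum_nat_powr_le) auto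
      finally show ?thesis .
    qed
    have b1: "norm (contour_integral ?A (\<lambda>z. S N z * K z / z - H z * K z))
        \<le> (2 * C / R\<^sup>2) * R * \<bar>pi/2 - (-pi/2)\<bar>"
    proof (rule contour_integral_bound_part_circlepath[OF intD])
      fix z assume "z \<in> path_image ?A"
      then obtain t where t: "z = of_real R * cis t" "cos t \<ge> 0" using arcA by blast
      have z0: "z \<noteq> 0" using t R by auto
      have "S N z * K z / z - H z * K z = (S N z - G z) * (K z / z)"
        using z0 by (simp add: H_def G0 field_simps)
      moreover have "norm ((S N z - G z) * (K z / z)) \<le> 2 * C / R\<^sup>2"
      proof (cases "cos t = 0")
        case True
        then have "norm (K z / z) = 0" using kern[OF t(1)] t by simp
        then have kz: "K z / z = 0" by (simp only: norm_eq_zero)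
        show ?thesis unfolding kz using C by simp
      next
        case False
        then have rz: "Re z > 0" using t R by auto
        have "norm ((S N z - G z) * (K z / z))
            \<le> C * (real N powr (- Re z) / Re z) * (real N powr (Re z) * (2 * \<bar>Re z\<bar> / R\<^sup>2))"
          unfolding norm_mult[of "S N z - G z"] kern[OF t(1)] using tail[OF rz] by (intro mult_right_mono) auto
        also have "\<dots> = 2 * C / R\<^sup>2" using rz N by (simp add: powr_minus field_simps)
        finally show ?thesis .
      qed
      ultimately show "norm (S N z * K z / z - H z * K z) \<le> 2 * C / R\<^sup>2" by simp
    qed (use R C in auto)
    have b2: "norm (contour_integral ?A' (\<lambda>z. S N z * K z / z))
        \<le> (2 * C / R\<^sup>2 + 2 * C / (R * real N)) * R * \<bar>3*pi/2 - pi/2\<bar>"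
    proof (rule contour_integral_bound_part_circlepath[OF intS(2)])
      fix z assume "z \<in> path_image ?A'"
      then obtain t where t: "z = of_real R * cis t" "cos t \<le> 0" using arcA' by blast
      have z0: "z \<noteq> 0" using t R by auto
      have nn: "0 \<le> 2 * C / R\<^sup>2 + 2 * C / (R * real N)" using C R by simp
      have "norm (S N z * (K z / z)) \<le> 2 * C / R\<^sup>2 + 2 * C / (R * real N)"
      proof (cases "cos t = 0")
        case True
        then have "norm (K z / z) = 0" using kern[OF t(1)] t by simp
        then have kz: "K z / z = 0" by (simp only: norm_eq_zero)
        show ?thesis unfolding kz using nn by simp
      next
        case False
        then have rz: "Re z < 0" using t R by (auto simp: mult_less_0_iff)
        have "norm z = R" using t R by (simp add: norm_mult)
        then have rR: "- Re z \<le> R" using abs_Re_le_cmod[of z] by linarith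
        have "norm (S N z * (K z / z)) \<le> C * (real N powr (- Re z) / (- Re z) + real N powr (- Re z - 1))
            * (real N powr (Re z) * (2 * \<bar>Re z\<bar> / R\<^sup>2))"
          unfolding norm_mult[of "S N z"] kern[OF t(1)] using head[OF rz] by (intro mult_right_mono) auto
        also have "\<dots> = 2 * C / R\<^sup>2 + 2 * C * (- Re z) / (R\<^sup>2 * real N)"
          using rz N R by (simp add: powr_minus powr_diff field_simps)
        also have "2 * C * (- Re z) / (R\<^sup>2 * real N) \<le> 2 * C * R / (R\<^sup>2 * real N)"
          using rR C by (intro divide_right_mono mult_left_mono) auto
        also have "2 * C * R / (R\<^sup>2 * real N) = 2 * C / (R * real N)" using R by (simp add: power2_eq_square)
        finally show ?thesis by simp
      qed
      then show "norm (S N z * K z / z) \<le> 2 * C / R\<^sup>2 + 2 * C / (R * real N)" by simp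
    qed (use R C in auto)
    let ?I = "contour_integral ?L (\<lambda>z. (H z * (1 + z\<^sup>2 / of_real (R\<^sup>2))) * exp (z * of_real (ln (real N))))"
    have IL: "contour_integral ?L (\<lambda>z. H z * K z) = ?I" by (simp add: K_def mult.assoc)
    have "norm (2 * (s N * (\<i> * of_real pi)))
        \<le> (2 * C / R\<^sup>2) * R * \<bar>pi/2 - (-pi/2)\<bar> + norm ?I + (2 * C / R\<^sup>2 + 2 * C / (R * real N)) * R * \<bar>3*pi/2
        - pi/2\<bar>"
      unfolding id IL by (intro order_trans[OF norm_triangle_ineq] order_trans[OF norm_triangle_ineq4]
          add_mono b1 b2 order_refl)
    also have "(2 * C / R\<^sup>2) * R * \<bar>pi/2 - (-pi/2)\<bar> = 2 * pi * (C / R)"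
      using R by (simp add: power2_eq_square)
    also have "(2 * C / R\<^sup>2 + 2 * C / (R * real N)) * R * \<bar>3*pi/2 - pi/2\<bar> = 2 * pi * (C / R + C / real N)"
    proof -
      have "\<bar>3*pi/2 - pi/2\<bar> = pi" by simp
      moreover have "(2 * C / R\<^sup>2 + 2 * C / (R * real N)) * R = 2 * (C / R + C / real N)"
        using R N by (simp add: distrib_right power2_eq_square)
      ultimately show ?thesis by simp
    qed
    finally have "norm (2 * (s N * (\<i> * of_real pi)))
        \<le> 2 * pi * (C / R) + norm ?I + 2 * pi * (C / R + C / real N)" .
    moreover have "norm (2 * (s N * (\<i> * of_real pi))) = 2 * pi * norm (s N)"
      by (simp add: norm_mult)
    moreover have "2 * pi * (C / R) + x + 2 * pi * (C / R + C / real N)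
        = 2 * pi * (2 * C / R + C / real N) + x" for x
      by (simp add: algebra_simps)
    ultimately have "2 * pi * norm (s N) \<le> 2 * pi * (2 * C / R + C / real N) + norm ?I"
      by (simp only:)
    also have "\<dots> \<le> 2 * pi * (2 * C / R + C / real N) + 2 * pi * norm ?I"
      using pi_ge_two by (intro add_mono order_refl) (simp add: mult_le_cancel_right1)
    finally have "2 * pi * norm (s N) \<le> 2 * pi * (2 * C / R + C / real N + norm ?I)"
        by (simp only: distrib_left)
    then show ?thesis by (rule mult_left_le_imp_le) simp
  qed
  have "s \<longlonglongrightarrow> 0"
  proof (rule LIMSEQ_I, goal_cases)
    case (1 e)
    \<comment> \<open>This radius makes the contribution of the arcs at most \<open>e / 3\<close>.\<close>
    define R where "R = 6 * (C + 1) / e"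
    have R: "R > 0" "2 * C / R \<le> e / 3" using 1 C by (auto simp: R_def field_simps)
    have seg: "closed_segment (\<i> * of_real R) (- \<i> * of_real R) \<subseteq> V"
      using V by (auto simp: closed_segment_def)
    have "(\<lambda>N. C / real N) \<longlonglongrightarrow> 0" by (rule lim_const_over_n)
    then have e1: "\<forall>\<^sub>F N in sequentially. C / real N < e / 3" using 1 by (intro order_tendstoD) auto
    have "(\<lambda>N. norm (contour_integral (linepath (\<i> * of_real R) (- \<i> * of_real R))
        (\<lambda>z. (H z * (1 + z\<^sup>2 / of_real (R\<^sup>2))) * exp (z * of_real (ln (real N)))))) \<longlonglongrightarrow> 0"
      using R seg by (intro tendsto_norm_zero riemann_lebesgue_linepath[OF V(1)] holomorphic_intros holH) auto
    then have e2: "\<forall>\<^sub>F N in sequentially. norm (contour_integral (linepath (\<i> * of_real R) (- \<i> * of_real R))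
        (\<lambda>z. (H z * (1 + z\<^sup>2 / of_real (R\<^sup>2))) * exp (z * of_real (ln (real N))))) < e / 3"
      using 1 by (intro order_tendstoD) auto
    have "\<forall>\<^sub>F N in sequentially. norm (s N - 0) < e"
      using e1 e2 eventually_ge_at_top[of 1]
    proof eventually_elim
      case (elim N)
      have "norm (s N) < e" using bound[OF R(1) elim(3)] R(2) elim(1,2) by linarith
      then show ?case by simp
    qed
    then show ?case by (simp add: eventually_sequentially)
  qed
  moreover have "s = (\<lambda>N. \<Sum>m\<le>N. a m / of_nat m)"
    unfolding s_def atMost_atLeast0 by (rule ext) (simp add: sum.atLeast_Suc_atMost)
  ultimately show ?thesis unfolding sums_def_le by simp
qed

text \<open>
  Changing the coefficient of index one by \<open>F 1\<close> reduces to a function that vanishes at \<open>1\<close>.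
\<close>

theorem newman_tauberian:
  fixes a :: "nat \<Rightarrow> complex"
  assumes bd: "\<And>m. norm (a m) \<le> C" and U: "open U" "{s. Re s \<ge> 1} \<subseteq> U" and hol: "F holomorphic_on U"
    and sums: "\<And>s. Re s > 1 \<Longrightarrow> (\<lambda>m. a m * of_nat m powr (-s)) sums F s"
  shows "(\<lambda>m. a m / of_nat m) sums F 1"
proof -
  define b where "b m = a m - (if m = 1 then F 1 else 0)" for m
  have *: "(\<lambda>m. (if m = 1 then F 1 else 0) * of_nat m powr (-s)) sums F 1" for s
  proof -
    have "(\<lambda>m. (if m = 1 then F 1 else 0) * of_nat m powr (-s))
        = (\<lambda>m. if m = 1 then F 1 * of_nat m powr (-s) else 0)" by auto
    then show ?thesis using sums_single[of 1 "\<lambda>m. F 1 * of_nat m powr (-s)"] by simp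
  qed
  have "(\<lambda>m. b m / of_nat m) sums 0"
  proof (rule newman_zero[where F = "\<lambda>s. F s - F 1"])
    show "norm (b m) \<le> C + norm (F 1)" for m
      using bd[of m] norm_triangle_ineq4[of "a m" "F 1"] by (auto simp: b_def intro: order_trans)
    show "(\<lambda>m. b m * of_nat m powr (-s)) sums (F s - F 1)" if "Re s > 1" for s
      using sums_diff[OF sums[OF that] *[of s]] by (simp add: b_def algebra_simps)
  qed (use U hol in \<open>auto intro!: holomorphic_intros\<close>)
  moreover have "(\<lambda>m. (if m = 1 then F 1 else 0) / of_nat m) sums F 1"
  proof -
    have "(\<lambda>m. (if m = 1 then F 1 else 0) / of_nat m) = (\<lambda>m. if m = 1 then F 1 / of_nat m else 0)" by auto
    then show ?thesis using sums_single[of 1 "\<lambda>m. F 1 / of_nat m"] by simp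
  qed
  ultimately show ?thesis using sums_add by (fastforce simp: b_def diff_divide_distrib)
qed

section \<open>The Moebius function and Dirichlet convolution\<close>

lemma moebius_mu_prime_mult:
  assumes "prime p" "\<not> p dvd d" "d > 0"
  shows "moebius_mu (p * d) = - moebius_mu d"
proof -
  have cop: "coprime p d" using assms by (simp add: prime_imp_coprime)
  have "squarefree (p * d) \<longleftrightarrow> squarefree d"
    using squarefree_mult_coprime[OF cop squarefree_prime[OF assms(1)]] squarefree_multD(2) by blast
  moreover have "prime_factors (p * d) = insert p (prime_factors d)"
    using assms by (subst prime_factors_product) (auto simp: prime_prime_factors)
  moreover have "p \<notin> prime_factors d" using assms by auto
  ultimately show ?thesis by (simp add: moebius_mu_def)
qed

text \<open>
  For a prime \<open>p\<close> dividing \<open>N\<close>, the divisors \<open>d\<close> not divisible by \<open>p\<close> cancel against the divisors \<open>p * d\<close>, and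
  \<open>\<mu>\<close> vanishes on those divisible by \<open>p\<^sup>2\<close>.
\<close>

lemma moebius_mu_sum_divisors:
  assumes "N > 0"
  shows "(\<Sum>d | d dvd N. moebius_mu d) = (if N = 1 then 1 else 0)"
proof (cases "N = 1")
  case True
  then show ?thesis by (simp add: moebius_mu_def)
next
  case False
  then obtain p where p: "prime p" "p dvd N" using prime_factor_nat by blast
  have fin: "finite {d. d dvd N}" using assms by simp
  define A where "A = {d. d dvd N \<and> \<not> p dvd d}"
  have finA: "finite A" using fin by (rule rev_finite_subset) (auto simp: A_def)
  have sub: "A \<union> (\<lambda>d. p * d) ` A \<subseteq> {d. d dvd N}"
  proof -
    have "p * d dvd N" if "d \<in> A" for d
    proof -
      have "coprime p d" using that p by (simp add: A_def prime_imp_coprime)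
      then show ?thesis using that p by (auto simp: A_def intro: divides_mult)
    qed
    then show ?thesis by (auto simp: A_def)
  qed
  have "(\<Sum>d | d dvd N. moebius_mu d) = sum moebius_mu (A \<union> (\<lambda>d. p * d) ` A)"
  proof (rule sum.mono_neutral_right[OF fin sub], intro ballI)
    fix d assume d: "d \<in> {d. d dvd N} - (A \<union> (\<lambda>d. p * d) ` A)"
    then have "p dvd d" by (auto simp: A_def)
    then obtain e where e: "d = p * e" by blast
    then have "e \<notin> A" using d by auto
    moreover have "e dvd N" using d e by (auto dest: dvd_mult_right)
    ultimately have "p dvd e" by (auto simp: A_def)
    then have "p ^ 2 dvd d" using e by (auto simp: power2_eq_square)
    then have "\<not> squarefree d" using p not_prime_1 by (intro not_squarefreeI) (auto simp: prime_nat_iff)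
    then show "moebius_mu d = 0" by (simp add: moebius_mu_def)
  qed
  also have "\<dots> = sum moebius_mu A + sum moebius_mu ((\<lambda>d. p * d) ` A)"
    using finA by (intro sum.union_disjoint) (auto simp: A_def)
  also have "sum moebius_mu ((\<lambda>d. p * d) ` A) = (\<Sum>d\<in>A. moebius_mu (p * d))"
    using p by (subst sum.reindex) (auto simp: inj_on_def prime_gt_0_nat)
  also have "\<dots> = (\<Sum>d\<in>A. - moebius_mu d)"
  proof (rule sum.cong)
    fix d assume "d \<in> A"
    then have "d > 0" "\<not> p dvd d" using assms by (auto simp: A_def intro: Nat.gr0I)
    then show "moebius_mu (p * d) = - moebius_mu d" using p by (intro moebius_mu_prime_mult)
  qed simp
  finally show ?thesis using False by (simp add: sum_negf)
qed

lemma abs_moebius_mu_le_1: "\<bar>moebius_mu d\<bar> \<le> 1"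
  by (simp add: moebius_mu_def power_abs)

lemma moebius_bounded:
  assumes "\<And>a. norm (f a) \<le> C"
  shows "norm (of_int (moebius_mu m) * f (int m) :: complex) \<le> C"
proof -
  have "norm (of_int (moebius_mu m) :: complex) \<le> 1" using abs_moebius_mu_le_1[of m] by simp
  then show ?thesis using assms[of "int m"] mult_mono[of "norm (of_int (moebius_mu m) :: complex)" 1
      "norm (f (int m))" C]
    by (simp add: norm_mult)
qed

text \<open>
  Phrased with \<open>d * (N div d)\<close> because this is the form in which the terms of a product of two series appear.
\<close>

lemma moebius_inversion_at:
  fixes h :: "nat \<Rightarrow> complex"
  assumes "N > 0"
  shows "(\<Sum>d | d dvd N. of_int (moebius_mu d) * h (d * (N div d))) = (if N = 1 then h 1 else 0)"
proof -
  have "(\<Sum>d | d dvd N. of_int (moebius_mu d) * h (d * (N div d))) = (\<Sum>d | d dvd N. of_int (moebius_mu d) * h N)"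
    by (rule sum.cong) auto
  also have "\<dots> = of_int (\<Sum>d | d dvd N. moebius_mu d) * h N" by (simp add: sum_distrib_right)
  finally show ?thesis using moebius_mu_sum_divisors[OF assms] by simp
qed

lemma has_sum_times:
  fixes f :: "'a \<Rightarrow> complex" and g :: "'b \<Rightarrow> complex"
  assumes f: "f abs_summable_on A" "(f has_sum a) A" and g: "g abs_summable_on B" "(g has_sum b) B"
  shows "((\<lambda>(x, y). f x * g y) has_sum (a * b)) (A \<times> B)"
proof (rule has_sum_SigmaI)
  fix x assume "x \<in> A"
  show "((\<lambda>y. case (x, y) of (x, y) \<Rightarrow> f x * g y) has_sum (f x * b)) B"
    using has_sum_cmult_right[OF g(2), of "f x"] by simp
next
  show "((\<lambda>x. f x * b) has_sum a * b) A" by (rule has_sum_cmult_left[OF f(2)])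
  have "(\<lambda>(x, y). f x * g y) abs_summable_on (A \<times> B)"
    unfolding Infinite_Sum.abs_summable_on_Sigma_iff
  proof (intro conjI ballI)
    fix x assume "x \<in> A"
    show "(\<lambda>y. case (x, y) of (x, y) \<Rightarrow> f x * g y) abs_summable_on B"
      using summable_on_cmult_right[OF g(1), of "norm (f x)"] by (simp add: norm_mult)
  next
    have "(\<lambda>x. norm (f x) * infsum (\<lambda>y. norm (g y)) B) summable_on A"
      by (rule summable_on_cmult_left[OF f(1)])
    then show "(\<lambda>x. \<Sum>\<^sub>\<infinity>y\<in>B. norm (case (x, y) of (x, y) \<Rightarrow> f x * g y)) abs_summable_on A"
      by (simp add: norm_mult infsum_cmult_right' abs_mult infsum_nonneg)
  qed
  then show "(\<lambda>(x, y). f x * g y) summable_on (A \<times> B)" by (rule abs_summable_summable)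
qed

text \<open>
  Pairs of positive integers are the same as pairs of a positive integer and one of its divisors.
\<close>

lemma has_sum_over_products:
  fixes g :: "nat \<times> nat \<Rightarrow> complex"
  assumes "(g has_sum S) ({1..} \<times> {1..})"
  shows "((\<lambda>N. \<Sum>d | d dvd N. g (d, N div d)) has_sum S) {1..}"
proof -
  have bij: "bij_betw (\<lambda>(N, d). (d, N div d)) (Sigma {1::nat..} (\<lambda>N. {d. d dvd N})) ({1::nat..} \<times> {1::nat..})"
    by (rule bij_betwI[where g = "\<lambda>(d, e). (d * e, d)"])
       (auto simp: Suc_le_eq dvd_div_eq_0_iff intro: Nat.gr0I)
  have "((\<lambda>x. g (case x of (N, d) \<Rightarrow> (d, N div d))) has_sum S) (Sigma {1..} (\<lambda>N. {d. d dvd N}))"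
    using assms by (subst has_sum_reindex_bij_betw[OF bij])
  then show ?thesis
    by (rule has_sum_Sigma') (auto intro!: has_sum_finiteI)
qed

lemma sums_imp_has_sum_positive:
  fixes f :: "nat \<Rightarrow> complex"
  assumes "summable (\<lambda>m. norm (f m))" "f sums S" "f 0 = 0"
  shows "(f has_sum S) {1..}" "f abs_summable_on {1..}"
proof -
  have "(f has_sum S) UNIV" using assms norm_summable_imp_has_sum by blast
  moreover have "(f has_sum S) UNIV \<longleftrightarrow> (f has_sum S) {1..}"
    by (rule has_sum_cong_neutral) (use assms in \<open>auto simp: not_le\<close>)
  ultimately show "(f has_sum S) {1..}" by simp
  have "(\<lambda>m. norm (f m)) summable_on UNIV" using assms(1)
    by (intro norm_summable_imp_summable_on) simp
  then show "f abs_summable_on {1..}" using summable_on_subset_banach by blast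
qed

lemma dirichlet_product:
  fixes a b :: "nat \<Rightarrow> complex"
  assumes "summable (\<lambda>m. norm (a m * of_nat m powr (-s)))" "(\<lambda>m. a m * of_nat m powr (-s)) sums A"
    and "summable (\<lambda>m. norm (b m * of_nat m powr (-s)))" "(\<lambda>m. b m * of_nat m powr (-s)) sums B"
  shows "(\<lambda>N. (\<Sum>d | d dvd N. a d * b (N div d)) * of_nat N powr (-s)) sums (A * B)"
proof -
  let ?f = "\<lambda>N. (\<Sum>d | d dvd N. a d * b (N div d)) * of_nat N powr (-s)"
  note a = sums_imp_has_sum_positive[OF assms(1,2)] and b = sums_imp_has_sum_positive[OF assms(3,4)]
  have "((\<lambda>N. \<Sum>d | d dvd N. (case (d, N div d) of (x, y) \<Rightarrow> (a x * of_nat x powr (-s))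
      * (b y * of_nat y powr (-s)))) has_sum (A * B)) {1..}"
    by (intro has_sum_over_products has_sum_times a b) auto
  moreover have "(\<Sum>d | d dvd N. (case (d, N div d) of (x, y) \<Rightarrow> (a x * of_nat x powr (-s))
      * (b y * of_nat y powr (-s)))) = ?f N"
    if "N \<in> {1..}" for N
  proof -
    have "(a d * of_nat d powr (-s)) * (b (N div d) * of_nat (N div d) powr (-s))
        = a d * b (N div d) * of_nat N powr (-s)" if "d dvd N" for d
    proof -
      have "(of_nat N :: complex) = of_nat d * of_nat (N div d)" using that by (simp flip: of_nat_mult)
      then have "of_nat N powr (-s) = of_nat d powr (-s) * of_nat (N div d) powr (-s)"
        by (simp only: powr_times_real Reals_of_nat complex_Re_of_nat of_nat_0_le_iff)
      then show ?thesis by (simp only: mult_ac)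
    qed
    then show ?thesis unfolding sum_distrib_right prod.case by (intro sum.cong) auto
  qed
  ultimately have "(?f has_sum (A * B)) {1..}" by (subst (asm) has_sum_cong) auto
  moreover have "(?f has_sum (A * B)) UNIV \<longleftrightarrow> (?f has_sum (A * B)) {1..}"
    by (rule has_sum_cong_neutral) (auto simp: not_le)
  ultimately show ?thesis by (intro has_sum_imp_sums) simp
qed

lemma summable_dirichlet_bounded:
  fixes a :: "nat \<Rightarrow> complex"
  assumes "\<And>m. norm (a m) \<le> C" "Re s > 1"
  shows "summable (\<lambda>m. norm (a m * of_nat m powr (-s)))"
proof (rule summable_comparison_test')
  show "summable (\<lambda>m. C * real m powr (- Re s))"
    using assms(2) by (intro summable_mult) (simp add: summable_real_powr_iff)
  fix m :: nat
  have C: "C \<ge> 0" using assms(1)[of 0] by (meson norm_ge_zero order_trans)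
  show "norm (norm (a m * of_nat m powr (-s))) \<le> C * real m powr (- Re s)"
    using assms(1)[of m] by (cases "m = 0") (auto simp: norm_mult norm_nat_powr intro!: mult_right_mono)
qed

text \<open>
  Up to sign this is the derivative of the series with all coefficients one, taken at a real point.
\<close>

lemma summable_ln_dirichlet:
  assumes "Re s > 1"
  shows "summable (\<lambda>m. ln (real m) * real m powr (- Re s))"
proof -
  obtain F F' :: "complex \<Rightarrow> complex" where "\<And>s. Re s > 1 \<Longrightarrow> (\<lambda>m. 1 * of_nat m powr (-s)) sums F s"
    and F: "\<And>s. Re s > 1 \<Longrightarrow> (\<lambda>m. - of_real (ln (real m)) * 1 * of_nat m powr (-s)) sums F' s"
    by (rule dirichlet_series_half_plane[of "\<lambda>_. 1::complex" 1]) (simp, blast)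
  have "(\<lambda>m. - of_real (ln (real m)) * 1 * of_nat m powr (- of_real (Re s))) sums F' (of_real (Re s))"
    using assms by (intro F) auto
  from sums_minus[OF sums_Re[OF this]]
  have "summable (\<lambda>m. - Re (- of_real (ln (real m)) * 1 * of_nat m powr (- of_real (Re s))))"
    by (auto simp: sums_iff)
  moreover have "- Re (- of_real (ln (real m)) * 1 * of_nat m powr (- of_real (Re s)))
      = ln (real m) * real m powr (- Re s)" for m
  proof -
    have "(of_nat m powr (- of_real (Re s)) :: complex) = of_real (real m powr (- Re s))"
      using powr_of_real[of "real m" "- Re s"] by simp
    then show ?thesis by simp
  qed
  ultimately show ?thesis by (simp only:)
qed

lemma sum_lessThan_add:
  fixes f :: "nat \<Rightarrow> 'a :: comm_monoid_add"
  shows "sum f {..<a + b} = sum f {..<a} + (\<Sum>m<b. f (a + m))"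
  by (induction b) (auto simp: add.assoc)

lemma periodic_partial_sums_bounded:
  fixes f :: "nat \<Rightarrow> complex"
  assumes per: "\<And>m. f (m + n) = f m" and zero: "(\<Sum>m<n. f m) = 0" and n: "n > 0"
  shows "norm (\<Sum>m\<le>N. f m) \<le> (\<Sum>m<n. norm (f m))"
proof -
  have perq: "f (m + q * n) = f m" for m q
    by (induction q) (auto simp: add.commute[of n] add.assoc[symmetric] per)
  have block: "(\<Sum>m<q * n. f m) = 0" for q
  proof (induction q)
    case (Suc q)
    have "(\<Sum>m<Suc q * n. f m) = (\<Sum>m<q * n + n. f m)" by (simp add: add.commute)
    also have "\<dots> = (\<Sum>m<q*n. f m) + (\<Sum>m<n. f (q * n + m))" by (rule sum_lessThan_add)
    also have "(\<Sum>m<n. f (q * n + m)) = (\<Sum>m<n. f m)" using perq by (simp add: add.commute)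
    finally show ?case using Suc zero by simp
  qed simp
  define q r where "q = Suc N div n" and "r = Suc N mod n"
  have "Suc N = q * n + r" by (simp add: q_def r_def)
  then have "(\<Sum>m\<le>N. f m) = (\<Sum>m<q*n. f m) + (\<Sum>m<r. f (q * n + m))"
    by (simp only: lessThan_Suc_atMost[symmetric] sum_lessThan_add)
  also have "\<dots> = (\<Sum>m<r. f m)" using block perq by (simp add: add.commute)
  also have "norm \<dots> \<le> (\<Sum>m<r. norm (f m))" by (rule norm_sum)
  also have "\<dots> \<le> (\<Sum>m<n. norm (f m))" using n by (intro sum_mono2)
      (auto simp: r_def less_le_trans[OF _ less_imp_le])
  finally show ?thesis .
qed

text \<open>
  Compares \<open>m powr (-s)\<close> with its mean over \<open>[m, m + 1]\<close>, the means adding up to \<open>1 / (s - 1)\<close>. It controls the zeta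
  function for \<open>Re s > 1\<close> up to the boundary line, both at the pole and away from it.
\<close>

lemma zeta_near_1:
  assumes "Re s > 1" "(\<lambda>m. 1 * of_nat m powr (-s)) sums Z"
  shows "norm ((s - 1) * Z - 1) \<le> norm s * norm (s - 1) * (\<Sum>m. real m powr (-2))"
proof -
  define D where "D m = (of_nat m powr (1 - s) - of_nat (Suc m) powr (1 - s)) - (s - 1) * of_nat m powr (-s)"
      for m
  have sq: "summable (\<lambda>m. real m powr (-2))" by (simp add: summable_real_powr_iff)
  have bD: "norm (D m) \<le> norm s * norm (s - 1) * real m powr (-2)" if m: "m > 0" for m
  proof -
    let ?S = "closed_segment (of_real (real m)) (of_real (real (Suc m))) :: complex set"
    let ?h = "\<lambda>z. z powr (1 - s) + (s - 1) * of_nat m powr (-s) * z"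
    have "norm (?h (of_real (real m)) - ?h (of_real (real (Suc m))))
        \<le> (norm s * norm (s - 1) * real m powr (-2))
        * norm (of_real (real m) - of_real (real (Suc m)) :: complex)"
    proof (rule field_differentiable_bound[where S = ?S and f'
        = "\<lambda>z. (1 - s) * z powr (-s) + (s - 1) * of_nat m powr (-s)"])
      fix z assume "z \<in> ?S"
      then obtain t where t: "z = of_real t" "real m \<le> t" "t \<le> real m + 1"
        unfolding closed_segment_of_real by (auto simp: closed_segment_eq_real_ivl)
      then have "z \<notin> \<real>\<^sub>\<le>\<^sub>0" using m by auto
      then have "((\<lambda>z. z powr (1 - s)) has_field_derivative (1 - s) * z powr (1 - s - 1)) (at z within ?S)"
        by (intro has_field_derivative_powr has_field_derivative_at_within)
      from DERIV_add[OF this DERIV_cmult_Id[of "(s - 1) * of_nat m powr (-s)"]]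
      show "(?h has_field_derivative (1 - s) * z powr (-s) + (s - 1) * of_nat m powr (-s)) (at z within ?S)"
        by simp
      have "norm ((1 - s) * z powr (-s) + (s - 1) * of_nat m powr (-s))
          = norm (s - 1) * norm (of_real (real m) powr (-s) - of_real t powr (-s))"
        unfolding norm_mult[symmetric] t(1) by (rule arg_cong[of _ _ norm]) (simp add: algebra_simps)
      also have "\<dots> \<le> norm (s - 1) * (norm s * real m powr (-1 - Re s))"
        using assms t m by (intro mult_left_mono powr_neg_diff_bound) auto
      also have "\<dots> \<le> norm (s - 1) * (norm s * real m powr (-2))"
        using assms m by (intro mult_left_mono powr_mono) auto
      finally show "norm ((1 - s) * z powr (-s) + (s - 1) * of_nat m powr (-s))
          \<le> norm s * norm (s - 1) * real m powr (-2)"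
        by (simp only: mult_ac)
    qed auto
    moreover have "?h (of_real (real m)) - ?h (of_real (real (Suc m))) = D m"
      by (simp add: D_def algebra_simps)
    moreover have "norm (of_real (real m) - of_real (real (Suc m)) :: complex) = 1"
      by (simp flip: of_real_diff)
    ultimately show ?thesis by simp
  qed
  have lim: "(\<lambda>m. of_nat (Suc m) powr (1 - s) :: complex) \<longlonglongrightarrow> 0"
  proof (rule Lim_null_comparison)
    show "\<forall>\<^sub>F m in sequentially. norm (of_nat (Suc m) powr (1 - s) :: complex)
        \<le> real (Suc m) powr (- (Re s - 1))"
      unfolding norm_nat_powr[OF zero_less_Suc] by (auto intro!: always_eventually)
    show "(\<lambda>m. real (Suc m) powr (- (Re s - 1))) \<longlonglongrightarrow> 0"
      using assms by (intro tendsto_neg_powr filterlim_compose[OF filterlim_real_sequentially] filterlim_Suc)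
          auto
  qed
  have "(\<lambda>m. of_nat (Suc m) powr (1 - s) - of_nat (Suc (Suc m)) powr (1 - s) :: complex)
      sums (of_nat (Suc 0) powr (1 - s) - 0)"
    by (rule telescope_sums'[OF lim])
  then have 1: "(\<lambda>m. of_nat (Suc m) powr (1 - s) - of_nat (Suc (Suc m)) powr (1 - s) :: complex) sums 1" by simp
  have "(\<lambda>m. of_nat (Suc m) powr (-s)) sums Z"
    using assms(2) by (subst sums_Suc_iff) simp
  from sums_diff[OF 1 sums_mult[OF this, of "s - 1"]]
  have sD: "(\<lambda>m. D (Suc m)) sums (1 - (s - 1) * Z)" by (simp add: D_def)
  have sq': "(\<lambda>m. norm s * norm (s - 1) * real (Suc m) powr (-2))
      sums (norm s * norm (s - 1) * (\<Sum>m. real m powr (-2)))"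
  proof (rule sums_mult)
    show "(\<lambda>m. real (Suc m) powr (-2)) sums (\<Sum>m. real m powr (-2))"
      unfolding sums_Suc_iff[of "\<lambda>m. real m powr (-2)"] using summable_sums[OF sq] by simp
  qed
  have "norm (1 - (s - 1) * Z) \<le> norm s * norm (s - 1) * (\<Sum>m. real m powr (-2))"
    by (rule norm_sums_le[OF sD sq' bD]) simp
  then show ?thesis by (simp add: norm_minus_commute)
qed

section \<open>Dirichlet characters and their L-functions\<close>

text \<open>
  A character is viewed as a function on all integers, zero off the units modulo \<open>n\<close>.
\<close>

locale dirichlet_character =
  fixes n :: nat and ch :: "int \<Rightarrow> complex"
  assumes modulus: "n > 0"
    and mult: "ch (a * b) = ch a * ch b"
    and periodic: "[a = b] (mod int n) \<Longrightarrow> ch a = ch b"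
    and zero: "\<not> coprime a (int n) \<Longrightarrow> ch a = 0"
    and one: "ch 1 = 1"
begin

lemma power: "ch (a ^ k) = ch a ^ k"
  by (induction k) (auto simp: one mult)

text \<open>
  By Euler's theorem the value is a root of unity.
\<close>

lemma norm_coprime: "coprime a (int n) \<Longrightarrow> norm (ch a) = 1"
proof -
  assume c: "coprime a (int n)"
  define b where "b = nat (a mod int n)"
  have b: "[a = int b] (mod int n)" using modulus by (simp add: b_def cong_def)
  have "coprime b n" using c b modulus
    by (metis cong_imp_coprime coprime_int_iff)
  then have "[b ^ totient n = 1] (mod n)" by (rule euler_theorem)
  then have "[int b ^ totient n = 1] (mod int n)" by (metis cong_int_iff of_nat_1 of_nat_power)
  then have "ch (int b) ^ totient n = 1" using periodic one power by metis
  then have "norm (ch (int b)) ^ totient n = 1" by (metis norm_one norm_power)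
  then have "norm (ch (int b)) = 1" using modulus power_eq_iff_eq_base[of "totient n" "norm (ch (int b))" 1]
      by simp
  then show ?thesis using periodic[OF b] by simp
qed

lemma norm_le_1: "norm (ch a) \<le> 1"
  using norm_coprime[of a] zero[of a] by (cases "coprime a (int n)") auto

definition L :: "complex \<Rightarrow> complex" where
  "L s = (\<Sum>m. ch (int m) * of_nat m powr (-s))"

lemma norm_summable: "Re s > 1 \<Longrightarrow> summable (\<lambda>m. norm (ch (int m) * of_nat m powr (-s)))"
  by (rule summable_dirichlet_bounded[of _ 1]) (auto intro: norm_le_1)

lemma L_sums: "Re s > 1 \<Longrightarrow> (\<lambda>m. ch (int m) * of_nat m powr (-s)) sums L s"
  unfolding L_def by (rule summable_sums[OF summable_norm_cancel[OF norm_summable]])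

text \<open>
  The Dirichlet convolution of \<open>\<mu> \<chi>\<close> with \<open>\<chi>\<close> is \<open>\<chi>\<close> times the convolution of \<open>\<mu>\<close> with one.
\<close>

lemma moebius_sums:
  assumes "Re s > 1" "(\<lambda>m. of_int (moebius_mu m) * ch (int m) * of_nat m powr (-s)) sums M"
  shows "M * L s = 1"
proof -
  have bd: "norm (of_int (moebius_mu m) * ch (int m)) \<le> 1" for m
    by (rule moebius_bounded) (rule norm_le_1)
  have "(\<lambda>N. (\<Sum>d | d dvd N. (of_int (moebius_mu d) * ch (int d)) * ch (int (N div d))) * of_nat N powr (-s))
      sums (M * L s)"
    by (intro dirichlet_product summable_dirichlet_bounded[OF bd] norm_summable L_sums assms)
  moreover have "(\<Sum>d | d dvd N. (of_int (moebius_mu d) * ch (int d)) * ch (int (N div d))) * of_nat N powr (-s)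
      = (if N = 1 then 1 else 0)" for N
  proof (cases "N = 0")
    case False
    have "(\<Sum>d | d dvd N. (of_int (moebius_mu d) * ch (int d)) * ch (int (N div d)))
        = (\<Sum>d | d dvd N. of_int (moebius_mu d) * ch (int (d * (N div d))))"
      by (simp only: of_nat_mult mult mult.assoc)
    also have "\<dots> = (if N = 1 then ch (int 1) else 0)"
      using False by (intro moebius_inversion_at) simp
    finally show ?thesis by (simp add: one)
  qed auto
  ultimately have "(\<lambda>N::nat. if N = 1 then 1 else 0) sums (M * L s)" by simp
  then show ?thesis using sums_single[of 1 "\<lambda>_. 1::complex"] by (rule sums_unique2)
qed

lemma moebius_summable: "Re s > 1 \<Longrightarrow> summable (\<lambda>m. of_int (moebius_mu m) * ch (int m) * of_nat m powr (-s))"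
proof (rule summable_norm_cancel, rule summable_dirichlet_bounded)
  show "norm (of_int (moebius_mu m) * ch (int m)) \<le> 1" for m
    by (rule moebius_bounded) (rule norm_le_1)
qed

lemma L_nonzero: "Re s > 1 \<Longrightarrow> L s \<noteq> 0"
  using moebius_sums[OF _ summable_sums[OF moebius_summable], of s] by auto

lemma moebius_sums_inverse: "Re s > 1 \<Longrightarrow> (\<lambda>m. of_int (moebius_mu m) * ch (int m) * of_nat m powr (-s))
    sums (1 / L s)"
  using moebius_sums[OF _ summable_sums[OF moebius_summable], of s] summable_sums[OF moebius_summable, of s]
      L_nonzero[of s]
  by (simp add: nonzero_eq_divide_eq[symmetric])

lemma L_deriv: "Re s > 1 \<Longrightarrow> (L has_field_derivative (\<Sum>m. - of_real (ln (real m)) * ch (int m)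
    * of_nat m powr (-s))) (at s)"
proof -
  assume s: "Re s > 1"
  obtain F F' where F: "\<And>s. Re s > 1 \<Longrightarrow> (\<lambda>m. ch (int m) * of_nat m powr (-s)) sums F s"
    "\<And>s. Re s > 1 \<Longrightarrow> (\<lambda>m. - of_real (ln (real m)) * ch (int m) * of_nat m powr (-s)) sums F' s"
    "\<And>s. Re s > 1 \<Longrightarrow> (F has_field_derivative F' s) (at s)"
    by (rule dirichlet_series_half_plane[of "\<lambda>m. ch (int m)" 1]) (rule norm_le_1, blast)
  have FL: "F z = L z" if "Re z > 1" for z using F(1)[OF that] by (simp add: L_def sums_iff)
  have "(L has_field_derivative F' s) (at s)"
    by (rule has_field_derivative_transform_within_open[OF F(3)[OF s] open_halfspace_Re_gt[of 1]])
        (use s FL in auto)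
  then show ?thesis using F(2)[OF s] by (simp add: sums_iff)
qed

text \<open>
  A logarithm of \<open>L\<close> up to an additive constant: the convolution of \<open>\<Lambda> \<chi>\<close> with \<open>\<chi>\<close> is \<open>\<chi> ln\<close>, so the series \<open>E\<close> with
  coefficients \<open>\<Lambda> m / ln m * \<chi> m\<close> has the logarithmic derivative of \<open>L\<close> as derivative.
\<close>

lemma L_eq_exp:
  obtains c E where "c \<noteq> 0"
    "\<And>s. Re s > 1 \<Longrightarrow> (\<lambda>m. mangoldt m / of_real (ln (real m)) * ch (int m) * of_nat m powr (-s)) sums E s"
    "\<And>s. Re s > 1 \<Longrightarrow> L s = c * exp (E s)"
proof -
  let ?e = "\<lambda>m. mangoldt m / of_real (ln (real m)) * ch (int m)"
  have "norm (?e m) \<le> 1" for m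
  proof -
    have "norm (mangoldt m / of_real (ln (real m)) :: complex) \<le> 1"
    proof (cases "m > 1")
      case True
      then show ?thesis using mangoldt_le[of m] by (simp add: norm_divide mangoldt_nonneg divide_le_eq_1)
    next
      case False
      then have "m = 0 \<or> m = 1" by auto
      then show ?thesis by auto
    qed
    then show ?thesis using norm_le_1[of "int m"] by (simp only: norm_mult mult_le_one norm_ge_zero)
  qed
  then obtain E E' where E: "\<And>s. Re s > 1 \<Longrightarrow> (\<lambda>m. ?e m * of_nat m powr (-s)) sums E s"
    "\<And>s. Re s > 1 \<Longrightarrow> (\<lambda>m. - of_real (ln (real m)) * ?e m * of_nat m powr (-s)) sums E' s"
    "\<And>s. Re s > 1 \<Longrightarrow> (E has_field_derivative E' s) (at s)"
    by (rule dirichlet_series_half_plane[of ?e 1]) blast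
  have conv: "(\<Sum>m. - of_real (ln (real m)) * ch (int m) * of_nat m powr (-s)) = E' s * L s" if s: "Re s > 1"
      for s
  proof -
    let ?a = "\<lambda>m. - mangoldt m * ch (int m)"
    have eq: "- of_real (ln (real m)) * ?e m = ?a m" for m
    proof (cases "m > 1")
      case False
      then have "m = 0 \<or> m = 1" by auto
      then show ?thesis by auto
    qed auto
    have sa: "(\<lambda>m. ?a m * of_nat m powr (-s)) sums E' s" using E(2)[OF s] unfolding eq .
    have na: "summable (\<lambda>m. norm (?a m * of_nat m powr (-s)))"
    proof (rule summable_comparison_test'[OF summable_ln_dirichlet[OF s]])
      fix m :: nat assume m: "m \<ge> 1"
      have "norm (?a m * of_nat m powr (-s)) = mangoldt m * norm (ch (int m)) * real m powr (- Re s)"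
        using m by (simp add: norm_mult norm_nat_powr mangoldt_nonneg)
      also have "\<dots> \<le> ln (real m) * 1 * real m powr (- Re s)"
        using m mangoldt_le[of m] by (intro mult_right_mono mult_mono norm_le_1) (auto simp: mangoldt_nonneg)
      finally show "norm (norm (?a m * of_nat m powr (-s))) \<le> ln (real m) * real m powr (- Re s)" by simp
    qed
    have "(\<lambda>N. (\<Sum>d | d dvd N. ?a d * ch (int (N div d))) * of_nat N powr (-s)) sums (E' s * L s)"
      by (intro dirichlet_product na sa norm_summable L_sums s)
    moreover have "(\<Sum>d | d dvd N. ?a d * ch (int (N div d))) * of_nat N powr (-s)
        = - of_real (ln (real N)) * ch (int N) * of_nat N powr (-s)" for N
    proof (cases "N = 0")
      case False
      have "(\<Sum>d | d dvd N. ?a d * ch (int (N div d))) = (\<Sum>d | d dvd N. - mangoldt d * ch (int N))"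
      proof (rule sum.cong)
        fix d assume "d \<in> {d. d dvd N}"
        then have "int N = int d * int (N div d)" by (simp flip: of_nat_mult)
        then show "?a d * ch (int (N div d)) = - mangoldt d * ch (int N)" by (simp add: mult)
      qed simp
      also have "\<dots> = - (\<Sum>d | d dvd N. mangoldt d) * ch (int N)"
        by (simp add: sum_distrib_right sum_negf)
      also have "\<dots> = - of_real (ln (real N)) * ch (int N)" using False by (simp add: mangoldt_sum)
      finally show ?thesis by simp
    qed simp
    ultimately show ?thesis by (simp add: sums_iff)
  qed
  have "\<exists>c. \<forall>s\<in>{s. Re s > 1}. L s * exp (- E s) = c"
  proof (rule has_field_derivative_zero_constant)
    show "convex {s. Re s > 1}" by (rule convex_halfspace_Re_gt)
    fix s :: complex assume "s \<in> {s. Re s > 1}"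
    then have s: "Re s > 1" by simp
    have d1: "(L has_field_derivative E' s * L s) (at s)" using L_deriv[OF s] conv[OF s] by simp
    have d2: "((\<lambda>s. exp (- E s)) has_field_derivative exp (- E s) * (- E' s)) (at s)"
      using E(3)[OF s] by (auto intro!: derivative_eq_intros)
    show "((\<lambda>s. L s * exp (- E s)) has_field_derivative 0) (at s within {s. Re s > 1})"
    proof (rule has_field_derivative_at_within)
      have "E' s * L s * exp (- E s) + exp (- E s) * (- E' s) * L s = 0"
        by (simp only: mult_minus_left mult_minus_right mult_ac add.right_inverse)
      with DERIV_mult[OF d1 d2] show "((\<lambda>s. L s * exp (- E s)) has_field_derivative 0) (at s)" by (simp only:)
    qed
  qed
  then obtain c where c: "\<And>s. Re s > 1 \<Longrightarrow> L s * exp (- E s) = c" by auto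
  have "L s = c * exp (E s)" if "Re s > 1" for s
    using c[OF that] by (simp add: exp_minus field_simps)
  moreover have "c \<noteq> 0" using c[of 2] L_nonzero[of 2] by auto
  ultimately show ?thesis using that E(1) by blast
qed

lemma sq_character: "dirichlet_character n (\<lambda>a. ch a ^ 2)"
proof
  show "ch a ^ 2 = ch b ^ 2" if "[a = b] (mod int n)" for a b using periodic[OF that] by simp
qed (auto simp: modulus mult power_mult_distrib one zero)

lemma principal_character: "dirichlet_character n (\<lambda>a. if coprime a (int n) then 1 else 0)"
proof
  show "(if coprime a (int n) then 1 else 0 :: complex) = (if coprime b (int n) then 1 else 0)"
    if "[a = b] (mod int n)" for a b
    using cong_imp_coprime[OF that] cong_imp_coprime[OF cong_sym[OF that]] by auto
qed (auto simp: modulus)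

text \<open>
  Multiplication by \<open>b\<close> permutes the residues and multiplies the sum by \<open>ch b\<close>.
\<close>

lemma sum_eq_zero:
  assumes "coprime b (int n)" "ch b \<noteq> 1"
  shows "(\<Sum>m<n. ch (int m)) = 0"
proof -
  define r where "r m = nat ((b * int m) mod int n)" for m
  have rr: "[b * int m = int (r m)] (mod int n)" for m using modulus by (simp add: r_def cong_def)
  have inj: "inj_on r {..<n}"
  proof (rule inj_onI)
    fix x y assume xy: "x \<in> {..<n}" "y \<in> {..<n}" "r x = r y"
    then have "[b * int x = b * int y] (mod int n)" using rr by (metis cong_sym cong_trans)
    then have "[int x = int y] (mod int n)" using assms(1) by (simp add: cong_mult_lcancel)
    then show "x = y" using xy by (simp add: cong_def)
  qed
  have "r ` {..<n} \<subseteq> {..<n}" using modulus by (auto simp: r_def nat_less_iff)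
  then have "bij_betw r {..<n} {..<n}" using inj by (simp add: bij_betw_def endo_inj_surj)
  then have "(\<Sum>m<n. ch (int m)) = (\<Sum>m<n. ch (int (r m)))"
    by (rule sum.reindex_bij_betw[symmetric])
  also have "\<dots> = (\<Sum>m<n. ch b * ch (int m))"
    using periodic[OF rr] mult by simp
  also have "\<dots> = ch b * (\<Sum>m<n. ch (int m))" by (simp add: sum_distrib_left)
  finally show ?thesis using assms(2) by (simp add: algebra_simps)
qed

lemma partial_sums_bounded:
  assumes "coprime b (int n)" "ch b \<noteq> 1"
  shows "norm (\<Sum>m\<le>N. ch (int m)) \<le> (\<Sum>m<n. norm (ch (int m)))"
proof (rule periodic_partial_sums_bounded)
  show "ch (int (m + n)) = ch (int m)" for m by (rule periodic) (simp add: cong_def)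
qed (use sum_eq_zero[OF assms] modulus in auto)

lemma zero_value: "coprime b (int n) \<Longrightarrow> ch b \<noteq> 1 \<Longrightarrow> ch 0 = 0"
  using zero[of 0] periodic[of b 1] one by (cases "n = 1") (auto simp: cong_def)

lemma L_extends:
  assumes "coprime b (int n)" "ch b \<noteq> 1"
  shows "L holomorphic_on {s. Re s > 0}"
    and "Re s > 0 \<Longrightarrow> (\<lambda>m. ch (int m) * of_nat m powr (-s)) sums L s"
proof -
  obtain K where K: "K holomorphic_on {s. Re s > 0}" "\<And>s. Re s > 0 \<Longrightarrow> (\<lambda>m. ch (int m) * of_nat m powr (-s))
      sums K s"
    by (rule dirichlet_series_bounded_sums[of "\<lambda>m. ch (int m)" "\<Sum>m<n. norm (ch (int m))"])
      (rule partial_sums_bounded[OF assms], simp add: zero_value[OF assms], blast)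
  have "K s = L s" if "Re s > 0" for s using K(2)[OF that] by (simp add: L_def sums_iff)
  then show "L holomorphic_on {s. Re s > 0}" "Re s > 0 \<Longrightarrow> (\<lambda>m. ch (int m) * of_nat m powr (-s)) sums L s"
    using K(1) holomorphic_cong[of "{s. Re s > 0}" "{s. Re s > 0}" K L] K(2)[of s] by simp_all
qed

end

section \<open>Non-vanishing on the line Re s = 1\<close>

context dirichlet_character begin

text \<open>
  The classical inequality \<open>3 + 4 cos \<theta> + cos (2 \<theta>) = 2 (1 + cos \<theta>)\<^sup>2 \<ge> 0\<close>, applied to every term of the logarithms
  of the three L-functions. The lower bound is a constant \<open>K\<close> instead of \<open>1\<close> since the logarithms are known up to
  constants only.
\<close>

lemma three_four_one:
  fixes t :: real
  obtains K where "K > 0"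
    "\<And>\<sigma>. \<sigma> > 1 \<Longrightarrow> K \<le> norm (dirichlet_character.L (\<lambda>a. if coprime a (int n) then 1 else 0) (of_real \<sigma>)) ^ 3 *
       norm (L (Complex \<sigma> t)) ^ 4 * norm (dirichlet_character.L (\<lambda>a. ch a ^ 2) (Complex \<sigma> (2 * t)))"
proof -
  interpret pr: dirichlet_character n "\<lambda>a. if coprime a (int n) then 1 else 0" by (rule principal_character)
  interpret sq: dirichlet_character n "\<lambda>a. ch a ^ 2" by (rule sq_character)
  let ?l = "\<lambda>m. mangoldt m / of_real (ln (real m)) :: complex"
  obtain c0 E0 where 0: "c0 \<noteq> 0"
    "\<And>s. Re s > 1 \<Longrightarrow> (\<lambda>m. ?l m * (if coprime (int m) (int n) then 1 else 0) * of_nat m powr (-s)) sums E0 s"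
    "\<And>s. Re s > 1 \<Longrightarrow> pr.L s = c0 * exp (E0 s)" using pr.L_eq_exp by blast
  obtain c1 E1 where 1: "c1 \<noteq> 0"
    "\<And>s. Re s > 1 \<Longrightarrow> (\<lambda>m. ?l m * ch (int m) * of_nat m powr (-s)) sums E1 s"
    "\<And>s. Re s > 1 \<Longrightarrow> L s = c1 * exp (E1 s)" using L_eq_exp by blast
  obtain c2 E2 where 2: "c2 \<noteq> 0"
    "\<And>s. Re s > 1 \<Longrightarrow> (\<lambda>m. ?l m * (ch (int m))^2 * of_nat m powr (-s)) sums E2 s"
    "\<And>s. Re s > 1 \<Longrightarrow> sq.L s = c2 * exp (E2 s)" using sq.L_eq_exp by blast
  define K where "K = norm c0 ^ 3 * norm c1 ^ 4 * norm c2"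
  have "K \<le> norm (pr.L (of_real \<sigma>)) ^ 3 * norm (L (Complex \<sigma> t)) ^ 4 * norm (sq.L (Complex \<sigma> (2 * t)))"
    if \<sigma>: "\<sigma> > 1" for \<sigma>
  proof -
    let ?s0 = "of_real \<sigma> :: complex" and ?s1 = "Complex \<sigma> t" and ?s2 = "Complex \<sigma> (2 * t)"
    let ?T = "\<lambda>m. 3 * (?l m * (if coprime (int m) (int n) then 1 else 0) * of_nat m powr (-?s0))
       + 4 * (?l m * ch (int m) * of_nat m powr (-?s1)) + ?l m * (ch (int m))^2 * of_nat m powr (-?s2)"
    have "?T sums (3 * E0 ?s0 + 4 * E1 ?s1 + E2 ?s2)"
      using \<sigma> by (intro sums_add sums_mult 0 1 2) auto
    then have sR: "(\<lambda>m. Re (?T m)) sums Re (3 * E0 ?s0 + 4 * E1 ?s1 + E2 ?s2)" by (rule sums_Re)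
    have "Re (?T m) \<ge> 0" for m
    proof (cases "m = 0 \<or> \<not> coprime (int m) (int n)")
      case True
      then show ?thesis using zero[of "int m"] by (cases "m = 0") auto
    next
      case False
      then have m: "m > 0" and c: "coprime (int m) (int n)" by auto
      define u where "u = (of_nat m :: complex) powr (- (\<i> * of_real t))"
      define x where "x = (of_nat m :: complex) powr (- of_real \<sigma>)"
      define v where "v = ch (int m) * u"
      have x: "x = of_real (real m powr (-\<sigma>))"
        using powr_of_real[of "real m" "-\<sigma>"] by (simp add: x_def)
      have s1: "of_nat m powr (-?s1) = x * u"
      proof -
        have "-?s1 = - of_real \<sigma> + (- (\<i> * of_real t))" by (simp add: complex_eq_iff)
        then show ?thesis by (simp only: x_def u_def powr_add)
      qed
      have s2: "of_nat m powr (-?s2) = x * u\<^sup>2"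
      proof -
        have "-?s2 = - of_real \<sigma> + (- (\<i> * of_real t)) + (- (\<i> * of_real t))" by (simp add: complex_eq_iff)
        then show ?thesis by (simp only: x_def u_def powr_add power2_eq_square mult.assoc)
      qed
      have "norm u = 1" using m by (simp add: u_def norm_nat_powr)
      then have "norm v = 1" using norm_coprime[OF c] by (simp add: v_def norm_mult)
      then have v: "(Re v)\<^sup>2 + (Im v)\<^sup>2 = 1" by (simp add: cmod_def)
      have l: "?l m = of_real (mangoldt m / ln (real m))" by simp
      have "?T m = of_real (mangoldt m / ln (real m) * real m powr (-\<sigma>)) * (3 + 4 * v + v\<^sup>2)"
        unfolding s1 s2 l x_def[symmetric] using c by (simp add: x v_def algebra_simps power2_eq_square)
      then have e1: "Re (?T m) = (mangoldt m / ln (real m) * real m powr (-\<sigma>)) * Re (3 + 4 * v + v\<^sup>2)"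
        by (simp only: times_complex.sel Re_complex_of_real Im_complex_of_real mult_zero_left diff_zero)
      have e2: "Re (3 + 4 * v + v\<^sup>2) = 2 * (1 + Re v)\<^sup>2"
        using v by (simp add: power2_eq_square algebra_simps)
      have e3: "mangoldt m / ln (real m) * real m powr (-\<sigma>) \<ge> 0"
        using m by (intro mult_nonneg_nonneg divide_nonneg_nonneg mangoldt_nonneg) auto
      show ?thesis unfolding e1 e2 by (intro mult_nonneg_nonneg[OF e3]) auto
    qed
    then have nn: "0 \<le> Re (3 * E0 ?s0 + 4 * E1 ?s1 + E2 ?s2)"
      using sums_le[OF _ sums_zero sR] by simp
    have "norm (pr.L ?s0) ^ 3 * norm (L ?s1) ^ 4 * norm (sq.L ?s2)
        = K * exp (Re (3 * E0 ?s0 + 4 * E1 ?s1 + E2 ?s2))"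
      using \<sigma> 0(3)[of ?s0] 1(3)[of ?s1] 2(3)[of ?s2]
      by (simp add: norm_mult norm_exp_eq_Re K_def power_mult_distrib exp_add exp_of_nat_mult[symmetric])
    moreover have "K * 1 \<le> K * exp (Re (3 * E0 ?s0 + 4 * E1 ?s1 + E2 ?s2))"
      using nn by (intro mult_left_mono) (auto simp: K_def)
    ultimately show ?thesis by simp
  qed
  moreover have "K > 0" using 0 1 2 by (simp add: K_def)
  ultimately show ?thesis using that by blast
qed

lemma L_pole_order:
  obtains C where "C \<ge> 0" "\<And>\<sigma>. 1 < \<sigma> \<Longrightarrow> \<sigma> \<le> 2 \<Longrightarrow> norm (L (of_real \<sigma>)) \<le> C / (\<sigma> - 1)"
proof
  let ?S = "\<Sum>m. real m powr (-2)"
  have S: "?S \<ge> 0" by (intro suminf_nonneg) (auto simp: summable_real_powr_iff)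
  show "0 \<le> 1 + 2 * ?S" using S by simp
  fix \<sigma> :: real assume s: "1 < \<sigma>" "\<sigma> \<le> 2"
  have su: "summable (\<lambda>m. norm (1 * of_nat m powr (- of_real \<sigma>) :: complex))"
    using s by (intro summable_dirichlet_bounded[of _ 1]) auto
  define Z where "Z = (\<Sum>m. 1 * of_nat m powr (- of_real \<sigma>) :: complex)"
  have Z: "(\<lambda>m. 1 * of_nat m powr (- of_real \<sigma>)) sums Z"
    unfolding Z_def by (rule summable_sums[OF summable_norm_cancel[OF su]])
  have "norm ((of_real \<sigma> - 1) * Z - 1) \<le> norm (of_real \<sigma> :: complex) * norm (of_real \<sigma> - 1 :: complex) * ?S"
    using zeta_near_1[OF _ Z] s by simp
  moreover have "norm (of_real \<sigma> - 1 :: complex) = \<sigma> - 1"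
    using s by (metis abs_of_pos diff_gt_0_iff_gt norm_of_real of_real_1 of_real_diff)
  ultimately have a: "norm ((of_real \<sigma> - 1) * Z - 1) \<le> \<sigma> * (\<sigma> - 1) * ?S" using s by simp
  have "\<sigma> * (\<sigma> - 1) * ?S \<le> 2 * 1 * ?S" using s S by (intro mult_right_mono mult_mono) auto
  then have "norm ((of_real \<sigma> - 1) * Z) \<le> 1 + 2 * ?S"
    using a norm_triangle_ineq[of "(of_real \<sigma> - 1) * Z - 1" 1] by simp
  then have b: "(\<sigma> - 1) * norm Z \<le> 1 + 2 * ?S" using \<open>norm (of_real \<sigma> - 1) = _\<close> by (simp add: norm_mult)
  have "norm (L (of_real \<sigma>)) \<le> norm Z"
  proof -
    have nz: "norm (of_nat m powr (- of_real \<sigma>) :: complex) = Re (1 * of_nat m powr (- of_real \<sigma>))" for m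
      using powr_of_real[of "real m" "-\<sigma>"] by simp
    have "norm (L (of_real \<sigma>)) \<le> Re Z"
    proof (rule norm_sums_le[OF L_sums sums_Re[OF Z]])
      show "norm (ch (int m) * of_nat m powr (- of_real \<sigma>)) \<le> Re (1 * of_nat m powr (- of_real \<sigma>))" for m
        unfolding nz[symmetric] norm_mult using norm_le_1[of "int m"] mult_right_mono[of
            "norm (ch (int m))" 1] by simp
    qed (use s in simp)
    also have "\<dots> \<le> norm Z" by (rule complex_Re_le_cmod)
    finally show ?thesis .
  qed
  then have "(\<sigma> - 1) * norm (L (of_real \<sigma>)) \<le> 1 + 2 * ?S"
    using b s mult_left_mono[of "norm (L (of_real \<sigma>))" "norm Z" "\<sigma> - 1"] by linarith
  then show "norm (L (of_real \<sigma>)) \<le> (1 + 2 * ?S) / (\<sigma> - 1)"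
    using s by (simp add: pos_le_divide_eq mult.commute)
qed

lemma bounded_on_vertical_strip_segment:
  fixes F :: "complex \<Rightarrow> complex"
  assumes "F holomorphic_on {s. Re s > 0}"
  obtains D where "\<And>\<sigma>. 1 \<le> \<sigma> \<Longrightarrow> \<sigma> \<le> 2 \<Longrightarrow> norm (F (Complex \<sigma> t)) \<le> D"
proof -
  let ?S = "(\<lambda>\<sigma>. Complex \<sigma> t) ` {1..2}"
  have "continuous_on {1..2} (\<lambda>\<sigma>. Complex \<sigma> t)"
    unfolding Complex_eq by (intro continuous_intros)
  then have S: "compact ?S" by (rule compact_continuous_image) simp
  have cF: "continuous_on ?S F"
    by (rule continuous_on_subset[OF holomorphic_on_imp_continuous_on[OF assms]]) auto
  have "bounded (F ` ?S)" by (rule compact_imp_bounded[OF compact_continuous_image[OF cF S]])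
  then show ?thesis using that by (fastforce simp: bounded_iff)
qed

text \<open>
  The character minus its mean \<open>k\<close> over a period has bounded partial sums, and \<open>k\<close> times the zeta function stays
  bounded away from \<open>s = 1\<close>.
\<close>

lemma L_bounded_off_1:
  assumes t: "t \<noteq> 0"
  obtains D where "D \<ge> 0" "\<And>\<sigma>. 1 < \<sigma> \<Longrightarrow> \<sigma> \<le> 2 \<Longrightarrow> norm (L (Complex \<sigma> t)) \<le> D"
proof -
  define k where "k = (\<Sum>m<n. ch (int m)) / of_nat n"
  define f where "f m = (if m = 0 then 0 else ch (int m) - k)" for m :: nat
  let ?B = "\<Sum>m<n. norm (ch (int m) - k)"
  have bd: "norm (\<Sum>m\<le>N. f m) \<le> ?B + norm (ch 0 - k)" for N
  proof -
    have "norm (\<Sum>m\<le>N. ch (int m) - k) \<le> ?B"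
    proof (rule periodic_partial_sums_bounded)
      show "ch (int (m + n)) - k = ch (int m) - k" for m using periodic[of "int (m + n)" "int m"]
          by (simp add: cong_def)
    qed (use modulus in \<open>auto simp: k_def sum_subtractf\<close>)
    moreover have "(\<Sum>m\<le>N. f m) = (\<Sum>m\<le>N. ch (int m) - k) - (ch 0 - k)"
      by (induction N) (auto simp: f_def)
    ultimately show ?thesis using norm_triangle_ineq4 by (smt (verit, best))
  qed
  obtain G where G: "G holomorphic_on {s. Re s > 0}" "\<And>s. Re s > 0 \<Longrightarrow> (\<lambda>m. f m * of_nat m powr (-s)) sums G s"
    by (rule dirichlet_series_bounded_sums[OF bd]) (simp add: f_def, blast)
  obtain D where D: "\<And>\<sigma>. 1 \<le> \<sigma> \<Longrightarrow> \<sigma> \<le> 2 \<Longrightarrow> norm (G (Complex \<sigma> t)) \<le> D"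
    using bounded_on_vertical_strip_segment[OF G(1)] by blast
  let ?S = "\<Sum>m. real m powr (-2)"
  have S: "?S \<ge> 0" by (intro suminf_nonneg) (auto simp: summable_real_powr_iff)
  define Bz where "Bz = (1 + (2 + \<bar>t\<bar>) * (1 + \<bar>t\<bar>) * ?S) / \<bar>t\<bar>"
  have "norm (L (Complex \<sigma> t)) \<le> norm k * Bz + D" if s: "1 < \<sigma>" "\<sigma> \<le> 2" for \<sigma>
  proof -
    let ?s = "Complex \<sigma> t"
    have su: "summable (\<lambda>m. norm (1 * of_nat m powr (- ?s) :: complex))"
      using s by (intro summable_dirichlet_bounded[of _ 1]) auto
    define Z where "Z = (\<Sum>m. 1 * of_nat m powr (- ?s) :: complex)"
    have Z: "(\<lambda>m. 1 * of_nat m powr (- ?s)) sums Z"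
      unfolding Z_def by (rule summable_sums[OF summable_norm_cancel[OF su]])
    have n1: "norm (?s - 1) \<le> 1 + \<bar>t\<bar>" using cmod_le[of "?s - 1"] s by simp
    have n2: "norm ?s \<le> 2 + \<bar>t\<bar>" using cmod_le[of ?s] s by simp
    have n3: "norm (?s - 1) \<ge> \<bar>t\<bar>" using abs_Im_le_cmod[of "?s - 1"] by simp
    have "norm ((?s - 1) * Z - 1) \<le> norm ?s * norm (?s - 1) * ?S"
      using zeta_near_1[OF _ Z] s by simp
    also have "\<dots> \<le> (2 + \<bar>t\<bar>) * (1 + \<bar>t\<bar>) * ?S" using n1 n2 S by (intro mult_right_mono mult_mono) auto
    finally have "norm ((?s - 1) * Z) \<le> 1 + (2 + \<bar>t\<bar>) * (1 + \<bar>t\<bar>) * ?S"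
      using norm_triangle_ineq[of "(?s - 1) * Z - 1" 1] by simp
    then have "\<bar>t\<bar> * norm Z \<le> 1 + (2 + \<bar>t\<bar>) * (1 + \<bar>t\<bar>) * ?S"
      using mult_right_mono[OF n3, of "norm Z"] by (simp add: norm_mult)
    then have zb: "norm Z \<le> Bz" using t by (simp add: Bz_def pos_le_divide_eq mult.commute)
    have "(\<lambda>m. k * (1 * of_nat m powr (-?s)) + f m * of_nat m powr (-?s)) sums (k * Z + G ?s)"
      using s by (intro sums_add sums_mult Z G) auto
    moreover have "k * (1 * of_nat m powr (-?s)) + f m * of_nat m powr (-?s)
        = ch (int m) * of_nat m powr (-?s)" for m
      by (cases "m = 0") (auto simp: f_def algebra_simps)
    ultimately have "L ?s = k * Z + G ?s" using L_sums[of ?s] s by (simp add: sums_iff)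
    then have "norm (L ?s) \<le> norm k * norm Z + norm (G ?s)" by (metis norm_mult norm_triangle_ineq)
    also have "\<dots> \<le> norm k * Bz + D" using zb D[of \<sigma>] s by (intro add_mono mult_left_mono) auto
    finally show ?thesis .
  qed
  then show ?thesis using that[of "max 0 (norm k * Bz + D)"] by (simp add: le_max_iff_disj)
qed

lemma L_bounded_nonprincipal:
  assumes "coprime b (int n)" "ch b \<noteq> 1"
  obtains D where "D \<ge> 0" "\<And>\<sigma>. 1 < \<sigma> \<Longrightarrow> \<sigma> \<le> 2 \<Longrightarrow> norm (L (Complex \<sigma> t)) \<le> D"
proof -
  obtain D where D: "\<And>\<sigma>. 1 \<le> \<sigma> \<Longrightarrow> \<sigma> \<le> 2 \<Longrightarrow> norm (L (Complex \<sigma> t)) \<le> D"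
    using bounded_on_vertical_strip_segment[OF L_extends(1)[OF assms]] by blast
  then show ?thesis using that[of "max 0 D"] by (simp add: le_max_iff_disj)
qed

lemma L_zero_linear:
  assumes "coprime b (int n)" "ch b \<noteq> 1" "L (Complex 1 t) = 0"
  obtains B where "B \<ge> 0" "\<And>\<sigma>. 1 < \<sigma> \<Longrightarrow> \<sigma> \<le> 2 \<Longrightarrow> norm (L (Complex \<sigma> t)) \<le> B * (\<sigma> - 1)"
proof -
  note hol = L_extends(1)[OF assms(1,2)]
  have "deriv L holomorphic_on {s. Re s > 0}"
    using hol open_halfspace_Re_gt by (rule holomorphic_deriv)
  then obtain D where D: "\<And>\<sigma>. 1 \<le> \<sigma> \<Longrightarrow> \<sigma> \<le> 2 \<Longrightarrow> norm (deriv L (Complex \<sigma> t)) \<le> D"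
    using bounded_on_vertical_strip_segment by blast
  have D0: "D \<ge> 0" using norm_ge_zero[of "deriv L (Complex 1 t)"] D[of 1] by linarith
  have "norm (L (Complex \<sigma> t)) \<le> D * (\<sigma> - 1)" if s: "1 < \<sigma>" "\<sigma> \<le> 2" for \<sigma>
  proof -
    let ?S = "closed_segment (Complex 1 t) (Complex 2 t)"
    have S: "\<exists>x. z = Complex x t \<and> 1 \<le> x \<and> x \<le> 2" if "z \<in> ?S" for z
    proof -
      from that obtain u where "0 \<le> u" "u \<le> 1" "z = (1 - u) *\<^sub>R Complex 1 t + u *\<^sub>R Complex 2 t"
        by (auto simp: closed_segment_def)
      then show ?thesis by (intro exI[of _ "1 + u"]) (auto simp: complex_eq_iff algebra_simps)
    qed
    have "Complex \<sigma> t = (1 - (\<sigma> - 1)) *\<^sub>R Complex 1 t + (\<sigma> - 1) *\<^sub>R Complex 2 t"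
      by (simp add: complex_eq_iff algebra_simps)
    then have sS: "Complex \<sigma> t \<in> ?S" unfolding closed_segment_def using s
        by (intro CollectI exI[of _ "\<sigma> - 1"]) auto
    have "norm (L (Complex \<sigma> t) - L (Complex 1 t)) \<le> D * norm (Complex \<sigma> t - Complex 1 t)"
    proof (rule field_differentiable_bound[OF convex_closed_segment])
      fix z assume z: "z \<in> ?S"
      then obtain x where x: "z = Complex x t" "1 \<le> x" "x \<le> 2" using S by blast
      then have "z \<in> {s. Re s > 0}" by auto
      then show "(L has_field_derivative deriv L z) (at z within ?S)"
        using holomorphic_derivI[OF hol open_halfspace_Re_gt] has_field_derivative_at_within by blast
      show "norm (deriv L z) \<le> D" using x D by auto
    qed (use sS in auto)
    then show ?thesis using s assms(3) by (simp add: cmod_def)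
  qed
  then show ?thesis using that D0 by blast
qed

text \<open>
  If \<open>L\<close> vanished at \<open>1 + \<i> t\<close>, the product in the 3-4-1 inequality would be \<open>O((\<sigma> - 1) ^ (4 - 3))\<close> as
  \<open>\<sigma> \<rightarrow> 1\<close>. The condition excludes a pole of the third factor.
\<close>

lemma L_nonzero_complex:
  assumes np: "coprime b (int n)" "ch b \<noteq> 1"
    and cond: "t \<noteq> 0 \<or> (\<exists>b. coprime b (int n) \<and> ch b ^ 2 \<noteq> 1)"
  shows "L (Complex 1 t) \<noteq> 0"
proof
  assume z: "L (Complex 1 t) = 0"
  interpret pr: dirichlet_character n "\<lambda>a. if coprime a (int n) then 1 else 0" by (rule principal_character)
  interpret sq: dirichlet_character n "\<lambda>a. ch a ^ 2" by (rule sq_character)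
  obtain K where K: "K > 0" "\<And>\<sigma>. \<sigma> > 1 \<Longrightarrow> K \<le> norm (pr.L (of_real \<sigma>)) ^ 3 * norm (L (Complex \<sigma> t)) ^ 4
      * norm (sq.L (Complex \<sigma> (2 * t)))"
    using three_four_one by blast
  obtain C where C: "C \<ge> 0" "\<And>\<sigma>. 1 < \<sigma> \<Longrightarrow> \<sigma> \<le> 2 \<Longrightarrow> norm (pr.L (of_real \<sigma>)) \<le> C / (\<sigma> - 1)"
    using pr.L_pole_order by blast
  obtain B where B: "B \<ge> 0" "\<And>\<sigma>. 1 < \<sigma> \<Longrightarrow> \<sigma> \<le> 2 \<Longrightarrow> norm (L (Complex \<sigma> t)) \<le> B * (\<sigma> - 1)"
    using L_zero_linear[OF np z] by blast
  obtain D where D: "D \<ge> 0" "\<And>\<sigma>. 1 < \<sigma> \<Longrightarrow> \<sigma> \<le> 2 \<Longrightarrow> norm (sq.L (Complex \<sigma> (2 * t))) \<le> D"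
  proof (cases "t = 0")
    case True
    then obtain b where "coprime b (int n)" "ch b ^ 2 \<noteq> 1" using cond by blast
    then show ?thesis using sq.L_bounded_nonprincipal that by blast
  next
    case False
    then show ?thesis using sq.L_bounded_off_1[of "2 * t"] that by auto
  qed
  define M where "M = C ^ 3 * B ^ 4 * D"
  have M0: "M \<ge> 0" using C B D by (simp add: M_def)
  have le: "K \<le> M * h" if h: "0 < h" "h \<le> 1" for h
  proof -
    have "K \<le> norm (pr.L (of_real (1 + h))) ^ 3 * norm (L (Complex (1 + h) t)) ^ 4
        * norm (sq.L (Complex (1 + h) (2 * t)))"
      by (rule K(2)) (use h in simp)
    also have "\<dots> \<le> (C / h) ^ 3 * (B * h) ^ 4 * D"
      using C(2)[of "1 + h"] B(2)[of "1 + h"] D(2)[of "1 + h"] h C(1) B(1) D(1)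
      by (intro mult_mono power_mono mult_nonneg_nonneg) auto
    also have "\<dots> = M * h" using h by (simp add: M_def field_simps power_mult_distrib eval_nat_numeral)
    finally show ?thesis .
  qed
  \<comment> \<open>Small enough for \<open>M * h < K\<close>.\<close>
  define h where "h = min 1 (K / (2 * (M + 1)))"
  have h: "0 < h" "h \<le> 1" using K M0 by (auto simp: h_def)
  have "M * h \<le> M * (K / (2 * (M + 1)))" using M0 by (intro mult_left_mono) (auto simp: h_def)
  also have "\<dots> = K * (M / (2 * (M + 1)))" by simp
  also have "\<dots> < K * 1" using K M0 by (intro mult_strict_left_mono) (auto simp: divide_less_eq)
  finally show False using le[OF h] by simp
qed

end

section \<open>Non-vanishing at s = 1 for real characters\<close>

lemma abel_summation_bound:
  fixes a :: "nat \<Rightarrow> complex" and b :: "nat \<Rightarrow> real"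
  assumes bd: "\<And>N. norm (\<Sum>m\<le>N. a m) \<le> C" and a0: "a 0 = 0"
    and dec: "\<And>m. m \<ge> 1 \<Longrightarrow> b (Suc m) \<le> b m" and nonneg: "\<And>m. m \<ge> 1 \<Longrightarrow> b m \<ge> 0"
  shows "norm (\<Sum>m\<le>N. a m * of_real (b m)) \<le> C * b 1"
proof -
  define A where "A N = (\<Sum>m\<le>N. a m)" for N
  have eq: "(\<Sum>m\<le>N. a m * of_real (b m)) = A N * of_real (b (Suc N)) + (\<Sum>m\<le>N. A m * of_real (b m - b (Suc m)))"
      for N
    by (induction N) (auto simp: A_def a0 algebra_simps)
  have C: "C \<ge> 0" using bd[of 0] norm_ge_zero order_trans by blast
  have bA: "norm (A m * of_real (b m - b (Suc m))) \<le> (if m = 0 then 0 else C * (b m - b (Suc m)))" for m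
  proof (cases "m = 0")
    case False
    then have "norm (of_real (b m - b (Suc m)) :: complex) = b m - b (Suc m)"
      using dec[of m] by (simp only: norm_of_real abs_of_nonneg diff_ge_0_iff_ge)
    moreover have "norm (A m) * (b m - b (Suc m)) \<le> C * (b m - b (Suc m))"
      using dec[of m] bd[of m] False by (intro mult_right_mono) (auto simp: A_def)
    ultimately show ?thesis using False by (simp only: norm_mult if_False)
  qed (simp add: A_def a0)
  have tel: "(\<Sum>m\<le>N. if m = 0 then 0 else C * (b m - b (Suc m))) = C * (b 1 - b (Suc N))" for N
    by (induction N) (auto simp: algebra_simps)
  have "norm (A N * of_real (b (Suc N))) \<le> C * b (Suc N)"
    using bd[of N] nonneg[of "Suc N"] by (simp add: norm_mult A_def mult_right_mono)
  moreover have "norm (\<Sum>m\<le>N. A m * of_real (b m - b (Suc m))) \<le> C * (b 1 - b (Suc N))"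
    unfolding tel[symmetric] by (rule sum_norm_le) (rule bA)
  ultimately show ?thesis
    unfolding eq using norm_triangle_ineq[of "A N * of_real (b (Suc N))" "\<Sum>m\<le>N. A m
        * of_real (b m - b (Suc m))"]
    by (simp add: algebra_simps)
qed

text \<open>
  The arithmetic-geometric mean inequality for the terms \<open>i\<close> and \<open>m - 1 - i\<close>.
\<close>

lemma geometric_sum_ge:
  fixes u :: real
  assumes "0 \<le> u"
  shows "(\<Sum>i<m. (u\<^sup>2) ^ i) \<ge> real m * u ^ (m - 1)"
proof -
  have "2 * (\<Sum>i<m. (u\<^sup>2) ^ i) = (\<Sum>i<m. (u\<^sup>2) ^ i) + (\<Sum>i<m. (u\<^sup>2) ^ (m - Suc i))"
    by (simp add: sum.nat_diff_reindex)
  also have "\<dots> = (\<Sum>i<m. (u\<^sup>2) ^ i + (u\<^sup>2) ^ (m - Suc i))" by (simp add: sum.distrib)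
  also have "\<dots> \<ge> (\<Sum>i<m. 2 * u ^ (m - 1))"
  proof (rule sum_mono)
    fix i assume i: "i \<in> {..<m}"
    have "0 \<le> (u ^ i - u ^ (m - Suc i))\<^sup>2" by simp
    then have "2 * (u ^ i * u ^ (m - Suc i)) \<le> (u ^ i)\<^sup>2 + (u ^ (m - Suc i))\<^sup>2"
      by (simp add: power2_eq_square algebra_simps)
    moreover have "u ^ i * u ^ (m - Suc i) = u ^ (m - 1)" using i by (simp flip: power_add)
    ultimately show "2 * u ^ (m - 1) \<le> (u\<^sup>2) ^ i + (u\<^sup>2) ^ (m - Suc i)"
      by (simp add: power_mult[symmetric] mult.commute)
  qed
  finally show ?thesis by simp
qed

text \<open>
  With \<open>S m = (1 - t ^ m) / (1 - t)\<close>, the difference \<open>b m - b (m + 1)\<close> is \<open>1 / (1 - t)\<close> times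
  \<open>1 / (m (m + 1)) - t ^ m / (S m * S (m + 1))\<close>, and \<open>S m * S (m + 1) \<ge> m (m + 1) t ^ m\<close> by the
  arithmetic-geometric mean inequality.
\<close>

lemma lambert_difference_decreasing:
  fixes t :: real
  assumes t: "0 < t" "t < 1"
  defines "b \<equiv> \<lambda>m. 1 / (real m * (1 - t)) - t ^ m / (1 - t ^ m)"
  shows "m \<ge> 1 \<Longrightarrow> b (Suc m) \<le> b m" "m \<ge> 1 \<Longrightarrow> b m \<ge> 0" "b 1 = 1"
proof -
  define S where "S m = (\<Sum>i<m. t ^ i)" for m
  have S: "1 - t ^ m = (1 - t) * S m" for m unfolding S_def by (rule one_diff_power_eq)
  have Spos: "S m > 0" if "m \<ge> 1" for m
    unfolding S_def using t that by (intro sum_pos) (auto simp: lessThan_empty_iff)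
  show "b 1 = 1" using t by (simp add: b_def diff_divide_distrib[symmetric])
  {
    assume m: "m \<ge> 1"
    have "real m * t ^ m = (\<Sum>i<m. t ^ m)" by simp
    also have "\<dots> \<le> S m" unfolding S_def using t by (intro sum_mono power_decreasing) auto
    finally have le: "real m * t ^ m \<le> S m" .
    have "t ^ m / S m \<le> 1 / real m" using le m Spos[OF m] by (simp add: field_simps)
    then have "t ^ m / S m / (1 - t) \<le> 1 / real m / (1 - t)" using t by (intro divide_right_mono) auto
    then show "b m \<ge> 0" by (simp add: b_def S mult.commute)
  next
    assume m: "m \<ge> 1"
    define u where "u = sqrt t"
    have u: "u \<ge> 0" "u\<^sup>2 = t" "u \<le> 1" using t by (auto simp: u_def)
    have g1: "S m \<ge> real m * u ^ (m - 1)" and g2: "S (Suc m) \<ge> real (Suc m) * u ^ m"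
      using geometric_sum_ge[OF u(1), of m] geometric_sum_ge[OF u(1), of "Suc m"] u(2)
          by (auto simp: S_def simp del: sum.lessThan_Suc)
    have "real m * real (Suc m) * t ^ m \<le> real m * real (Suc m) * u ^ (2 * m - 1)"
      using u by (intro mult_left_mono) (auto simp: u(2)[symmetric] power_mult[symmetric] intro!:
          power_decreasing)
    also have "2 * m - 1 = (m - 1) + m" using m by simp
    also have "real m * real (Suc m) * u ^ (m - 1 + m) = (real m * u ^ (m - 1)) * (real (Suc m) * u ^ m)"
      by (simp add: power_add)
    also have "\<dots> \<le> S m * S (Suc m)"
      using g1 g2 u Spos[OF m] by (intro mult_mono) auto
    finally have key: "real m * real (Suc m) * t ^ m \<le> S m * S (Suc m)" .
    have pos: "S m > 0" "S (Suc m) > 0" using Spos m by auto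
    have "t ^ m / (S m * S (Suc m)) \<le> 1 / (real m * real (Suc m))"
    proof -
      have "x / w \<le> 1 / y" if "w > 0" "y > 0" "y * x \<le> w" for x y w :: real
        using that by (simp add: field_simps)
      then show ?thesis using key pos m by (simp del: of_nat_Suc)
    qed
    moreover have "t ^ m / S m - t ^ Suc m / S (Suc m) = t ^ m / (S m * S (Suc m))"
    proof -
      have "S (Suc m) - t * S m = 1"
        using S[of m] S[of "Suc m"] by (simp add: S_def sum_distrib_left sum.lessThan_Suc_shift del:
            sum.lessThan_Suc)
      then have "t ^ m * S (Suc m) - t ^ Suc m * S m = t ^ m"
          by (metis mult.assoc mult.commute mult.right_neutral power_Suc right_diff_distrib)
      then show ?thesis using pos by (simp add: diff_frac_eq)
    qed
    moreover have "1 / real m - 1 / real (Suc m) = 1 / (real m * real (Suc m))"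
      using m by (simp add: field_simps)
    ultimately have "(t ^ m / S m - t ^ Suc m / S (Suc m)) / (1 - t)
        \<le> (1 / real m - 1 / real (Suc m)) / (1 - t)"
      using t by (intro divide_right_mono) auto
    then show "b (Suc m) \<le> b m"
      by (simp add: b_def S diff_divide_distrib mult.commute del: power_Suc of_nat_Suc)
  }
qed

text \<open>
  The divisor sum is multiplicative, and at a prime power it is \<open>1 + r p + \<dots> + (r p) ^ k \<ge> 0\<close>. The induction
  splits off one prime power.
\<close>

lemma divisor_sum_nonneg:
  fixes r :: "nat \<Rightarrow> real"
  assumes mult: "\<And>a b. r (a * b) = r a * r b" and one: "r 1 = 1"
    and val: "\<And>a. r a = 0 \<or> r a = 1 \<or> r a = -1"
  shows "N > 0 \<Longrightarrow> (\<Sum>d | d dvd N. r d) \<ge> 0"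
proof (induction N rule: less_induct)
  case (less N)
  show ?case
  proof (cases "N = 1")
    case True
    then show ?thesis using one by simp
  next
    case False
    then obtain p where p: "prime p" "p dvd N" using prime_factor_nat by blast
    define k where "k = multiplicity p N"
    have "N \<noteq> 0" "\<not> is_unit p" using less.prems p by (auto simp: prime_nat_iff)
    then obtain M where M: "N = p ^ k * M" "\<not> p dvd M"
      unfolding k_def by (rule multiplicity_decompose')
    have k: "k > 0" using p less.prems by (simp add: k_def prime_multiplicity_gt_zero_iff)
    have M0: "M > 0" using M less.prems by (auto intro: Nat.gr0I)
    have pk: "p ^ k > 1" using one_less_power[OF prime_gt_1_nat[OF p(1)] k] .
    then have "M < N" using M M0 by simp
    have pow: "r (a ^ i) = r a ^ i" for a i by (induction i) (auto simp: mult one[simplified])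
    have bij: "bij_betw (\<lambda>(i, e). p ^ i * e) ({..k} \<times> {e. e dvd M}) {d. d dvd N}"
      unfolding bij_betw_def
    proof
      show "inj_on (\<lambda>(i, e). p ^ i * e) ({..k} \<times> {e. e dvd M})"
      proof (rule inj_onI, clarify)
        fix i e i' e'
        assume e: "e dvd M" "e' dvd M" and eq: "p ^ i * e = p ^ i' * e'"
        have "e \<noteq> 0" "e' \<noteq> 0" "\<not> p dvd e" "\<not> p dvd e'" using e M M0 by (auto intro: dvd_trans)
        then have "multiplicity p (p ^ i * e) = i" "multiplicity p (p ^ i' * e') = i'"
          using p by (simp_all add: prime_elem_multiplicity_mult_distrib not_dvd_imp_multiplicity_0)
        then have "i = i'" using eq by simp
        then show "i = i' \<and> e = e'" using eq p by simp
      qed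
      show "(\<lambda>(i, e). p ^ i * e) ` ({..k} \<times> {e. e dvd M}) = {d. d dvd N}"
      proof (intro equalityI subsetI)
        fix d assume "d \<in> {d. d dvd N}"
        then have "d dvd p ^ k * M" using M by simp
        then obtain b c where bc: "d = b * c" "b dvd p ^ k" "c dvd M" using division_decomp by blast
        then obtain i where "i \<le> k" "b = p ^ i" using p divides_primepow_nat by blast
        then show "d \<in> (\<lambda>(i, e). p ^ i * e) ` ({..k} \<times> {e. e dvd M})" using bc by force
      next
        fix d assume "d \<in> (\<lambda>(i, e). p ^ i * e) ` ({..k} \<times> {e. e dvd M})"
        then show "d \<in> {d. d dvd N}" unfolding M(1) by (auto intro!: mult_dvd_mono le_imp_power_dvd)
      qed
    qed
    have "(\<Sum>d | d dvd N. r d) = (\<Sum>(i, e)\<in>{..k} \<times> {e. e dvd M}. r (p ^ i * e))"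
      using sum.reindex_bij_betw[OF bij, of r] by (simp add: case_prod_unfold)
    also have "\<dots> = (\<Sum>i\<le>k. \<Sum>e | e dvd M. r p ^ i * r e)"
      by (subst sum.cartesian_product[symmetric]) (simp add: mult pow)
    also have "\<dots> = (\<Sum>i\<le>k. r p ^ i) * (\<Sum>e | e dvd M. r e)"
      by (simp add: sum_product)
    also have "\<dots> \<ge> 0"
    proof (rule mult_nonneg_nonneg)
      show "(\<Sum>i\<le>k. r p ^ i) \<ge> 0"
      proof -
        have "(\<Sum>i\<le>k. (-1::real) ^ i) \<ge> 0" for k
        proof -
          have "(\<Sum>i\<le>k. (-1::real) ^ i) = (if even k then 1 else 0)" by (induction k) auto
          then show ?thesis by simp
        qed
        moreover have "(\<Sum>i\<le>k. (0::real) ^ i) \<ge> 0" by (intro sum_nonneg) simp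
        ultimately show ?thesis using val[of p] by auto
      qed
      show "(\<Sum>e | e dvd M. r e) \<ge> 0" using less.IH[OF \<open>M < N\<close> M0] .
    qed
    finally show ?thesis .
  qed
qed

context dirichlet_character begin

text \<open>
  Monsky's argument. The Lambert series \<open>\<Sum> \<chi> m * t ^ m / (1 - t ^ m)\<close> has the non-negative power series coefficients
  \<open>c N = \<Sum>d dvd N. \<chi> d\<close>, which equal one at all powers of a prime dividing \<open>n\<close>, so it is unbounded as
  \<open>t \<rightarrow> 1\<close>. If \<open>L 1 = 0\<close>, then subtracting it from \<open>L 1 / (1 - t)\<close> changes only the sign and leaves
  \<open>\<Sum> \<chi> m * b m\<close> with decreasing \<open>b m\<close> and \<open>b 1 = 1\<close>, which is bounded by Abel summation.
\<close>

lemma L_1_nonzero_real: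
  assumes np: "coprime b (int n)" "ch b \<noteq> 1" and real: "\<And>a. coprime a (int n) \<Longrightarrow> ch a ^ 2 = 1"
  shows "L 1 \<noteq> 0"
proof
  assume L0: "L 1 = 0"
  define r where "r m = Re (ch (int m))" for m :: nat
  have val: "ch a = 0 \<or> ch a = 1 \<or> ch a = -1" for a
    using real[of a] zero[of a] by (cases "coprime a (int n)") (auto simp: power2_eq_1_iff)
  have chr: "ch (int m) = of_real (r m)" for m using val[of "int m"] by (auto simp: r_def complex_eq_iff)
  have rval: "r m = 0 \<or> r m = 1 \<or> r m = -1" for m using val[of "int m"] by (auto simp: r_def)
  have rmult: "r (a * b) = r a * r b" for a b
    using mult[of "int a" "int b"] chr by (metis of_nat_mult of_real_eq_iff of_real_mult)
  have r1: "r 1 = 1" using one by (simp add: r_def)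
  define c where "c N = (\<Sum>d | d dvd N. r d)" for N
  have c_nonneg: "c N \<ge> 0" if "N > 0" for N unfolding c_def by (rule divisor_sum_nonneg[OF rmult r1 rval that])
  have "n \<noteq> 1" using np periodic[of b 1] one by (auto simp: cong_def)
  then obtain p where p: "prime p" "p dvd n" using prime_factor_nat modulus by blast
  have rp: "r p = 0"
  proof -
    have "\<not> coprime (int p) (int n)" using p by (metis coprime_absorb_left coprime_int_iff not_prime_unit)
    then show ?thesis using zero by (simp add: r_def)
  qed
  have cp: "c (p ^ k) = 1" for k
  proof -
    have "{d. d dvd p ^ k} = (\<lambda>i. p ^ i) ` {..k}" using p by (auto simp: divides_primepow_nat)
    moreover have "inj_on (\<lambda>i. p ^ i) {..k}" using p prime_gt_1_nat by (auto intro!: inj_onI)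
    ultimately have "c (p ^ k) = (\<Sum>i\<le>k. r (p ^ i))" unfolding c_def by (simp add: sum.reindex)
    moreover have "r (p ^ i) = (if i = 0 then 1 else 0)" for i
      using rp r1 rmult[of p] by (cases i) auto
    ultimately show ?thesis by simp
  qed
  define C where "C = (\<Sum>m<n. norm (ch (int m)))"
  have bound: "(\<Sum>k<K. t ^ (p ^ k)) \<le> C" if t: "0 < t" "t < 1" for t :: real and K
  proof -
    let ?g = "\<lambda>(m, l). ch (int m) * of_real (t ^ (m * l)) :: complex"
    have geo: "((\<lambda>l. t ^ (m * l)) has_sum (t ^ m / (1 - t ^ m))) {1..}" if "m \<ge> 1" for m
    proof -
      have tm: "0 < t ^ m" "t ^ m < 1" using t that by (auto simp: power_less_one_iff)
      have "(\<lambda>l. (t ^ m) ^ Suc l) sums (t ^ m * (1 / (1 - t ^ m)))"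
        using sums_mult[OF geometric_sums[of "t ^ m"], of "t ^ m"] tm by simp
      then have "((\<lambda>l. (t ^ m) ^ Suc l) has_sum (t ^ m / (1 - t ^ m))) UNIV"
        using tm by (intro sums_nonneg_imp_has_sum) auto
      moreover have "bij_betw Suc UNIV {1..}" by (rule bij_betwI[where g = "\<lambda>l. l - 1"]) auto
      ultimately have "((\<lambda>l. (t ^ m) ^ l) has_sum (t ^ m / (1 - t ^ m))) {1..}"
        by (subst (asm) has_sum_reindex_bij_betw)
      then show ?thesis by (simp add: power_mult)
    qed
    have inner: "((\<lambda>l. ?g (m, l)) has_sum (ch (int m) * of_real (t ^ m / (1 - t ^ m)))) {1..}" if "m \<in> {1..}"
        for m
      using has_sum_cmult_right[OF has_sum_of_real[OF geo[of m]], of "ch (int m)"] that by simp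
    have sm: "?g summable_on ({1..} \<times> {1..})"
    proof (rule abs_summable_summable, subst Infinite_Sum.abs_summable_on_Sigma_iff, intro conjI ballI)
      fix m :: nat assume m: "m \<in> {1..}"
      have eq: "norm (?g (m, l)) = norm (ch (int m)) * t ^ (m * l)" for l using t
          by (simp add: norm_mult norm_power)
      have hs: "((\<lambda>l. norm (?g (m, l))) has_sum (norm (ch (int m)) * (t ^ m / (1 - t ^ m)))) {1..}"
        unfolding eq using m by (intro has_sum_cmult_right geo) auto
      then show "(\<lambda>l. ?g (m, l)) abs_summable_on {1..}" by (rule has_sum_imp_summable)
    next
      have "(\<lambda>m. t ^ m / (1 - t)) summable_on {1..}"
        using summable_on_cmult_left[OF has_sum_imp_summable[OF geo[of 1]], of "1 / (1 - t)"] by simp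
      then show "(\<lambda>m. \<Sum>\<^sub>\<infinity>l\<in>{1..}. norm (?g (m, l))) abs_summable_on {1..}"
      proof (rule Infinite_Sum.abs_summable_on_comparison_test')
        fix m :: nat assume m: "m \<in> {1..}"
        have eq: "norm (?g (m, l)) = norm (ch (int m)) * t ^ (m * l)" for l using t
            by (simp add: norm_mult norm_power)
        have hs: "((\<lambda>l. norm (?g (m, l))) has_sum (norm (ch (int m)) * (t ^ m / (1 - t ^ m)))) {1..}"
          unfolding eq using m by (intro has_sum_cmult_right geo) auto
        have le: "t ^ m \<le> t" using power_decreasing[of 1 m t] t m by simp
        have "norm (ch (int m)) * (t ^ m / (1 - t ^ m)) \<le> 1 * (t ^ m / (1 - t))"
          using t le norm_le_1[of "int m"] by (intro mult_mono divide_left_mono) auto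
        then show "norm (\<Sum>\<^sub>\<infinity>l\<in>{1..}. norm (?g (m, l))) \<le> t ^ m / (1 - t)"
          using infsumI[OF hs] t le by (simp add: abs_mult)
      qed
    qed
    define S where "S = infsum ?g ({1..} \<times> {1..})"
    have S: "(?g has_sum S) ({1..} \<times> {1..})" unfolding S_def using sm by (rule has_sum_infsum)
    have hN: "((\<lambda>N. of_real (c N * t ^ N)) has_sum S) {1..}"
    proof -
      have "((\<lambda>N. \<Sum>d | d dvd N. ?g (d, N div d)) has_sum S) {1..}" by (rule has_sum_over_products[OF S])
      moreover have "(\<Sum>d | d dvd N. ?g (d, N div d)) = of_real (c N * t ^ N)" for N
        by (simp add: c_def chr sum_distrib_right)
      ultimately show ?thesis by (simp only:)
    qed
    have hM: "((\<lambda>m. ch (int m) * of_real (t ^ m / (1 - t ^ m))) has_sum S) {1..}"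
      by (rule has_sum_Sigma'[OF S inner])
    have lower: "(\<Sum>k<K. t ^ (p ^ k)) \<le> Re S"
    proof -
      have h: "((\<lambda>N. c N * t ^ N) has_sum Re S) {1..}" using has_sum_Re[OF hN] by simp
      have "sum (\<lambda>N. c N * t ^ N) ((\<lambda>k. p ^ k) ` {..<K}) \<le> Re S"
        by (rule finite_sum_le_has_sum[OF h])
           (use p t c_nonneg in \<open>auto simp: prime_gt_0_nat Suc_le_eq\<close>)
      moreover have "inj_on (\<lambda>k. p ^ k) {..<K}" using p prime_gt_1_nat by (auto intro!: inj_onI)
      ultimately show ?thesis by (simp add: sum.reindex cp)
    qed
    have "norm S \<le> C"
    proof -
      let ?f = "\<lambda>m. ch (int m) * of_real (t ^ m / (1 - t ^ m)) :: complex"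
      have ch0: "ch 0 = 0" by (rule zero_value[OF np])
      have "(?f has_sum S) UNIV"
        using hM by (subst has_sum_cong_neutral[of "{1..}" UNIV ?f ?f]) (auto simp: not_le ch0)
      then have s1: "?f sums S" by (rule has_sum_imp_sums)
      have "(\<lambda>m. ch (int m) * of_nat m powr (-1)) sums L 1" using L_extends(2)[OF np, of 1] by simp
      from sums_mult[OF this, of "1 / of_real (1 - t)"]
      have s2: "(\<lambda>m. 1 / of_real (1 - t) * (ch (int m) * of_nat m powr (-1))) sums 0" by (simp add: L0)
      define b where "b m = 1 / (real m * (1 - t)) - t ^ m / (1 - t ^ m)" for m
      have "(\<lambda>m. ch (int m) * of_real (b m)) sums (0 - S)"
      proof -
        have eq: "ch (int m) * of_real (b m) = 1 / of_real (1 - t) * (ch (int m) * of_nat m powr (-1)) - ?f m"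
            for m
        proof (cases "m = 0")
          case False
          then have "(of_nat m :: complex) powr (-1) = 1 / of_nat m" by (simp add: powr_minus inverse_eq_divide)
          then show ?thesis unfolding b_def by (simp only: of_real_diff of_real_divide of_real_1 of_real_mult
              of_real_of_nat_eq)
            (simp add: algebra_simps)
        qed (simp add: ch0)
        show ?thesis unfolding eq by (intro sums_diff s1 s2)
      qed
      then have "(\<lambda>N. \<Sum>m\<le>N. ch (int m) * of_real (b m)) \<longlonglongrightarrow> - S" by (simp add: sums_def_le)
      then have lim: "(\<lambda>N. norm (\<Sum>m\<le>N. ch (int m) * of_real (b m))) \<longlonglongrightarrow> norm (- S)" by (rule tendsto_norm)
      have "norm (- S) \<le> C * b 1"
      proof (rule tendsto_upperbound[OF lim])
        show "\<forall>\<^sub>F N in sequentially. norm (\<Sum>m\<le>N. ch (int m) * of_real (b m)) \<le> C * b 1"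
        proof (intro always_eventually allI abel_summation_bound)
          show "norm (\<Sum>m\<le>N. ch (int m)) \<le> C" for N unfolding C_def by (rule partial_sums_bounded[OF np])
          show "m \<ge> 1 \<Longrightarrow> b (Suc m) \<le> b m" "m \<ge> 1 \<Longrightarrow> b m \<ge> 0" for m
            unfolding b_def by (rule lambert_difference_decreasing[OF t], assumption)+
        qed (simp add: ch0)
      qed simp
      moreover have "b 1 = 1" unfolding b_def by (rule lambert_difference_decreasing(3)[OF t])
      ultimately show ?thesis by simp
    qed
    then show ?thesis using lower complex_Re_le_cmod[of S] by linarith
  qed
  define K where "K = nat \<lceil>C\<rceil> + 1"
  have "((\<lambda>t. \<Sum>k<K. t ^ (p ^ k)) \<longlongrightarrow> (\<Sum>k<K. 1 ^ (p ^ k))) (at_left (1::real))"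
    by (intro tendsto_intros)
  moreover have "\<forall>\<^sub>F t in at_left (1::real). (\<Sum>k<K. t ^ (p ^ k)) \<le> C"
    using eventually_at_left_real[of 0 1] by (rule eventually_mono) (auto intro: bound)
  ultimately have "(\<Sum>k<K. 1 ^ (p ^ k)) \<le> C" by (rule tendsto_upperbound) simp
  then have "real K \<le> C" by simp
  then show False unfolding K_def by linarith
qed

end

section \<open>Convergence of the Moebius series of odd periodic functions\<close>

context dirichlet_character begin

lemma L_nonzero_odd:
  assumes odd: "ch (-1) = -1" and s: "Re s \<ge> 1"
  shows "L s \<noteq> 0"
proof -
  have np: "coprime (-1) (int n)" "ch (-1) \<noteq> 1" using odd by auto
  consider "Re s > 1" | t where "s = Complex 1 t" using s by (metis complex.exhaust_sel less_le)
  then show ?thesis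
  proof cases
    case 2
    show ?thesis
    proof (cases "t \<noteq> 0 \<or> (\<exists>b. coprime b (int n) \<and> ch b ^ 2 \<noteq> 1)")
      case True
      then show ?thesis using L_nonzero_complex[OF np] 2 by blast
    next
      case False
      then have "s = 1" using 2 by (simp add: complex_eq_iff)
      then show ?thesis using L_1_nonzero_real[OF np] False by blast
    qed
  qed (rule L_nonzero)
qed

text \<open>
  Non-vanishing on \<open>Re s \<ge> 1\<close> makes \<open>1 / L\<close> holomorphic on a neighbourhood of this half plane, as the Tauberian
  theorem requires. Recording the limit from the right along with the sum lets identities valid for \<open>s > 1\<close> be
  carried over to \<open>s = 1\<close>.
\<close>

lemma moebius_converges_odd:
  assumes odd: "ch (-1) = -1"
  shows "(\<lambda>m. of_int (moebius_mu m) * ch (int m) / of_nat m) sums (1 / L 1)"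
    and "((\<lambda>s::real. \<Sum>m. of_int (moebius_mu m) * ch (int m) * of_nat m powr (- of_real s))
        \<longlongrightarrow> 1 / L 1) (at_right 1)"
proof -
  have np: "coprime (-1) (int n)" "ch (-1) \<noteq> 1" using odd by auto
  note hol = L_extends(1)[OF np]
  define U where "U = {s. Re s > 0} \<inter> L -` (- {0})"
  have U: "open U" unfolding U_def
    by (rule continuous_open_preimage[OF holomorphic_on_imp_continuous_on[OF hol] open_halfspace_Re_gt]) auto
  have sub: "{s. Re s \<ge> 1} \<subseteq> U" using L_nonzero_odd[OF odd] by (auto simp: U_def)
  have hinv: "(\<lambda>s. 1 / L s) holomorphic_on U"
    by (intro holomorphic_intros holomorphic_on_subset[OF hol]) (auto simp: U_def)
  show "(\<lambda>m. of_int (moebius_mu m) * ch (int m) / of_nat m) sums (1 / L 1)"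
  proof (rule newman_tauberian[OF _ U sub hinv])
    show "norm (of_int (moebius_mu m) * ch (int m)) \<le> 1" for m
      by (rule moebius_bounded) (rule norm_le_1)
  qed (rule moebius_sums_inverse)
  have "continuous_on U (\<lambda>s. 1 / L s)" using hinv by (rule holomorphic_on_imp_continuous_on)
  then have "isCont (\<lambda>s. 1 / L s) 1" using U subsetD[OF sub, of 1] by (simp add: continuous_on_eq_continuous_at)
  then have "((\<lambda>s::real. 1 / L (of_real s)) \<longlongrightarrow> 1 / L 1) (at_right 1)"
    by (intro isCont_tendsto_compose[where g = "\<lambda>s. 1 / L s"]) (auto intro!: tendsto_eq_intros)
  moreover have "\<forall>\<^sub>F s::real in at_right 1. 1 / L (of_real s)
      = (\<Sum>m. of_int (moebius_mu m) * ch (int m) * of_nat m powr (- of_real s))"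
    using eventually_at_right_less[of 1]
  proof eventually_elim
    case (elim s)
    then show ?case using moebius_sums_inverse[of "of_real s"] by (simp add: sums_iff)
  qed
  ultimately show "((\<lambda>s::real. \<Sum>m. of_int (moebius_mu m) * ch (int m) * of_nat m powr (- of_real s))
      \<longlongrightarrow> 1 / L 1) (at_right 1)"
    by (rule Lim_transform_eventually)
qed

end

definition odd_unit_function :: "nat \<Rightarrow> (int \<Rightarrow> complex) \<Rightarrow> bool" where
  "odd_unit_function n f \<longleftrightarrow> (\<forall>a b. [a = b] (mod int n) \<longrightarrow> f a = f b) \<and>
     (\<forall>a. \<not> coprime a (int n) \<longrightarrow> f a = 0) \<and> (\<forall>a. f (- a) = - f a)"

lemma odd_unit_functionD:
  assumes "odd_unit_function n f"
  shows "[a = b] (mod int n) \<Longrightarrow> f a = f b" "\<not> coprime a (int n) \<Longrightarrow> f a = 0" "f (- a) = - f a"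
  using assms unfolding odd_unit_function_def by blast+

lemma sum_roots_of_unity:
  assumes "N > 0" "i < N"
  shows "(\<Sum>k<N. exp (2 * of_real pi * \<i> / of_nat N) ^ (k * i)) = (if i = 0 then of_nat N else (0::complex))"
proof (cases "i = 0")
  case False
  let ?w = "exp (2 * of_real pi * \<i> / of_nat N) :: complex"
  have wN: "?w ^ N = 1" using assms by (simp flip: exp_of_nat_mult)
  have wi: "?w ^ i = exp (2 * of_real pi * \<i> * of_nat i / of_nat N)"
      by (simp add: mult.commute flip: exp_of_nat_mult)
  have "?w ^ i \<noteq> 1"
    unfolding wi using complex_root_unity_eq_1[of N i] assms False by (auto dest: dvd_imp_le)
  moreover have "(\<Sum>k<N. (?w ^ i) ^ k) * (?w ^ i - 1) = (?w ^ i) ^ N - 1"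
    by (simp add: power_diff_1_eq mult.commute)
  moreover have "(?w ^ i) ^ N = 1" using wN by (metis mult.commute power_mult power_one)
  ultimately have "(\<Sum>k<N. (?w ^ i) ^ k) = 0" by simp
  then show ?thesis using False by (simp add: power_mult[symmetric] mult.commute)
qed simp

lemma odd_unit_function_sum:
  "finite A \<Longrightarrow> (\<And>k. k \<in> A \<Longrightarrow> odd_unit_function n (F k)) \<Longrightarrow> odd_unit_function n (\<lambda>a. \<Sum>k\<in>A. F k a)"
  unfolding odd_unit_function_def by (auto simp: sum_negf intro!: sum.cong sum.neutral)

text \<open>
  Every odd periodic function supported on the units is a sum of multiples of odd characters. This follows by
  splitting off one unit after another: for a unit \<open>g\<close> of order dividing \<open>N\<close>, averaging the translates of \<open>f\<close> by the powers of
  \<open>g\<close> against the \<open>N\<close>-th roots of unity writes \<open>f\<close> as a sum of eigenfunctions of the translation by \<open>g\<close>, and these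
  averages keep the eigenfunction property for the other units. A simultaneous eigenfunction for all units is a
  multiple of a character.
\<close>

lemma odd_unit_function_induct:
  assumes n: "n > 0" and f: "odd_unit_function n f"
    and zero: "P (\<lambda>_. 0)"
    and add: "\<And>f g. odd_unit_function n f \<Longrightarrow> odd_unit_function n g \<Longrightarrow> P f \<Longrightarrow> P g \<Longrightarrow> P (\<lambda>a. f a + g a)"
    and char: "\<And>c ch. dirichlet_character n ch \<Longrightarrow> ch (-1) = -1 \<Longrightarrow> P (\<lambda>a. c * ch a)"
  shows "P f"
proof -
  define eig where "eig f g \<longleftrightarrow> (\<exists>w. \<forall>a. f (g * a) = w * f a)" for f :: "int \<Rightarrow> complex" and g
  define G where "G = {g \<in> {0..<int n}. coprime g (int n)}"
  have psum: "P (\<lambda>a. \<Sum>k<N. F k a)" if "\<And>k. k < N \<Longrightarrow> odd_unit_function n (F k)" "\<And>k. k < N \<Longrightarrow> P (F k)"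
      for N :: nat and F
    using that
  proof (induction N)
    case 0
    then show ?case using zero by simp
  next
    case (Suc N)
    have "P (\<lambda>a. (\<Sum>k<N. F k a) + F N a)"
      by (rule add) (use Suc in \<open>auto intro: odd_unit_function_sum\<close>)
    then show ?case by simp
  qed
  have base: "P f" if V: "odd_unit_function n f" and e: "\<And>g. g \<in> G \<Longrightarrow> eig f g" for f
  proof -
    note V = odd_unit_functionD[OF V]
    have e': "\<exists>w. \<forall>a. f (g * a) = w * f a" if g: "coprime g (int n)" for g
    proof -
      have c: "[g mod int n = g] (mod int n)" by (simp add: cong_def)
      then have "g mod int n \<in> G" using n g cong_imp_coprime[OF cong_sym[OF c]] by (auto simp: G_def)
      then obtain w where w: "\<And>a. f ((g mod int n) * a) = w * f a" using e unfolding eig_def by blast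
      have "f (g * a) = f ((g mod int n) * a)" for a by (rule V(1)) (simp add: cong_def mod_mult_left_eq)
      then show ?thesis using w by auto
    qed
    have m: "f (a * b) * f 1 = f a * f b" for a b
    proof (cases "coprime a (int n)")
      case True
      then obtain w where w: "\<And>x. f (a * x) = w * f x" using e' by blast
      show ?thesis using w[of b] w[of 1] by simp
    next
      case False
      then have "\<not> coprime (a * b) (int n)" by auto
      then show ?thesis using False V(2) by simp
    qed
    show "P f"
    proof (cases "f 1 = 0")
      case True
      have "f a = 0" for a
      proof (cases "coprime a (int n)")
        case c: True
        then obtain w where "\<And>x. f (a * x) = w * f x" using e' by blast
        from this[of 1] show ?thesis using True by simp
      qed (rule V(2))
      then have "f = (\<lambda>_. 0)" by auto
      then show ?thesis using zero by simp
    next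
      case False
      have "dirichlet_character n (\<lambda>a. f a / f 1)"
      proof
        show "f (a * b) / f 1 = f a / f 1 * (f b / f 1)" for a b
          using m[of a b] False by (simp add: field_simps)
        show "f a / f 1 = f b / f 1" if "[a = b] (mod int n)" for a b using V(1)[OF that] by simp
        show "f a / f 1 = 0" if "\<not> coprime a (int n)" for a using V(2)[OF that] by simp
      qed (use n False in auto)
      moreover have "f (-1) / f 1 = -1" using V(3)[of 1] False by simp
      ultimately have "P (\<lambda>a. f 1 * (f a / f 1))" by (rule char)
      then show ?thesis using False by simp
    qed
  qed
  have step: "\<forall>f. odd_unit_function n f \<and> (\<forall>g\<in>G - T. eig f g) \<longrightarrow> P f" if "finite T" "T \<subseteq> G" for T
    using that
  proof (induction T)
    case empty
    then show ?case using base by auto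
  next
    case (insert g T)
    show ?case
    proof (intro allI impI, elim conjE)
      fix f assume V: "odd_unit_function n f" and e: "\<forall>h\<in>G - insert g T. eig f h"
      note V' = odd_unit_functionD[OF V]
      define N where "N = totient n"
      have N: "N > 0" using n by (simp add: N_def)
      have g: "coprime g (int n)" "0 \<le> g" using insert.prems by (auto simp: G_def)
      have gN: "[g ^ N = 1] (mod int n)"
      proof -
        obtain h where h: "g = int h" using g by (metis nonneg_int_cases)
        have "[h ^ N = 1] (mod n)" unfolding N_def using g h by (intro euler_theorem) simp
        then show ?thesis using h by (metis cong_int_iff of_nat_1 of_nat_power)
      qed
      define w where "w = exp (2 * of_real pi * \<i> / of_nat N :: complex)"
      have wN: "w ^ N = 1" using N by (simp add: w_def flip: exp_of_nat_mult)
      have w0: "w \<noteq> 0" by (simp add: w_def)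
      \<comment> \<open>The projection of \<open>f\<close> to the eigenspace of the translation by \<open>g\<close> for the eigenvalue \<open>w ^ (- k)\<close>.\<close>
      define F where "F k a = (\<Sum>i<N. w ^ (k * i) * f (g ^ i * a)) / of_nat N" for k a
      have FV: "odd_unit_function n (F k)" for k
        unfolding odd_unit_function_def
      proof (intro conjI allI impI)
        show "F k a = F k b" if "[a = b] (mod int n)" for a b
          unfolding F_def using V'(1)[OF cong_mult[OF cong_refl that]] by simp
        show "F k a = 0" if "\<not> coprime a (int n)" for a
        proof -
          have "\<not> coprime (g ^ i * a) (int n)" for i using that by auto
          then show ?thesis using V'(2) by (simp add: F_def)
        qed
        show "F k (- a) = - F k a" for a
          using V'(3) by (simp add: F_def sum_negf)
      qed
      have Fg: "eig (F k) g" for k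
        unfolding eig_def
      proof (intro exI allI)
        fix a
        let ?h = "\<lambda>i. w ^ (k * i) * f (g ^ i * a)"
        have hN: "?h N = ?h 0"
        proof -
          have "w ^ (k * N) = 1" using wN by (metis mult.commute power_mult power_one)
          moreover have "f (g ^ N * a) = f (1 * a)" by (intro V'(1) cong_mult gN cong_refl)
          ultimately show ?thesis by simp
        qed
        have "w ^ k * F k (g * a) = (\<Sum>i<N. ?h (Suc i)) / of_nat N"
          by (simp add: F_def sum_distrib_left power_add mult_ac)
        also have "(\<Sum>i<N. ?h (Suc i)) = (\<Sum>i<Suc N. ?h i) - ?h 0"
          by (subst sum.lessThan_Suc_shift) simp
        also have "\<dots> = (\<Sum>i<N. ?h i)" using hN by simp
        finally have "w ^ k * F k (g * a) = F k a" by (simp add: F_def)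
        then show "F k (g * a) = inverse (w ^ k) * F k a" using w0 by (simp add: field_simps)
      qed
      have Fh: "eig (F k) h" if "h \<in> G - insert g T" for k h
      proof -
        have "eig f h" using e that by (rule bspec)
        then obtain v where v: "\<forall>a. f (h * a) = v * f a" unfolding eig_def ..
        have "f (g ^ i * (h * a)) = v * f (g ^ i * a)" for i a
          using v[rule_format, of "g ^ i * a"] by (simp add: mult.left_commute)
        then have "\<forall>a. F k (h * a) = v * F k a"
          by (simp add: F_def sum_distrib_left mult.left_commute)
        then show ?thesis unfolding eig_def ..
      qed
      have PF: "P (F k)" for k
      proof -
        have "\<forall>h\<in>G - T. eig (F k) h" using Fg Fh by (metis Diff_iff insertE)
        then show ?thesis using insert.IH insert.prems FV by blast
      qed
      have "f a = (\<Sum>k<N. F k a)" for a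
      proof -
        have "(\<Sum>k<N. F k a) = (\<Sum>k<N. \<Sum>i<N. w ^ (k * i) * f (g ^ i * a)) / of_nat N"
          by (simp add: F_def sum_divide_distrib)
        also have "(\<Sum>k<N. \<Sum>i<N. w ^ (k * i) * f (g ^ i * a)) = (\<Sum>i<N. \<Sum>k<N. w ^ (k * i) * f (g ^ i * a))"
          by (rule sum.swap)
        also have "\<dots> = (\<Sum>i<N. (if i = 0 then of_nat N else 0) * f (g ^ i * a))"
          using sum_roots_of_unity[OF N] by (simp add: w_def sum_distrib_right[symmetric])
        also have "\<dots> = (\<Sum>i<N. (if i = 0 then of_nat N * f a else 0))" by (rule sum.cong) auto
        also have "\<dots> = of_nat N * f a" using N by simp
        finally show ?thesis using N by simp
      qed
      then have "f = (\<lambda>a. \<Sum>k<N. F k a)" by auto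
      moreover have "P (\<lambda>a. \<Sum>k<N. F k a)" using FV PF by (rule psum)
      ultimately show "P f" by simp
    qed
  qed
  have "finite G" by (rule finite_subset[of _ "{0..<int n}"]) (auto simp: G_def)
  from step[OF this order_refl] show ?thesis using f by blast
qed

lemma odd_unit_function_bounded:
  assumes "n > 0" "odd_unit_function n f"
  obtains C where "\<And>a. norm (f a) \<le> C"
proof -
  have "norm (f a) \<le> (\<Sum>x\<in>{0..<int n}. norm (f x))" for a
  proof -
    have "f a = f (a mod int n)" by (rule odd_unit_functionD(1)[OF assms(2)]) (simp add: cong_def)
    moreover have "a mod int n \<in> {0..<int n}" using assms by simp
    ultimately show ?thesis
      using member_le_sum[of "a mod int n" "{0..<int n}" "\<lambda>x. norm (f x)"] by simp
  qed
  then show ?thesis using that by blast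
qed

theorem moebius_converges:
  assumes "n > 0" "odd_unit_function n f"
  shows "\<exists>l. (\<lambda>m. of_int (moebius_mu m) * f (int m) / of_nat m) sums l \<and>
    ((\<lambda>s::real. \<Sum>m. of_int (moebius_mu m) * f (int m) * of_nat m powr (- of_real s)) \<longlongrightarrow> l) (at_right 1)"
  using assms
proof (rule odd_unit_function_induct, goal_cases)
  case 1
  show ?case by (rule exI[of _ 0]) simp
next
  case (2 f g)
  then obtain l l' where l: "(\<lambda>m. of_int (moebius_mu m) * f (int m) / of_nat m) sums l"
      "((\<lambda>s::real. \<Sum>m. of_int (moebius_mu m) * f (int m) * of_nat m powr (- of_real s)) \<longlongrightarrow> l) (at_right 1)"
      "(\<lambda>m. of_int (moebius_mu m) * g (int m) / of_nat m) sums l'"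
      "((\<lambda>s::real. \<Sum>m. of_int (moebius_mu m) * g (int m) * of_nat m powr (- of_real s)) \<longlongrightarrow> l') (at_right 1)"
          by blast
  obtain C C' where C: "\<And>a. norm (f a) \<le> C" "\<And>a. norm (g a) \<le> C'"
    using odd_unit_function_bounded[OF assms(1)] 2 by metis
  have "\<forall>\<^sub>F s::real in at_right 1. (\<Sum>m. of_int (moebius_mu m) * f (int m) * of_nat m powr (- of_real s))
      + (\<Sum>m. of_int (moebius_mu m) * g (int m) * of_nat m powr (- of_real s))
      = (\<Sum>m. of_int (moebius_mu m) * (f (int m) + g (int m)) * of_nat m powr (- of_real s))"
    using eventually_at_right_less[of 1]
  proof eventually_elim
    case (elim s)
    then have s: "Re (of_real s) > 1" by simp
    have "summable (\<lambda>m. of_int (moebius_mu m) * f (int m) * of_nat m powr (- of_real s))"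
      by (rule summable_norm_cancel[OF summable_dirichlet_bounded[OF moebius_bounded[of f, OF C(1)] s]])
    moreover have "summable (\<lambda>m. of_int (moebius_mu m) * g (int m) * of_nat m powr (- of_real s))"
      by (rule summable_norm_cancel[OF summable_dirichlet_bounded[OF moebius_bounded[of g, OF C(2)] s]])
    ultimately show ?case by (simp only: suminf_add distrib_left distrib_right)
  qed
  then have "((\<lambda>s::real. \<Sum>m. of_int (moebius_mu m) * (f (int m) + g (int m)) * of_nat m powr (- of_real s))
      \<longlongrightarrow> l + l') (at_right 1)"
    by (rule Lim_transform_eventually[OF tendsto_add[OF l(2,4)]])
  moreover have "(\<lambda>m. of_int (moebius_mu m) * (f (int m) + g (int m)) / of_nat m) sums (l + l')"
    using sums_add[OF l(1,3)] by (simp add: distrib_left add_divide_distrib)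
  ultimately show ?case by blast
next
  case (3 c ch)
  then interpret dirichlet_character n ch by simp
  have "(\<lambda>m. c * (of_int (moebius_mu m) * ch (int m) / of_nat m)) sums (c * (1 / L 1))"
    by (intro sums_mult moebius_converges_odd 3)
  moreover have "((\<lambda>s::real. c * (\<Sum>m. of_int (moebius_mu m) * ch (int m) * of_nat m powr (- of_real s)))
      \<longlongrightarrow> c * (1 / L 1)) (at_right 1)"
    by (intro tendsto_mult tendsto_const moebius_converges_odd 3)
  moreover have "\<forall>\<^sub>F s::real in at_right 1. c * (\<Sum>m. of_int (moebius_mu m) * ch (int m)
      * of_nat m powr (- of_real s))
     = (\<Sum>m. of_int (moebius_mu m) * (c * ch (int m)) * of_nat m powr (- of_real s))"
    using eventually_at_right_less[of 1]
  proof eventually_elim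
    case (elim s)
    then show ?case using moebius_summable[of "of_real s"]
        by (subst suminf_mult[symmetric]) (auto simp: mult_ac)
  qed
  ultimately show ?case by (intro exI[of _ "c * (1 / L 1)"]) (auto intro: Lim_transform_eventually simp:
      mult_ac)
qed

section \<open>Cotangent series and inverse cotangent series are convolution inverses\<close>

text \<open>
  Summing over the integers \<open>m \<equiv> j\<close> a function of parity \<open>\<eta>\<close> amounts to summing it, weighted by this function,
  over the positive integers: a negative \<open>m\<close> contributes through \<open>- m \<equiv> - j\<close>.
\<close>

definition parity_indicator :: "complex \<Rightarrow> nat \<Rightarrow> int \<Rightarrow> int \<Rightarrow> complex" where
  "parity_indicator \<eta> n j m = of_bool ([m = j] (mod int n)) + \<eta> * of_bool ([m = - j] (mod int n))"

definition unit_residues :: "nat \<Rightarrow> int set" where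
  "unit_residues n = {k \<in> {0..<int n}. coprime k (int n)}"

lemma finite_unit_residues [simp]: "finite (unit_residues n)"
  by (rule finite_subset[of _ "{0..<int n}"]) (auto simp: unit_residues_def)

lemma cong_minus_iff: "[- a = b] (mod m) \<longleftrightarrow> [a = - b] (mod m)" for a b m :: int
  by (metis cong_minus_minus_iff minus_minus)

lemma parity_indicator_cong:
  assumes "[j = j'] (mod int n)" "[m = m'] (mod int n)"
  shows "parity_indicator \<eta> n j m = parity_indicator \<eta> n j' m'"
proof -
  have "[m = j] (mod int n) \<longleftrightarrow> [m' = j'] (mod int n)"
    using assms by (meson cong_sym cong_trans)
  moreover have "[- j = - j'] (mod int n)" using assms by (simp add: cong_minus_minus_iff)
  then have "[m = - j] (mod int n) \<longleftrightarrow> [m' = - j'] (mod int n)"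
    using assms by (meson cong_sym cong_trans)
  ultimately show ?thesis by (simp add: parity_indicator_def)
qed

lemma parity_indicator_minus:
  assumes "\<eta> * \<eta> = 1"
  shows "parity_indicator \<eta> n j (- m) = \<eta> * parity_indicator \<eta> n j m"
  using assms by (simp add: parity_indicator_def cong_minus_iff distrib_left mult.assoc[symmetric])

lemma parity_indicator_uminus_left:
  assumes "\<eta> * \<eta> = 1"
  shows "parity_indicator \<eta> n (- j) m = \<eta> * parity_indicator \<eta> n j m"
  using assms by (simp add: parity_indicator_def cong_minus_iff distrib_left mult.assoc[symmetric])

lemma parity_indicator_not_coprime:
  assumes "coprime j (int n)" "\<not> coprime m (int n)"
  shows "parity_indicator \<eta> n j m = 0"
proof -
  have "\<not> [m = j] (mod int n)" using assms cong_imp_coprime[of j m "int n"] by (auto dest: cong_sym)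
  moreover have "\<not> [m = - j] (mod int n)" using assms cong_imp_coprime[of "- j" m "int n"]
      by (auto dest: cong_sym)
  ultimately show ?thesis by (simp add: parity_indicator_def)
qed

lemma parity_indicator_mult:
  assumes "coprime a (int n)"
  shows "parity_indicator \<eta> n (a * j) (a * m) = parity_indicator \<eta> n j m"
proof -
  have "[a * m = a * j] (mod int n) \<longleftrightarrow> [m = j] (mod int n)"
    using assms by (simp add: cong_mult_lcancel)
  moreover have "[a * m = a * (- j)] (mod int n) \<longleftrightarrow> [m = - j] (mod int n)"
    using assms by (subst cong_mult_lcancel) auto
  ultimately show ?thesis by (simp add: parity_indicator_def)
qed

lemma modular_inverse_coprime:
  assumes "coprime k (int n)"
  shows "coprime (modular_inverse (int n) k) (int n)" "[k * modular_inverse (int n) k = 1] (mod int n)"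
  using assms by (auto intro: coprime_modular_inverse cong_modular_inverse1)

lemma parity_indicator_inverse:
  assumes "coprime k (int n)"
  shows "parity_indicator \<eta> n (modular_inverse (int n) k * j) m = parity_indicator \<eta> n j (k * m)"
proof -
  have "[k * (modular_inverse (int n) k * j) = 1 * j] (mod int n)"
    unfolding mult.assoc[symmetric] using modular_inverse_coprime(2)[OF assms] by (rule cong_mult) simp
  then show ?thesis
    using parity_indicator_mult[OF assms, of \<eta> "modular_inverse (int n) k * j" m]
        parity_indicator_cong[OF _ cong_refl]
    by simp
qed

lemma sum_unit_residues_of_bool:
  assumes "coprime d (int n)" "n > 0" and per: "\<And>a b. [a = b] (mod int n) \<Longrightarrow> g a = g b"
  shows "(\<Sum>k\<in>unit_residues n. of_bool ([d = k] (mod int n)) * g k) = (g d :: complex)"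
proof -
  have c: "[d mod int n = d] (mod int n)" by (simp add: cong_def)
  have mem: "d mod int n \<in> unit_residues n"
    using assms cong_imp_coprime[OF cong_sym[OF c]] by (simp add: unit_residues_def)
  have iff: "[d = k] (mod int n) \<longleftrightarrow> k = d mod int n" if "k \<in> unit_residues n" for k
    using that by (auto simp: unit_residues_def cong_def)
  have "(\<Sum>k\<in>unit_residues n. of_bool ([d = k] (mod int n)) * g k)
      = (\<Sum>k\<in>unit_residues n. if k = d mod int n then g k else 0)"
    by (rule sum.cong) (auto simp: iff)
  also have "\<dots> = g (d mod int n)"
    using mem by simp
  finally show ?thesis using per[OF c] by simp
qed

text \<open>
  For a unit \<open>d\<close> only the classes of \<open>d\<close> and \<open>- d\<close> contribute to the sum over \<open>k\<close>, and both give the same value.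
\<close>

lemma parity_indicator_convolution:
  assumes "\<eta> * \<eta> = 1" "n > 0" "coprime j (int n)"
  shows "(\<Sum>k\<in>unit_residues n. parity_indicator \<eta> n k d * parity_indicator \<eta> n (modular_inverse (int n) k * j) e)
     = 2 * parity_indicator \<eta> n j (d * e)"
proof (cases "coprime d (int n)")
  case True
  let ?g = "\<lambda>k. parity_indicator \<eta> n j (k * e)"
  have per: "?g a = ?g b" if "[a = b] (mod int n)" for a b
    using that by (intro parity_indicator_cong cong_mult) auto
  have "(\<Sum>k\<in>unit_residues n. parity_indicator \<eta> n k d * parity_indicator \<eta> n (modular_inverse (int n) k * j) e)
    = (\<Sum>k\<in>unit_residues n. of_bool ([d = k] (mod int n)) * ?g k + \<eta> * (of_bool ([- d = k] (mod int n)) * ?g k))"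
  proof (rule sum.cong)
    fix k assume "k \<in> unit_residues n"
    then have "coprime k (int n)" by (simp add: unit_residues_def)
    from parity_indicator_inverse[OF this, of \<eta> j e]
    show "parity_indicator \<eta> n k d * parity_indicator \<eta> n (modular_inverse (int n) k * j) e =
       of_bool ([d = k] (mod int n)) * ?g k + \<eta> * (of_bool ([- d = k] (mod int n)) * ?g k)"
      by (simp add: parity_indicator_def[of \<eta> n k d] cong_minus_iff distrib_right mult.assoc)
  qed simp
  also have "\<dots> = ?g d + \<eta> * ?g (- d)"
    unfolding sum.distrib sum_distrib_left[symmetric]
    using True assms by (subst (1 2) sum_unit_residues_of_bool[OF _ _ per]) auto
  also have "?g (- d) = \<eta> * ?g d" using parity_indicator_minus[OF assms(1), of n j "d * e"] by simp
  finally show ?thesis using assms(1) by (simp add: mult.assoc[symmetric])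
next
  case False
  then have "\<not> coprime (d * e) (int n)" by auto
  then have "parity_indicator \<eta> n j (d * e) = 0" using assms by (intro parity_indicator_not_coprime)
  moreover have "parity_indicator \<eta> n k d = 0" if "k \<in> unit_residues n" for k
    using that False by (intro parity_indicator_not_coprime) (auto simp: unit_residues_def)
  ultimately show ?thesis by simp
qed

text \<open>
  For \<open>\<eta> = (-1) ^ r\<close> and \<open>s = r\<close> this series and the next one extend over all integers congruent to \<open>j\<close>. A
  complex exponent makes \<open>r = 1\<close> accessible as a limit of the absolutely convergent case.
\<close>

definition cot_series :: "complex \<Rightarrow> nat \<Rightarrow> int \<Rightarrow> complex \<Rightarrow> complex" where
  "cot_series \<eta> n j s = (\<Sum>m. parity_indicator \<eta> n j (int m) * of_nat m powr (-s))"

definition inverse_cot_series :: "complex \<Rightarrow> nat \<Rightarrow> int \<Rightarrow> complex \<Rightarrow> complex" where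
  "inverse_cot_series \<eta> n j s = (\<Sum>m. of_int (moebius_mu m) * parity_indicator \<eta> n j (int m)
      * of_nat m powr (-s))"

lemma norm_parity_indicator: "norm \<eta> = 1 \<Longrightarrow> norm (parity_indicator \<eta> n j m) \<le> 2"
  unfolding parity_indicator_def by (rule order_trans[OF norm_triangle_ineq]) (auto simp: norm_mult)

text \<open>
  By bilinearity this is Moebius inversion, applied to \<open>2 * parity_indicator \<eta> n j (d * e)\<close> as a function of the
  product \<open>d * e\<close>.
\<close>

lemma cot_series_convolution:
  assumes eta: "\<eta> * \<eta> = 1" "norm \<eta> = 1" and n: "n > 0" "coprime j (int n)" and s: "Re s > 1"
  shows "(\<Sum>k\<in>unit_residues n. inverse_cot_series \<eta> n k s * cot_series \<eta> n (modular_inverse (int n) k * j) s)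
     = 2 * parity_indicator \<eta> n j 1"
proof -
  let ?p = "parity_indicator \<eta> n"
  note bp = norm_parity_indicator[OF eta(2)]
  have sp: "summable (\<lambda>m. norm (?p i (int m) * of_nat m powr (-s)))" for i
    by (rule summable_dirichlet_bounded[OF bp s])
  have smu: "summable (\<lambda>m. norm (of_int (moebius_mu m) * ?p i (int m) * of_nat m powr (-s)))" for i
    by (rule summable_dirichlet_bounded[OF moebius_bounded[OF bp] s])
  let ?T = "\<lambda>k N. (\<Sum>d | d dvd N. (of_int (moebius_mu d) * ?p k (int d)) * ?p (modular_inverse (int n) k * j)
      (int (N div d))) * of_nat N powr (-s)"
  have "(\<lambda>N. ?T k N) sums (inverse_cot_series \<eta> n k s * cot_series \<eta> n (modular_inverse (int n) k * j) s)" for k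
    unfolding inverse_cot_series_def cot_series_def
    by (intro dirichlet_product smu sp summable_sums summable_norm_cancel[OF smu] summable_norm_cancel[OF sp])
  then have "(\<lambda>N. \<Sum>k\<in>unit_residues n. ?T k N) sums
     (\<Sum>k\<in>unit_residues n. inverse_cot_series \<eta> n k s * cot_series \<eta> n (modular_inverse (int n) k * j) s)"
    by (intro sums_sum)
  moreover have "(\<Sum>k\<in>unit_residues n. ?T k N) = (if N = 1 then 2 * ?p j 1 else 0)" for N
  proof (cases "N = 0")
    case False
    have "(\<Sum>k\<in>unit_residues n. \<Sum>d | d dvd N. (of_int (moebius_mu d) * ?p k (int d))
        * ?p (modular_inverse (int n) k * j) (int (N div d)))
       = (\<Sum>d | d dvd N. \<Sum>k\<in>unit_residues n. (of_int (moebius_mu d) * ?p k (int d))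
           * ?p (modular_inverse (int n) k * j) (int (N div d)))"
      by (rule sum.swap)
    also have "\<dots> = (\<Sum>d | d dvd N. of_int (moebius_mu d) * (2 * ?p j (int (d * (N div d)))))"
      by (rule sum.cong) (simp_all only: mult.assoc sum_distrib_left[symmetric]
          parity_indicator_convolution[OF eta(1) n] of_nat_mult)
    also have "\<dots> = (if N = 1 then 2 * ?p j (int 1) else 0)"
      using False by (intro moebius_inversion_at) simp
    finally show ?thesis by (simp add: sum_distrib_right[symmetric])
  qed simp
  ultimately have "(\<lambda>N. if N = 1 then 2 * ?p j 1 else 0) sums
     (\<Sum>k\<in>unit_residues n. inverse_cot_series \<eta> n k s * cot_series \<eta> n (modular_inverse (int n) k * j) s)"
         by simp
  moreover have "(\<lambda>N::nat. if N = 1 then 2 * ?p j 1 else 0) sums (2 * ?p j 1)"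
    using sums_single[of 1 "\<lambda>_. 2 * ?p j 1"] by simp
  ultimately show ?thesis by (rule sums_unique2)
qed

lemma of_nat_powr_minus_nat: "m > 0 \<Longrightarrow> (of_nat m :: complex) powr (- of_nat r) = 1 / of_nat m ^ r"
  by (simp add: powr_minus powr_nat' inverse_eq_divide)

text \<open>
  The sum over the residue class splits into its positive and its negative part.
\<close>

lemma moebius_series_abs_convergent:
  assumes r: "r \<ge> 2" and n: "n > 0"
  shows "of_real (moebius_series n r j) = inverse_cot_series ((-1) ^ r) n j (of_nat r)"
proof -
  define a where "a i m = of_bool ([int m = i] (mod int n)) * (of_int (moebius_mu m) / real m ^ r)"
      for i :: int and m :: nat
  define P where "P i = (\<Sum>m. a i m)" for i
  define h where "h m = of_bool ([m = j] (mod int n)) * moebius_term r m" for m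
  have sa: "summable (\<lambda>m. norm (a i m))" for i
  proof (rule summable_comparison_test')
    show "summable (\<lambda>m. real m powr (- real r))" using r by (simp add: summable_real_powr_iff)
    fix m :: nat assume m: "m \<ge> 1"
    have "\<bar>of_int (moebius_mu m) :: real\<bar> \<le> 1" using abs_moebius_mu_le_1[of m] by linarith
    then have "\<bar>of_int (moebius_mu m) / real m ^ r\<bar> \<le> 1 / real m ^ r"
      by (simp add: abs_div divide_right_mono)
    then show "norm (norm (a i m)) \<le> real m powr (- real r)"
      using m by (simp add: a_def powr_minus powr_realpow inverse_eq_divide)
  qed
  have sums_a: "(\<lambda>m. a i m) sums P i" for i
    unfolding P_def by (rule summable_sums[OF summable_norm_cancel[OF sa]])
  have a0: "a i 0 = 0" for i using r by (simp add: a_def)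
  have ha: "((\<lambda>m. a i m) has_sum P i) {1..}" for i
  proof -
    have "((\<lambda>m. a i m) has_sum P i) UNIV" by (rule norm_summable_imp_has_sum[OF sa sums_a])
    then show ?thesis by (subst has_sum_cong_neutral[of UNIV "{1..}" _ "a i"]) (auto simp: a0 not_le)
  qed
  have hp: "(h has_sum P j) {1..}"
  proof -
    have "bij_betw int {1..} {1..}" by (rule bij_betwI[where g = nat]) auto
    moreover have "h (int m) = a j m" for m by (simp add: h_def a_def moebius_term_def)
    ultimately show ?thesis using ha[of j] by (subst has_sum_reindex_bij_betw[symmetric, of int "{1..}"])
        simp_all
  qed
  have hm: "(h has_sum ((-1) ^ r * P (- j))) {..-1}"
  proof -
    have "bij_betw (\<lambda>m. - int m) {1..} {..-1}" by (rule bij_betwI[where g = "\<lambda>m. nat (- m)"]) auto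
    moreover have "h (- int m) = (-1) ^ r * a (- j) m" for m
      by (cases "even r") (simp_all add: h_def a_def moebius_term_def cong_minus_iff)
    ultimately show ?thesis using has_sum_cmult_right[OF ha[of "- j"], of "(-1) ^ r"]
      by (subst has_sum_reindex_bij_betw[symmetric, of "\<lambda>m. - int m" "{1..}"]) simp_all
  qed
  have "(h has_sum (P j + (-1) ^ r * P (- j))) ({1..} \<union> {..-1})"
    by (rule has_sum_Un_disjoint[OF hp hm]) auto
  moreover have "(h has_sum x) ({1..} \<union> {..-1}) \<longleftrightarrow> (moebius_term r has_sum x) {m. [m = j] (mod int n)}" for x
  proof (rule has_sum_cong_neutral)
    fix x :: int assume "x \<in> {m. [m = j] (mod int n)} - ({1..} \<union> {..-1})"
    then have "x = 0" by auto
    then show "moebius_term r x = 0" using r by (simp add: moebius_term_def)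
  qed (auto simp: h_def)
  ultimately have "(moebius_term r has_sum (P j + (-1) ^ r * P (- j))) {m. [m = j] (mod int n)}" by blast
  then have "moebius_series n r j = P j + (-1) ^ r * P (- j)"
    using r by (simp add: moebius_series_def infsumI)
  moreover have "(\<lambda>m. of_int (moebius_mu m) * parity_indicator ((-1) ^ r) n j (int m)
      * of_nat m powr (- of_nat r)) sums
      (of_real (P j) + (-1) ^ r * of_real (P (- j)))"
  proof -
    have "of_int (moebius_mu m) * parity_indicator ((-1) ^ r) n j (int m) * of_nat m powr (- of_nat r)
       = of_real (a j m) + (-1) ^ r * of_real (a (- j) m)" for m
    proof (cases "m = 0")
      case False
      then show ?thesis by (simp add: of_nat_powr_minus_nat a_def parity_indicator_def algebra_simps)
    qed (simp add: a0)
    then show ?thesis by (simp only:) (intro sums_add sums_mult sums_of_real sums_a)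
  qed
  ultimately show ?thesis by (simp add: inverse_cot_series_def sums_iff)
qed

text \<open>
  The symmetric partial sums are the partial sums of the Moebius series of an odd periodic function.
\<close>

lemma moebius_series_1:
  assumes n: "n > 0" and j: "coprime j (int n)"
  shows "((\<lambda>s::real. inverse_cot_series (-1) n j (of_real s)) \<longlongrightarrow> of_real (moebius_series n 1 j)) (at_right 1)"
proof -
  have odd: "odd_unit_function n (parity_indicator (-1) n j)"
    unfolding odd_unit_function_def
  proof (intro conjI allI impI)
    show "parity_indicator (-1) n j (- a) = - parity_indicator (-1) n j a" for a
      using parity_indicator_minus[of "-1" n j a] by simp
  qed (use parity_indicator_cong parity_indicator_not_coprime[OF j] in auto)
  obtain l where l: "(\<lambda>m. of_int (moebius_mu m) * parity_indicator (-1) n j (int m) / of_nat m) sums l"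
     "((\<lambda>s::real. \<Sum>m. of_int (moebius_mu m) * parity_indicator (-1) n j (int m) * of_nat m powr (- of_real s))
         \<longlongrightarrow> l) (at_right 1)"
    using moebius_converges[OF n odd] by blast
  define h where "h m = of_bool ([m = j] (mod int n)) * moebius_term 1 m" for m
  define S where "S = (\<lambda>k::nat. \<Sum>m | \<bar>m\<bar> \<le> int k \<and> [m = j] (mod int n). moebius_term 1 m)"
  have S_h: "S k = (\<Sum>m\<in>{- int k..int k}. h m)" for k
    unfolding S_def by (rule sum.mono_neutral_cong_left) (auto simp: h_def)
  have h0: "h 0 = 0" by (simp add: h_def moebius_term_def)
  have S_eq: "(\<Sum>m\<in>{- int k..int k}. h m) = (\<Sum>m\<le>k. h (int m) + h (- int m))" for k
  proof (induction k)
    case (Suc k)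
    have "{- int (Suc k)..int (Suc k)} = insert (int (Suc k)) (insert (- int (Suc k)) {- int k..int k})" by auto
    then show ?case using Suc by simp
  qed (simp add: h0)
  have "of_real (h (int m) + h (- int m)) = of_int (moebius_mu m) * parity_indicator (-1) n j (int m) / of_nat
      m" for m
    by (cases "m = 0") (auto simp: h_def moebius_term_def parity_indicator_def cong_minus_iff h0 field_simps)
  then have "(\<lambda>k. of_real (S k) :: complex) \<longlonglongrightarrow> l"
    using l(1) unfolding S_h S_eq sums_def_le by simp
  then have "S \<longlonglongrightarrow> Re l" using tendsto_Re by fastforce
  then have "moebius_series n 1 j = Re l"
    unfolding moebius_series_def S_def[symmetric] by (simp add: limI)
  moreover have "of_real (Re l) = l"
    using LIMSEQ_unique[OF tendsto_of_real[OF \<open>S \<longlonglongrightarrow> Re l\<close>] \<open>(\<lambda>k. of_real (S k)) \<longlonglongrightarrow> l\<close>] .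
  ultimately show ?thesis using l(2) by (simp add: inverse_cot_series_def)
qed

text \<open>
  The indicator has mean zero, so its Dirichlet series continues holomorphically to \<open>Re s > 0\<close>.
\<close>

lemma cot_series_1:
  assumes n: "n > 0"
  obtains c where "(\<lambda>m. parity_indicator (-1) n j (int m) / of_nat m) sums c"
    "((\<lambda>s::real. cot_series (-1) n j (of_real s)) \<longlongrightarrow> c) (at_right 1)"
proof -
  let ?p = "\<lambda>m. parity_indicator (-1) n j (int m)"
  have ind: "(\<Sum>m<n. of_bool ([int m = i] (mod int n))) = (1 :: complex)" for i
  proof -
    have "(\<Sum>m<n. of_bool ([int m = i] (mod int n))) = (\<Sum>m<n. if m = nat (i mod int n) then 1 else 0 :: complex)"
      using n by (intro sum.cong) (auto simp: cong_def)
    also have "\<dots> = 1" using n by (simp add: nat_less_iff)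
    finally show ?thesis .
  qed
  have "(\<Sum>m<n. ?p m) = (\<Sum>m<n. of_bool ([int m = j] (mod int n))) - (\<Sum>m<n. of_bool ([int m = - j] (mod int n)))"
    by (simp add: parity_indicator_def sum_subtractf)
  then have z: "(\<Sum>m<n. ?p m) = 0" by (simp only: ind) simp
  have per: "?p (m + n) = ?p m" for m by (rule parity_indicator_cong) (auto simp: cong_def)
  have p0: "?p 0 = 0" using cong_minus_iff[of 0 j "int n"] by (simp add: parity_indicator_def)
  obtain K where K: "K holomorphic_on {s. Re s > 0}" "\<And>s. Re s > 0 \<Longrightarrow> (\<lambda>m. ?p m * of_nat m powr (-s)) sums K s"
    by (rule dirichlet_series_bounded_sums[of ?p, OF periodic_partial_sums_bounded[OF per z n] p0]) blast
  have "(\<lambda>m. ?p m * of_nat m powr (-1)) sums K 1" using K(2)[of 1] by simp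
  moreover have "?p m * of_nat m powr (-1) = ?p m / of_nat m" for m
    by (cases "m = 0") (auto simp: powr_minus divide_inverse)
  ultimately have 1: "(\<lambda>m. ?p m / of_nat m) sums K 1" by simp
  have "isCont K 1"
    using holomorphic_on_imp_continuous_on[OF K(1)]
        by (simp add: continuous_on_eq_continuous_at open_halfspace_Re_gt)
  then have "((\<lambda>s::real. K (of_real s)) \<longlongrightarrow> K 1) (at_right 1)"
    by (rule isCont_tendsto_compose) (auto intro!: tendsto_eq_intros)
  moreover have "\<forall>\<^sub>F s::real in at_right 1. K (of_real s) = cot_series (-1) n j (of_real s)"
    using eventually_at_right_less[of 1]
  proof eventually_elim
    case (elim s)
    then show ?case using K(2)[of "of_real s"] by (simp add: cot_series_def sums_iff)
  qed
  ultimately have "((\<lambda>s::real. cot_series (-1) n j (of_real s)) \<longlongrightarrow> K 1) (at_right 1)"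
    by (rule Lim_transform_eventually)
  with 1 show ?thesis using that by blast
qed

text \<open>
  For \<open>r = 1\<close> the identity is the limit of the ones for real \<open>s > 1\<close>.
\<close>

theorem moebius_series_convolution:
  assumes n: "n > 0" and r: "r \<ge> 1"
  obtains c where "\<And>j. coprime j (int n) \<Longrightarrow> (\<lambda>m. parity_indicator ((-1) ^ r) n j (int m) / of_nat m ^ r)
      sums c j"
    "\<And>j. coprime j (int n) \<Longrightarrow> (\<Sum>k\<in>unit_residues n. of_real (moebius_series n r k)
        * c (modular_inverse (int n) k * j))
       = 2 * parity_indicator ((-1) ^ r) n j 1"
proof (cases "r = 1")
  case True
  have "\<exists>c. \<forall>j. (\<lambda>m. parity_indicator (-1) n j (int m) / of_nat m) sums c j \<and>
    ((\<lambda>s::real. cot_series (-1) n j (of_real s)) \<longlongrightarrow> c j) (at_right 1)"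
    by (rule choice) (use cot_series_1[OF n] in blast)
  then obtain c where c: "\<And>j. (\<lambda>m. parity_indicator (-1) n j (int m) / of_nat m) sums c j"
    "\<And>j. ((\<lambda>s::real. cot_series (-1) n j (of_real s)) \<longlongrightarrow> c j) (at_right 1)" by blast
  have "(\<Sum>k\<in>unit_residues n. of_real (moebius_series n 1 k) * c (modular_inverse (int n) k * j))
      = 2 * parity_indicator (-1) n j 1"
    if j: "coprime j (int n)" for j
  proof (rule tendsto_unique)
    show "((\<lambda>s::real. \<Sum>k\<in>unit_residues n. inverse_cot_series (-1) n k (of_real s)
        * cot_series (-1) n (modular_inverse (int n) k * j) (of_real s))
       \<longlongrightarrow> (\<Sum>k\<in>unit_residues n. of_real (moebius_series n 1 k) * c (modular_inverse (int n) k * j))) (at_right 1)"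
      by (intro tendsto_sum tendsto_mult moebius_series_1[OF n] c(2)) (auto simp: unit_residues_def)
    have "\<forall>\<^sub>F s::real in at_right 1. 2 * parity_indicator (-1) n j 1
        = (\<Sum>k\<in>unit_residues n. inverse_cot_series (-1) n k (of_real s)
        * cot_series (-1) n (modular_inverse (int n) k * j) (of_real s))"
      using eventually_at_right_less[of 1]
    proof eventually_elim
      case (elim s)
      then show ?case using cot_series_convolution[of "-1" n j "of_real s"] n j by simp
    qed
    then show "((\<lambda>s::real. \<Sum>k\<in>unit_residues n. inverse_cot_series (-1) n k (of_real s)
        * cot_series (-1) n (modular_inverse (int n) k * j) (of_real s))
       \<longlongrightarrow> 2 * parity_indicator (-1) n j 1) (at_right 1)"
      by (rule Lim_transform_eventually[OF tendsto_const])
  qed simp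
  then show ?thesis using that[of c] c(1) True by simp
next
  case False
  then have r2: "r \<ge> 2" using r by simp
  let ?e = "(-1) ^ r :: complex"
  have e: "?e * ?e = 1" "norm ?e = 1" by (simp_all add: norm_power flip: power_mult_distrib)
  define c where "c j = cot_series ?e n j (of_nat r)" for j
  have s: "Re (of_nat r) > 1" using r2 by simp
  have "(\<lambda>m. parity_indicator ?e n j (int m) / of_nat m ^ r) sums c j" for j
  proof -
    have "(\<lambda>m. parity_indicator ?e n j (int m) * of_nat m powr (- of_nat r)) sums c j"
      unfolding c_def cot_series_def
      by (intro summable_sums summable_norm_cancel[OF
          summable_dirichlet_bounded[OF norm_parity_indicator[OF e(2)] s]])
    moreover have "parity_indicator ?e n j (int m) * of_nat m powr (- of_nat r)
        = parity_indicator ?e n j (int m) / of_nat m ^ r" for m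
      using r by (cases "m = 0") (auto simp: of_nat_powr_minus_nat)
    ultimately show ?thesis by simp
  qed
  moreover have "(\<Sum>k\<in>unit_residues n. of_real (moebius_series n r k) * c (modular_inverse (int n) k * j))
      = 2 * parity_indicator ?e n j 1"
    if "coprime j (int n)" for j
    using cot_series_convolution[OF e n that s] by (simp add: moebius_series_abs_convergent[OF r2 n] c_def)
  ultimately show ?thesis using that by blast
qed

section \<open>Subfields of the complex numbers\<close>

locale complex_subfield =
  fixes K :: "complex set"
  assumes rats: "\<rat> \<subseteq> K"
    and add: "x \<in> K \<Longrightarrow> y \<in> K \<Longrightarrow> x + y \<in> K"
    and mult: "x \<in> K \<Longrightarrow> y \<in> K \<Longrightarrow> x * y \<in> K"
    and minus: "x \<in> K \<Longrightarrow> - x \<in> K"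
    and inverse: "x \<in> K \<Longrightarrow> inverse x \<in> K"
begin

lemma zero [simp]: "0 \<in> K" and one [simp]: "1 \<in> K" and of_int [simp]: "of_int i \<in> K"
    and of_nat [simp]: "of_nat m \<in> K"
  using rats by auto

lemma diff: "x \<in> K \<Longrightarrow> y \<in> K \<Longrightarrow> x - y \<in> K"
  using add[of x "- y"] minus by simp

lemma divide: "x \<in> K \<Longrightarrow> y \<in> K \<Longrightarrow> x / y \<in> K"
  using mult[of x "inverse y"] inverse by (simp add: divide_inverse)

lemma power: "x \<in> K \<Longrightarrow> x ^ k \<in> K"
  by (induction k) (auto intro: mult)

lemma sum: "(\<And>i. i \<in> A \<Longrightarrow> f i \<in> K) \<Longrightarrow> sum f A \<in> K"
  by (induction A rule: infinite_finite_induct) (auto intro: add)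

text \<open>
  Gaussian elimination stays inside the field of coefficients, so solvability over the complex numbers descends
  to \<open>K\<close>.
\<close>

lemma linear_system_solution:
  fixes a :: "'i \<Rightarrow> 'j \<Rightarrow> complex"
  assumes "finite J"
    and "\<And>i j. i \<in> I \<Longrightarrow> j \<in> J \<Longrightarrow> a i j \<in> K" "\<And>i. i \<in> I \<Longrightarrow> b i \<in> K"
    and "\<And>i. i \<in> I \<Longrightarrow> (\<Sum>j\<in>J. a i j * x j) = b i"
  shows "\<exists>y. (\<forall>j\<in>J. y j \<in> K) \<and> (\<forall>i\<in>I. (\<Sum>j\<in>J. a i j * y j) = b i)"
  using assms
proof (induction J arbitrary: a b)
  case empty
  then show ?case by auto
next
  case (insert j0 J)
  show ?case
  proof (cases "\<exists>i0\<in>I. a i0 j0 \<noteq> 0")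
    case True
    then obtain i0 where i0: "i0 \<in> I" "a i0 j0 \<noteq> 0" by blast
    define a' where "a' i j = a i j - a i j0 / a i0 j0 * a i0 j" for i j
    define b' where "b' i = b i - a i j0 / a i0 j0 * b i0" for i
    have sum': "(\<Sum>j\<in>J. a' i j * z j) = (\<Sum>j\<in>J. a i j * z j) - a i j0 / a i0 j0 * (\<Sum>j\<in>J. a i0 j * z j)" for i z
      by (simp add: a'_def left_diff_distrib sum_subtractf sum_distrib_left mult.assoc)
    have eqs: "(\<Sum>j\<in>J. a i j * x j) = b i - a i j0 * x j0" if "i \<in> I" for i
      using insert.prems(3)[OF that] insert.hyps by (simp add: algebra_simps)
    have "\<exists>y. (\<forall>j\<in>J. y j \<in> K) \<and> (\<forall>i\<in>I. (\<Sum>j\<in>J. a' i j * y j) = b' i)"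
    proof (rule insert.IH)
      fix i assume i: "i \<in> I"
      show "(\<Sum>j\<in>J. a' i j * x j) = b' i"
        unfolding sum' eqs[OF i] eqs[OF i0(1)] b'_def using i0 by (simp add: field_simps)
      show "b' i \<in> K" unfolding b'_def using i i0 insert.prems by (auto intro!: diff mult divide)
      show "a' i j \<in> K" if "j \<in> J" for j
        unfolding a'_def using i i0 insert.prems that by (auto intro!: diff mult divide)
    qed
    then obtain y where y: "\<And>j. j \<in> J \<Longrightarrow> y j \<in> K" "\<And>i. i \<in> I \<Longrightarrow> (\<Sum>j\<in>J. a' i j * y j) = b' i" by blast
    define y0 where "y0 = (b i0 - (\<Sum>j\<in>J. a i0 j * y j)) / a i0 j0"
    define y' where "y' j = (if j = j0 then y0 else y j)" for j
    have sy: "(\<Sum>j\<in>J. a i j * y' j) = (\<Sum>j\<in>J. a i j * y j)" for i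
      using insert.hyps by (intro sum.cong) (auto simp: y'_def)
    have "y0 \<in> K" unfolding y0_def using i0 insert.prems y by (auto intro!: diff mult divide sum)
    moreover have "(\<Sum>j\<in>insert j0 J. a i j * y' j) = b i" if "i \<in> I" for i
    proof -
      have "(\<Sum>j\<in>J. a i j * y j) = b' i + a i j0 / a i0 j0 * (\<Sum>j\<in>J. a i0 j * y j)"
        using y(2)[OF that] unfolding sum' by (simp add: algebra_simps)
      moreover have "a i j0 * y0 = a i j0 / a i0 j0 * b i0 - a i j0 / a i0 j0 * (\<Sum>j\<in>J. a i0 j * y j)"
        by (simp add: y0_def right_diff_distrib diff_divide_distrib)
      ultimately show ?thesis using insert.hyps sy by (simp add: y'_def b'_def)
    qed
    ultimately show ?thesis using y by (intro exI[of _ y']) (auto simp: y'_def)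
  next
    case False
    then have z: "a i j0 = 0" if "i \<in> I" for i using that by blast
    have "\<exists>y. (\<forall>j\<in>J. y j \<in> K) \<and> (\<forall>i\<in>I. (\<Sum>j\<in>J. a i j * y j) = b i)"
      by (rule insert.IH) (use insert.prems insert.hyps z in auto)
    then obtain y where y: "\<And>j. j \<in> J \<Longrightarrow> y j \<in> K" "\<And>i. i \<in> I \<Longrightarrow> (\<Sum>j\<in>J. a i j * y j) = b i" by blast
    have "(\<Sum>j\<in>J. a i j * (y(j0 := 0)) j) = (\<Sum>j\<in>J. a i j * y j)" for i
      using insert.hyps by (intro sum.cong) auto
    then show ?thesis using y z insert.hyps by (intro exI[of _ "y(j0 := 0)"]) auto
  qed
qed

definition in_poly :: "complex poly \<Rightarrow> bool" where
  "in_poly p \<longleftrightarrow> (\<forall>i. coeff p i \<in> K)"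

lemma in_poly_0 [simp]: "in_poly 0" and in_poly_1 [simp]: "in_poly 1"
  by (auto simp: in_poly_def)

lemma in_poly_add: "in_poly p \<Longrightarrow> in_poly q \<Longrightarrow> in_poly (p + q)"
  by (simp add: in_poly_def add)

lemma in_poly_diff: "in_poly p \<Longrightarrow> in_poly q \<Longrightarrow> in_poly (p - q)"
  by (simp add: in_poly_def diff)

lemma in_poly_smult: "c \<in> K \<Longrightarrow> in_poly p \<Longrightarrow> in_poly (smult c p)"
  by (simp add: in_poly_def mult)

lemma in_poly_mult: "in_poly p \<Longrightarrow> in_poly q \<Longrightarrow> in_poly (p * q)"
  by (simp add: in_poly_def coeff_mult mult sum)

lemma in_poly_monom: "c \<in> K \<Longrightarrow> in_poly (monom c k)"
  by (simp add: in_poly_def coeff_monom)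

lemma in_poly_pCons: "c \<in> K \<Longrightarrow> in_poly p \<Longrightarrow> in_poly (pCons c p)"
  by (simp add: in_poly_def coeff_pCons split: nat.split)

lemma in_poly_pCons_iff: "in_poly (pCons c p) \<longleftrightarrow> c \<in> K \<and> in_poly p"
  unfolding in_poly_def by (metis coeff_pCons_0 coeff_pCons_Suc not0_implies_Suc)

lemma in_poly_power: "in_poly p \<Longrightarrow> in_poly (p ^ k)"
  by (induction k) (auto intro: in_poly_mult)

lemma in_poly_pcompose: "in_poly p \<Longrightarrow> in_poly q \<Longrightarrow> in_poly (pcompose p q)"
  by (induction p) (auto simp: pcompose_pCons in_poly_pCons_iff intro!: in_poly_add in_poly_mult in_poly_pCons)

lemma poly_in_poly: "in_poly p \<Longrightarrow> x \<in> K \<Longrightarrow> poly p x \<in> K"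
  by (induction p) (auto simp: in_poly_pCons_iff intro!: add mult)

lemma monic_division:
  assumes "in_poly f" "in_poly m" "lead_coeff m = 1"
  shows "\<exists>q r. in_poly q \<and> in_poly r \<and> f = q * m + r \<and> (r = 0 \<or> degree r < degree m)"
  using assms(1)
proof (induction "degree f" arbitrary: f rule: less_induct)
  case less
  show ?case
  proof (cases "f = 0 \<or> degree f < degree m")
    case True
    then show ?thesis using less.prems by (intro exI[of _ 0] exI[of _ f]) auto
  next
    case False
    then have f0: "f \<noteq> 0" and deg: "degree m \<le> degree f" by auto
    define t where "t = monom (lead_coeff f) (degree f - degree m)"
    have t: "in_poly t" unfolding t_def using less.prems by (intro in_poly_monom) (simp add: in_poly_def)
    define f' where "f' = f - t * m"
    have of': "in_poly f'" unfolding f'_def by (intro in_poly_diff in_poly_mult t assms less.prems)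
    have "m \<noteq> 0" using assms by auto
    have dt: "degree (t * m) = degree f" using f0 deg \<open>m \<noteq> 0\<close>
      by (subst degree_mult_eq) (auto simp: t_def degree_monom_eq monom_eq_0_iff)
    have lt: "coeff (t * m) (degree f) = lead_coeff f"
      using lead_coeff_mult[of t m] assms(3) f0 unfolding dt by (simp add: t_def degree_monom_eq)
    show ?thesis
    proof (cases "degree f = 0")
      case True
      then have "degree m = 0" using deg by simp
      then have "m = 1" using assms(3) by (metis degree_0_id one_pCons)
      then show ?thesis using less.prems by (intro exI[of _ f] exI[of _ 0]) auto
    next
      case False
      have "degree f' < degree f"
      proof -
        have "degree f' \<le> degree f" unfolding f'_def using dt by (intro degree_diff_le) auto
        moreover have "coeff f' (degree f) = 0" using lt by (simp add: f'_def)
        ultimately show ?thesis using False by (metis eq_zero_or_degree_less degree_0 gr0I)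
      qed
      from less.hyps[OF this of'] obtain q r where qr: "in_poly q" "in_poly r" "f' = q * m + r" "r
          = 0 \<or> degree r < degree m" by blast
      then have "f = (q + t) * m + r" by (simp add: f'_def algebra_simps)
      then show ?thesis using qr t by (intro exI[of _ "q + t"] exI[of _ r]) (auto intro: in_poly_add)
    qed
  qed
qed

definition minimal_poly :: "complex \<Rightarrow> complex poly \<Rightarrow> bool" where
  "minimal_poly \<alpha> m \<longleftrightarrow> in_poly m \<and> lead_coeff m = 1 \<and> poly m \<alpha> = 0 \<and>
     (\<forall>f. in_poly f \<longrightarrow> poly f \<alpha> = 0 \<longrightarrow> f = 0 \<or> degree m \<le> degree f)"

lemma minimal_poly_exists:
  assumes "in_poly f" "f \<noteq> 0" "poly f \<alpha> = 0"
  obtains m where "minimal_poly \<alpha> m"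
proof -
  let ?P = "\<lambda>f. in_poly f \<and> f \<noteq> 0 \<and> poly f \<alpha> = 0"
  obtain g where g: "?P g" "\<And>h. ?P h \<Longrightarrow> degree g \<le> degree h"
    using ex_has_least_nat[of ?P f degree] assms by blast
  define m where "m = smult (inverse (lead_coeff g)) g"
  have "in_poly m" unfolding m_def using g by (intro in_poly_smult inverse) (auto simp: in_poly_def)
  then have "minimal_poly \<alpha> m"
    unfolding minimal_poly_def using g by (auto simp: m_def)
  then show ?thesis using that by blast
qed

lemma minimal_poly_dvd:
  assumes "minimal_poly \<alpha> m" "in_poly f" "poly f \<alpha> = 0"
  obtains q where "in_poly q" "f = q * m"
proof -
  obtain q r where qr: "in_poly q" "in_poly r" "f = q * m + r" "r = 0 \<or> degree r < degree m"
    using monic_division[of f m] assms by (auto simp: minimal_poly_def)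
  then have "poly r \<alpha> = 0" using assms by (simp add: minimal_poly_def)
  then have "r = 0" using qr assms(1) by (auto simp: minimal_poly_def)
  then show ?thesis using that qr by simp
qed

lemma minimal_poly_degree_pos:
  assumes "minimal_poly \<alpha> m"
  shows "degree m > 0"
proof (rule ccontr)
  assume "\<not> degree m > 0"
  then obtain c where "m = [:c:]" by (metis degree_eq_zeroE gr0I)
  then show False using assms by (auto simp: minimal_poly_def)
qed

text \<open>
  Irreducibility of the minimal polynomial: the minimal polynomial \<open>m'\<close> of \<open>\<omega>\<close> divides \<open>m\<close>, and the cofactor has too
  small a degree to vanish at \<open>\<alpha>\<close>.
\<close>

lemma minimal_poly_conjugate:
  assumes m: "minimal_poly \<alpha> m" and \<omega>: "poly m \<omega> = 0" and f: "in_poly f" "poly f \<omega> = 0"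
  shows "poly f \<alpha> = 0"
proof -
  have om: "in_poly m" "m \<noteq> 0" using m by (auto simp: minimal_poly_def)
  obtain m' where m': "minimal_poly \<omega> m'" using minimal_poly_exists[OF om \<omega>] .
  obtain q where q: "in_poly q" "m = q * m'" using minimal_poly_dvd[OF m' om(1) \<omega>] .
  have "q \<noteq> 0" "m' \<noteq> 0" using q om by auto
  then have "degree q < degree m" using q minimal_poly_degree_pos[OF m'] by (simp add: degree_mult_eq)
  then have "poly q \<alpha> \<noteq> 0" using m q \<open>q \<noteq> 0\<close> by (auto simp: minimal_poly_def)
  moreover have "poly (q * m') \<alpha> = 0" using m q by (simp add: minimal_poly_def)
  ultimately have "poly m' \<alpha> = 0" by simp
  moreover obtain q' where "in_poly q'" "f = q' * m'" by (rule minimal_poly_dvd[OF m' f])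
  ultimately show ?thesis by simp
qed

text \<open>
  The Euclidean algorithm for \<open>p\<close> and \<open>m\<close>; it makes the polynomial expressions in an algebraic number a field.
\<close>

lemma algebraic_inverse:
  assumes m: "minimal_poly \<alpha> m" and p: "in_poly p" "poly p \<alpha> \<noteq> 0"
  shows "\<exists>a. in_poly a \<and> poly a \<alpha> * poly p \<alpha> = 1"
proof -
  have step: "in_poly p \<Longrightarrow> poly p \<alpha> \<noteq> 0 \<Longrightarrow> degree p < degree m \<Longrightarrow> \<exists>a. in_poly a \<and> poly a \<alpha> * poly p \<alpha> = 1" for p
  proof (induction "degree p" arbitrary: p rule: less_induct)
    case less
    define c where "c = lead_coeff p"
    have p0: "p \<noteq> 0" using less.prems by auto
    have c: "c \<noteq> 0" "c \<in> K" using p0 less.prems by (auto simp: c_def in_poly_def)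
    define p' where "p' = smult (inverse c) p"
    have p': "in_poly p'" "lead_coeff p' = 1" "degree p' = degree p"
      using c less.prems by (auto simp: p'_def intro!: in_poly_smult inverse) (simp add: c_def)
    show ?case
    proof (cases "degree p = 0")
      case True
      then obtain d where d: "p = [:d:]" by (metis degree_eq_zeroE)
      then have "d \<noteq> 0" "d \<in> K" using less.prems by (auto simp: in_poly_pCons_iff)
      then show ?thesis using d by (intro exI[of _ "[:inverse d:]"]) (auto simp: in_poly_pCons_iff inverse)
    next
      case False
      obtain q r where qr: "in_poly q" "in_poly r" "m = q * p' + r" "r = 0 \<or> degree r < degree p'"
        using monic_division[of m p'] m p' by (auto simp: minimal_poly_def)
      have val: "poly r \<alpha> = - poly q \<alpha> * poly p' \<alpha>"
        using m arg_cong[OF qr(3), of "\<lambda>f. poly f \<alpha>"]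
            by (simp add: minimal_poly_def eq_neg_iff_add_eq_0 add.commute)
      have "poly r \<alpha> \<noteq> 0"
      proof
        assume z: "poly r \<alpha> = 0"
        then have "r = 0"
        proof -
          have "r = 0 \<or> degree m \<le> degree r" using z qr m by (auto simp: minimal_poly_def)
          then show ?thesis using qr(4) p' less.prems by auto
        qed
        have "poly q \<alpha> = 0" using z val less.prems c by (simp add: p'_def)
        then have "q = 0 \<or> degree m \<le> degree q" using qr m by (auto simp: minimal_poly_def)
        moreover have "m \<noteq> 0" using m by (auto simp: minimal_poly_def)
        then have "q \<noteq> 0" "p' \<noteq> 0" using qr \<open>r = 0\<close> by auto
        then have "degree m = degree q + degree p'" using qr \<open>r = 0\<close> by (simp add: degree_mult_eq)
        ultimately show False using False p' \<open>q \<noteq> 0\<close> by simp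
      qed
      moreover have "degree r < degree p" using qr(4) p' False by auto
      ultimately obtain a where a: "in_poly a" "poly a \<alpha> * poly r \<alpha> = 1"
        using less.hyps[of r] qr less.prems by auto
      have "poly (smult (- inverse c) (a * q)) \<alpha> * poly p \<alpha> = 1"
        using a(2) unfolding val by (simp add: p'_def mult_ac)
      moreover have "in_poly (smult (- inverse c) (a * q))" using a qr c
          by (intro in_poly_smult in_poly_mult minus inverse)
      ultimately show ?thesis by blast
    qed
  qed
  obtain q r where qr: "in_poly q" "in_poly r" "p = q * m + r" "r = 0 \<or> degree r < degree m"
    using monic_division[of p m] m p by (auto simp: minimal_poly_def)
  have v: "poly p \<alpha> = poly r \<alpha>" using m qr by (simp add: minimal_poly_def)
  then have "r \<noteq> 0" using p by auto
  then show ?thesis using step[of r] qr p v by auto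
qed

end

lemma ring_of_type_algebra_inverses:
  "\<ominus>\<^bsub>ring_of_type_algebra\<^esub> x = - (x::complex)" "x \<noteq> 0 \<Longrightarrow> inv\<^bsub>ring_of_type_algebra\<^esub> x = inverse x"
proof -
  interpret R: field "ring_of_type_algebra :: complex ring" by (rule field_from_type_algebra)
  show "\<ominus>\<^bsub>ring_of_type_algebra\<^esub> x = - x"
    by (rule R.minus_equality) (auto simp: ring_of_type_algebra_def)
  show "inv\<^bsub>ring_of_type_algebra\<^esub> x = inverse x" if "x \<noteq> 0"
    by (rule R.inv_char) (use that in \<open>auto simp: ring_of_type_algebra_def\<close>)
qed

lemma rat_adjoin_subfield: "complex_subfield (rat_adjoin x)"
proof
  note gf = generate_field.intros[where R = "ring_of_type_algebra :: complex ring" and H = "\<rat> \<union> {x}"]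
  show "\<rat> \<subseteq> rat_adjoin x" unfolding rat_adjoin_def using gf(2) by blast
  show "y + z \<in> rat_adjoin x" if "y \<in> rat_adjoin x" "z \<in> rat_adjoin x" for y z
    using gf(5)[of y z] that by (simp add: rat_adjoin_def ring_of_type_algebra_def)
  show "y * z \<in> rat_adjoin x" if "y \<in> rat_adjoin x" "z \<in> rat_adjoin x" for y z
    using gf(6)[of y z] that by (simp add: rat_adjoin_def ring_of_type_algebra_def)
  show "- y \<in> rat_adjoin x" if "y \<in> rat_adjoin x" for y
    using gf(3)[of y] that by (simp add: rat_adjoin_def ring_of_type_algebra_inverses)
  show "inverse y \<in> rat_adjoin x" if "y \<in> rat_adjoin x" for y
  proof (cases "y = 0")
    case True
    then show ?thesis using that by simp
  next
    case False
    then show ?thesis using gf(4)[of y] that ring_of_type_algebra_inverses(2)[of y]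
      by (simp add: rat_adjoin_def) (simp add: ring_of_type_algebra_def)
  qed
qed

lemma rat_adjoin_self: "x \<in> rat_adjoin x"
  unfolding rat_adjoin_def by (intro generate_field.incl) simp

lemma rat_adjoin_least:
  assumes "complex_subfield K" "x \<in> K"
  shows "rat_adjoin x \<subseteq> K"
proof
  interpret complex_subfield K by fact
  fix y assume "y \<in> rat_adjoin x"
  then show "y \<in> K" unfolding rat_adjoin_def
  proof (induction rule: generate_field.induct)
    case one
    show ?case by (simp add: ring_of_type_algebra_def)
  next
    case (incl h)
    then show ?case using rats assms(2) by blast
  next
    case (a_inv h)
    then show ?case using minus by (simp add: ring_of_type_algebra_inverses)
  next
    case (m_inv h)
    then have "h \<noteq> 0" by (simp add: ring_of_type_algebra_def)
    then show ?case using m_inv inverse by (simp add: ring_of_type_algebra_inverses)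
  next
    case (eng_add h1 h2)
    then show ?case using add by (simp add: ring_of_type_algebra_def)
  next
    case (eng_mult h1 h2)
    then show ?case using mult by (simp add: ring_of_type_algebra_def)
  qed
qed

section \<open>Conjugates of roots of unity\<close>

definition ipoly :: "int poly \<Rightarrow> complex \<Rightarrow> complex" where
  "ipoly f x = poly (map_poly of_int f) x"

lemma ipoly_0 [simp]: "ipoly 0 x = 0"
  by (simp add: ipoly_def)

lemma ipoly_pCons [simp]: "ipoly (pCons a f) x = of_int a + x * ipoly f x"
  by (simp add: ipoly_def map_poly_pCons)

lemma ipoly_1 [simp]: "ipoly 1 x = 1"
  by (simp add: one_pCons)

lemma ipoly_add [simp]: "ipoly (f + g) x = ipoly f x + ipoly g x"
  by (induction f g rule: poly_induct2) (auto simp: algebra_simps)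

lemma ipoly_smult [simp]: "ipoly (smult c f) x = of_int c * ipoly f x"
  by (induction f) (auto simp: algebra_simps)

lemma ipoly_mult [simp]: "ipoly (f * g) x = ipoly f x * ipoly g x"
  by (induction f) (auto simp: algebra_simps)

lemma ipoly_diff [simp]: "ipoly (f - g) x = ipoly f x - ipoly g x"
proof -
  have "f - g = f + smult (-1) g" by simp
  then show ?thesis by (simp only: ipoly_add ipoly_smult) simp
qed

lemma ipoly_power [simp]: "ipoly (f ^ k) x = ipoly f x ^ k"
  by (induction k) auto

lemma ipoly_monom [simp]: "ipoly (monom c k) x = of_int c * x ^ k"
  by (induction k) (auto simp: monom_Suc monom_0 algebra_simps)

lemma ipoly_of_nat [simp]: "ipoly (of_nat m) x = of_nat m"
  by (simp add: of_nat_poly)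

lemma ipoly_pcompose [simp]: "ipoly (pcompose f g) x = ipoly f (ipoly g x)"
  by (induction f) (auto simp: pcompose_pCons)

lemma prime_dvd_power_add:
  fixes x y :: "'a :: comm_ring_1"
  assumes "prime p"
  shows "of_nat p dvd (x + y) ^ p - (x ^ p + y ^ p)"
proof -
  have p: "p > 0" using assms prime_gt_0_nat by blast
  have "(x + y) ^ p = (\<Sum>k\<le>p. of_nat (p choose k) * x ^ k * y ^ (p - k))" by (rule binomial_ring)
  also have "{..p} = insert 0 (insert p {0<..<p})" using p by auto
  also have "(\<Sum>k\<in>\<dots>. of_nat (p choose k) * x ^ k * y ^ (p - k))
      = y ^ p + (x ^ p + (\<Sum>k\<in>{0<..<p}. of_nat (p choose k) * x ^ k * y ^ (p - k)))"
    using p by simp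
  finally have "(x + y) ^ p - (x ^ p + y ^ p) = (\<Sum>k\<in>{0<..<p}. of_nat (p choose k) * x ^ k * y ^ (p - k))"
    by simp
  moreover have "of_nat p dvd (\<Sum>k\<in>{0<..<p}. of_nat (p choose k) * x ^ k * y ^ (p - k) :: 'a)"
  proof (rule dvd_sum)
    fix k assume "k \<in> {0<..<p}"
    then have "p dvd (p choose k)" using assms by (intro dvd_choose_prime) auto
    then obtain c where "p choose k = p * c" by blast
    then show "of_nat p dvd (of_nat (p choose k) * x ^ k * y ^ (p - k) :: 'a)" by (simp add: mult.assoc)
  qed
  ultimately show ?thesis by simp
qed

lemma fermat_int:
  assumes "prime p"
  shows "int p dvd a - a ^ p"
proof -
  define b where "b = nat (a mod int p)"
  have p: "p > 0" using assms prime_gt_0_nat by blast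
  have ab: "[a = int b] (mod int p)" using p by (simp add: b_def cong_def)
  have "[b ^ p = b] (mod p)"
  proof (cases "p dvd b")
    case True
    then have "p dvd b ^ p" using p by (simp add: dvd_power_same dvd_power_le prime_dvd_power_nat_iff assms)
    then show ?thesis using True by (simp add: cong_def mod_eq_0_iff_dvd)
  next
    case False
    then have "[b ^ (p - 1) * b = 1 * b] (mod p)" using fermat_theorem[OF assms] by (intro cong_mult) auto
    moreover have "b ^ (p - 1) * b = b ^ p" using p by (metis Suc_diff_1 power_Suc2)
    ultimately show ?thesis by simp
  qed
  then have "[int b ^ p = int b] (mod int p)" by (metis cong_int_iff of_nat_power)
  then have "[a ^ p = a] (mod int p)" using ab by (meson cong_pow cong_sym cong_trans)
  then show ?thesis by (simp add: cong_iff_dvd_diff dvd_diff_commute)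
qed

text \<open>
  Modulo \<open>p\<close>, raising a polynomial to the power \<open>p\<close> is the substitution of \<open>x ^ p\<close> for \<open>x\<close>.
\<close>

lemma frobenius_int_poly:
  assumes "prime p"
  shows "of_nat p dvd pcompose f (monom 1 p) - (f :: int poly) ^ p"
proof (induction f)
  case (pCons a f)
  let ?x = "[:0, 1:] :: int poly"
  have "pCons a f = [:a:] + ?x * f" by simp
  then have 1: "of_nat p dvd (pCons a f) ^ p - ([:a:] ^ p + (?x * f) ^ p)"
    using prime_dvd_power_add[OF assms, of "[:a:]" "?x * f"] by simp
  have x: "?x ^ p = monom 1 p" by (simp add: monom_altdef)
  have xf: "(?x * f) ^ p = monom 1 p * f ^ p" by (simp only: power_mult_distrib x)
  have 2: "of_nat p dvd [:a:] - [:a:] ^ p"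
  proof -
    have "[:a:] - [:a:] ^ p = [:a - a ^ p:]" by (simp add: poly_const_pow)
    then show ?thesis using fermat_int[OF assms, of a] by (simp add: of_nat_poly)
  qed
  have 3: "of_nat p dvd monom 1 p * (pcompose f (monom 1 p) - f ^ p)" using pCons.IH by (rule dvd_mult)
  have "of_nat p dvd ([:a:] - [:a:] ^ p) + monom 1 p * (pcompose f (monom 1 p) - f ^ p)
      - ((pCons a f) ^ p - ([:a:] ^ p + (?x * f) ^ p))"
    by (rule dvd_diff[OF dvd_add[OF 2 3] 1])
  also have "\<dots> = pcompose (pCons a f) (monom 1 p) - (pCons a f) ^ p"
    unfolding pcompose_pCons xf by (simp add: algebra_simps)
  finally show ?case .
next
  case 0
  then show ?case using prime_gt_0_nat[OF assms] by (simp add: power_0_left)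
qed

lemma degree_monom_minus_1:
  fixes n :: nat
  assumes "n > 0"
  shows "degree (monom 1 n - 1 :: 'a :: comm_ring_1 poly) = n" "coeff (monom 1 n - 1 :: 'a poly) n = 1"
proof -
  show c: "coeff (monom 1 n - 1 :: 'a poly) n = 1" using assms by simp
  have "degree (monom 1 n - 1 :: 'a poly) \<le> n" by (rule degree_diff_le) (auto simp: degree_monom_le)
  moreover have "n \<le> degree (monom 1 n - 1 :: 'a poly)" by (rule le_degree) (simp add: assms)
  ultimately show "degree (monom 1 n - 1 :: 'a poly) = n" by simp
qed

text \<open>
  Dedekind's argument for the irreducibility of cyclotomic polynomials, carried out in the ring \<open>\<int>[\<omega>]\<close>.
  By Gauss's lemma \<open>x ^ n - 1 = f * h\<close> with \<open>f\<close> a monic integer polynomial of least degree vanishing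
  at \<open>\<omega>\<close>. If \<open>f\<close> does not vanish at \<open>\<omega> ^ p\<close>, then \<open>h\<close> does, and differentiating at \<open>\<omega> ^ p\<close> shows that
  \<open>f (\<omega> ^ p)\<close> divides \<open>n\<close> in \<open>\<int>[\<omega>]\<close>. But \<open>f (\<omega> ^ p)\<close> is congruent to \<open>f \<omega> ^ p = 0\<close> modulo \<open>p\<close>, so \<open>p\<close>
  divides \<open>n\<close> in \<open>\<int>[\<omega>]\<close>, hence in \<open>\<int>\<close>, since \<open>\<int>[\<omega>]\<close> has a basis of powers of \<open>\<omega>\<close> that contains one.
\<close>

lemma root_of_unity_prime_power:
  assumes n: "n > 0" and \<omega>: "\<omega> ^ n = 1" and p: "prime p" "\<not> p dvd n" and q: "ipoly q \<omega> = 0"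
  shows "ipoly q (\<omega> ^ p) = 0"
proof -
  have w0: "\<omega> \<noteq> 0" using \<omega> n by (auto simp: power_0_left)
  let ?P = "\<lambda>f. f \<noteq> 0 \<and> ipoly f \<omega> = 0"
  have "monom 1 n - 1 \<noteq> (0 :: int poly)" using degree_monom_minus_1(2)[OF n, where ?'a = int] by force
  then have P1: "?P (monom 1 n - 1)" using \<omega> by simp
  obtain f1 where f1: "?P f1" "\<And>g. ?P g \<Longrightarrow> degree f1 \<le> degree g"
    using ex_has_least_nat[of ?P "monom 1 n - 1" degree] P1 by blast
  define f2 where "f2 = primitive_part f1"
  have f1_eq: "f1 = smult (content f1) f2" by (simp add: f2_def)
  have f2: "?P f2" "\<And>g. ?P g \<Longrightarrow> degree f2 \<le> degree g" "content f2 = 1"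
  proof -
    have "content f1 \<noteq> 0" using f1 by simp
    have "ipoly f1 \<omega> = of_int (content f1) * ipoly f2 \<omega>" by (subst f1_eq) simp
    then show "?P f2" using f1 \<open>content f1 \<noteq> 0\<close> by (auto simp: f2_def)
    show "degree f2 \<le> degree g" if "?P g" for g using f1(2)[OF that] by (simp add: f2_def)
    show "content f2 = 1" using f1 by (simp add: f2_def)
  qed
  have dvd2: "f2 dvd g" if "ipoly g \<omega> = 0" for g
  proof -
    have "f2 \<noteq> 0" using f2 by blast
    from pseudo_mod[OF this, of g] obtain a s where a: "a \<noteq> 0" "smult a g = f2 * s + pseudo_mod g f2"
      and dr: "pseudo_mod g f2 = 0 \<or> degree (pseudo_mod g f2) < degree f2" by blast
    have "ipoly (pseudo_mod g f2) \<omega> = 0"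
      using arg_cong[OF a(2), of "\<lambda>h. ipoly h \<omega>"] that f2 by simp
    then have "pseudo_mod g f2 = 0" using dr f2(2)[of "pseudo_mod g f2"] by (meson not_le)
    then have "f2 dvd smult a g" using a by simp
    then have "fract_poly f2 dvd smult (to_fract a) (fract_poly g)"
      using fract_poly_dvd[of f2 "smult a g"] by (simp add: fract_poly_smult)
    then have "fract_poly f2 dvd fract_poly g" using a by (simp add: dvd_smult_iff)
    then show ?thesis using f2(3) by (rule fract_poly_dvdD)
  qed
  have "f2 dvd monom 1 n - 1" using P1 by (intro dvd2) blast
  then obtain h2 where h2: "monom 1 n - 1 = f2 * h2" by blast
  have "lead_coeff (monom 1 n - 1 :: int poly) = 1"
    by (simp only: degree_monom_minus_1[OF n])
  then have lc: "lead_coeff f2 * lead_coeff h2 = 1" unfolding h2 by (simp add: lead_coeff_mult)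
  \<comment> \<open>The leading coefficient of the primitive polynomial \<open>f2\<close> is a unit; scaling by it makes \<open>f\<close> monic.\<close>
  define u where "u = lead_coeff f2"
  have u: "u * u = 1" using lc by (auto simp: u_def zmult_eq_1_iff)
  define f where "f = smult u f2"
  define h where "h = smult u h2"
  have monic: "lead_coeff f = 1" using u f2(1) by (simp add: f_def u_def)
  have f0: "f \<noteq> 0" using monic by auto
  have fh: "monom 1 n - 1 = f * h" unfolding h2 f_def h_def using u by simp
  have fw: "ipoly f \<omega> = 0" using f2 by (simp add: f_def)
  have degf: "degree f = degree f2" using u by (auto simp: f_def)
  have dvd: "f dvd g" if "ipoly g \<omega> = 0" for g
  proof -
    from dvd2[OF that] obtain s where "g = f2 * s" by blast
    then have "g = f * smult u s" using u by (simp add: f_def)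
    then show ?thesis by (rule dvdI)
  qed
  have degpos: "degree f > 0"
  proof (rule ccontr)
    assume "\<not> degree f > 0"
    then obtain c where "f = [:c:]" by (metis degree_eq_zeroE gr0I)
    then show False using monic fw by simp
  qed
  have fp: "ipoly f (\<omega> ^ p) = 0"
  proof (rule ccontr)
    assume ne: "ipoly f (\<omega> ^ p) \<noteq> 0"
    have "(\<omega> ^ p) ^ n = 1" using \<omega> by (metis mult.commute power_mult power_one)
    then have "ipoly f (\<omega> ^ p) * ipoly h (\<omega> ^ p) = 0"
      using arg_cong[OF fh, of "\<lambda>g. ipoly g (\<omega> ^ p)"] by simp
    then have hp: "ipoly h (\<omega> ^ p) = 0" using ne by simp
    have "pderiv (monom 1 n - 1) = f * pderiv h + h * pderiv f" unfolding fh by (rule pderiv_mult)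
    then have "monom (int n) (n - 1) = f * pderiv h + h * pderiv f" by (simp add: pderiv_diff pderiv_monom)
    from arg_cong[OF this, of "\<lambda>g. ipoly g (\<omega> ^ p)"]
    have d: "of_nat n * (\<omega> ^ p) ^ (n - 1) = ipoly f (\<omega> ^ p) * ipoly (pderiv h) (\<omega> ^ p)" using hp by simp
    obtain g where g: "pcompose f (monom 1 p) - f ^ p = of_nat p * g" using frobenius_int_poly[OF p(1), of f]
        by blast
    have "ipoly f (\<omega> ^ p) = of_nat p * ipoly g \<omega>"
      using arg_cong[OF g, of "\<lambda>g. ipoly g \<omega>"] fw p(1) by (simp add: prime_gt_0_nat power_0_left)
    then have "of_nat n * (\<omega> ^ p) ^ (n - 1) * \<omega> ^ p
        = of_nat p * ipoly (g * pcompose (pderiv h) (monom 1 p) * monom 1 p) \<omega>"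
      unfolding d by simp
    moreover have "(\<omega> ^ p) ^ (n - 1) * \<omega> ^ p = 1" using \<open>(\<omega> ^ p) ^ n = 1\<close> n by (metis Suc_diff_1 power_Suc2)
    ultimately obtain g' where g': "of_nat n = of_nat p * ipoly g' \<omega>" by (metis mult.assoc mult.right_neutral)
    \<comment> \<open>Dividing by the monic \<open>f\<close> represents the quotient \<open>n / p\<close> by a polynomial of degree below that of \<open>f\<close>.\<close>
    obtain s r where sr: "pseudo_divmod g' f = (s, r)" by fastforce
    from pseudo_divmod[OF f0 sr] monic have "g' = f * s + r" and dr: "r = 0 \<or> degree r < degree f" by auto
    then have "of_nat n = of_nat p * ipoly r \<omega>" using g' fw by simp
    then have "ipoly (smult (int p) r - [:int n:]) \<omega> = 0" by simp
    moreover have "degree (smult (int p) r - [:int n:]) < degree f2"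
      using dr degpos degf by (intro degree_diff_less) auto
    ultimately have "smult (int p) r - [:int n:] = 0" using f2(2) by (meson not_le)
    then have "coeff (smult (int p) r - [:int n:]) 0 = 0" by simp
    then have "int p * coeff r 0 = int n" by simp
    then have "int p dvd int n" by (metis dvd_triv_left)
    then show False using p by simp
  qed
  obtain g where "q = f * g" using dvd[OF q] by blast
  then show ?thesis using fp by simp
qed

lemma root_of_unity_coprime_power:
  assumes "n > 0" "\<omega> ^ n = 1" "coprime k n" "k > 0" "ipoly q \<omega> = 0"
  shows "ipoly q (\<omega> ^ k) = 0"
  using assms(2-)
proof (induction k arbitrary: \<omega> rule: less_induct)
  case (less k)
  show ?case
  proof (cases "k = 1")
    case True
    then show ?thesis using less.prems by simp
  next
    case False
    then obtain p where p: "prime p" "p dvd k" using prime_factor_nat by blast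
    then obtain l where l: "k = p * l" by blast
    have "p > 1" using p prime_gt_1_nat by blast
    then have "l < k" "l > 0" using l less.prems by auto
    have cop: "coprime p n" "coprime l n" using less.prems l by auto
    have "\<not> p dvd n"
    proof
      assume "p dvd n"
      then have "is_unit p" using cop(1) by (meson coprime_common_divisor dvd_refl)
      then show False using p by (metis not_prime_unit)
    qed
    then have "ipoly q (\<omega> ^ p) = 0" using less.prems p assms(1) by (intro root_of_unity_prime_power[of n])
    moreover have "(\<omega> ^ p) ^ n = 1" using less.prems by (metis mult.commute power_mult power_one)
    ultimately have "ipoly q ((\<omega> ^ p) ^ l) = 0" using less.IH[OF \<open>l < k\<close>] cop \<open>l > 0\<close> by blast
    then show ?thesis using l by (simp add: power_mult)
  qed
qed

interpretation Rats: complex_subfield "\<rat>"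
  by unfold_locales auto

lemma rational_poly_denominator:
  assumes "Rats.in_poly p"
  shows "\<exists>d q. d \<noteq> (0::int) \<and> map_poly of_int q = smult (of_int d) p"
  using assms
proof (induction p)
  case 0
  show ?case by (rule exI[of _ 1], rule exI[of _ 0]) simp
next
  case (pCons a p)
  then have a: "a \<in> \<rat>" and p: "Rats.in_poly p" by (simp_all add: Rats.in_poly_pCons_iff)
  then obtain d q where dq: "d \<noteq> (0::int)" "map_poly of_int q = smult (of_int d) p" using pCons.IH by blast
  from a obtain u v where "v > 0" "coprime u v" and av: "a = of_int u / of_int v" by (rule Rats_cases')
  then have uv: "v \<noteq> 0" "a = of_int u / of_int v" by auto
  have "map_poly of_int (pCons (u * d) (smult v q))
      = pCons (of_int (u * d)) (smult (of_int v) (map_poly of_int q :: complex poly))"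
    by (simp add: map_poly_pCons map_poly_smult)
  also have "\<dots> = smult (of_int (v * d)) (pCons a p)" using dq uv by (simp add: field_simps)
  finally show ?case using dq uv by (intro exI[of _ "v * d"] exI[of _ "pCons (u * d) (smult v q)"]) auto
qed

text \<open>
  The form of irreducibility used below: rational relations for a root of unity survive raising it to a power
  prime to \<open>n\<close>.
\<close>

theorem rational_poly_conjugate_root:
  assumes "n > 0" "\<omega> ^ n = 1" "coprime k n" "k > 0" "Rats.in_poly p" "poly p \<omega> = 0"
  shows "poly p (\<omega> ^ k) = 0"
proof -
  obtain d q where dq: "d \<noteq> (0::int)" "map_poly of_int q = smult (of_int d) p"
    using rational_poly_denominator[OF assms(5)] by blast
  have "ipoly q z = of_int d * poly p z" for z by (simp add: ipoly_def dq)
  then show ?thesis using root_of_unity_coprime_power[OF assms(1-4), of q] assms(6) dq(1) by simp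
qed

lemma rat_adjoin_poly:
  assumes n: "n > 0" "\<omega> ^ n = 1" and x: "x \<in> rat_adjoin \<omega>"
  obtains p where "Rats.in_poly p" "x = poly p \<omega>"
proof -
  let ?S = "{poly p \<omega> | p. Rats.in_poly p}"
  have "(monom 1 n - 1 :: complex poly) \<noteq> 0" using degree_monom_minus_1(2)[OF n(1), where ?'a = complex]
      by force
  moreover have "Rats.in_poly (monom 1 n - 1)" by (intro Rats.in_poly_diff Rats.in_poly_monom) auto
  moreover have "poly (monom 1 n - 1) \<omega> = 0" using n by (simp add: poly_monom)
  ultimately obtain m where m: "Rats.minimal_poly \<omega> m" using Rats.minimal_poly_exists by blast
  have "complex_subfield ?S"
  proof
    show "\<rat> \<subseteq> ?S"
    proof
      fix c :: complex assume "c \<in> \<rat>"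
      then show "c \<in> ?S" by (intro CollectI exI[of _ "[:c:]"]) (simp add: Rats.in_poly_pCons_iff)
    qed
    fix y assume "y \<in> ?S"
    then obtain p where p: "Rats.in_poly p" "y = poly p \<omega>" by blast
    show "- y \<in> ?S" using p Rats.in_poly_smult[of "-1" p] by (intro CollectI exI[of _ "smult (-1) p"]) simp
    show "inverse y \<in> ?S"
    proof (cases "y = 0")
      case True
      then show ?thesis by (intro CollectI exI[of _ 0]) simp
    next
      case False
      then obtain a where "Rats.in_poly a" "poly a \<omega> * poly p \<omega> = 1" using Rats.algebraic_inverse[OF m] p
          by blast
      then show ?thesis using p False by (intro CollectI exI[of _ a]) (auto simp: field_simps)
    qed
    fix z assume "z \<in> ?S"
    then obtain q where q: "Rats.in_poly q" "z = poly q \<omega>" by blast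
    show "y + z \<in> ?S" using p q Rats.in_poly_add by (intro CollectI exI[of _ "p + q"]) simp
    show "y * z \<in> ?S" using p q Rats.in_poly_mult by (intro CollectI exI[of _ "p * q"]) simp
  qed
  moreover have "\<omega> \<in> ?S" by (intro CollectI exI[of _ "[:0, 1:]"]) (simp add: Rats.in_poly_pCons_iff)
  ultimately have "rat_adjoin \<omega> \<subseteq> ?S" by (rule rat_adjoin_least)
  then show ?thesis using x that by blast
qed

section \<open>Cotangent numbers lie in the cyclotomic field\<close>

text \<open>
  For \<open>n = 0\<close> this is \<open>\<pi> cot (\<pi> z)\<close>, and increasing \<open>n\<close> by one means differentiating; thus it is the \<open>n\<close>-th
  derivative of \<open>\<pi> cot (\<pi> z)\<close>.
\<close>

definition reflected_polygamma :: "nat \<Rightarrow> complex \<Rightarrow> complex" where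
  "reflected_polygamma n z = (-1) ^ n * Polygamma n (1 - z) - Polygamma n z"

lemma sin_pi_nonzero_imp:
  assumes "sin (of_real pi * z :: complex) \<noteq> 0"
  shows "z \<notin> \<int>" "z \<notin> \<int>\<^sub>\<le>\<^sub>0" "1 - z \<notin> \<int>\<^sub>\<le>\<^sub>0" "z \<noteq> 0" "1 - z \<noteq> 0"
proof -
  show 1: "z \<notin> \<int>"
  proof
    assume "z \<in> \<int>"
    then obtain k where "z = of_int k" by (elim Ints_cases)
    then have "of_real pi * z = of_real (of_int k * pi)" by simp
    then have "sin (of_real pi * z) = of_real (sin (of_int k * pi))" by (simp only: sin_of_real)
    also have "sin (of_int k * pi) = 0" by (simp add: sin_times_pi_eq_0)
    finally show False using assms by simp
  qed
  then have 2: "1 - z \<notin> \<int>" by (metis Ints_1 Ints_diff diff_diff_eq2 add_diff_cancel_left')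
  show "z \<notin> \<int>\<^sub>\<le>\<^sub>0" "1 - z \<notin> \<int>\<^sub>\<le>\<^sub>0" using 1 2 nonpos_Ints_subset_Ints by blast+
  show "z \<noteq> 0" "1 - z \<noteq> 0" using 1 2 by (metis Ints_0)+
qed

lemma open_sin_pi_nonzero: "open {z :: complex. sin (of_real pi * z) \<noteq> 0}"
  by (intro open_Collect_neq continuous_intros)

text \<open>
  Logarithmic derivative of the reflection formula for the Gamma function.
\<close>

lemma Digamma_reflection:
  assumes "sin (of_real pi * z :: complex) \<noteq> 0"
  shows "Digamma (1 - z) - Digamma z = of_real pi * cos (of_real pi * z) / sin (of_real pi * z)"
proof -
  note z = sin_pi_nonzero_imp[OF assms]
  let ?G = "\<lambda>z. Gamma z * Gamma (1 - z) * sin (of_real pi * z) :: complex"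
  let ?s = "sin (of_real pi * z)" and ?c = "cos (of_real pi * z)"
  have const: "?G w = of_real pi" if "sin (of_real pi * w) \<noteq> 0" for w
    using Gamma_reflection_complex[of w] that by simp
  have "(?G has_field_derivative 0) (at z)"
    by (rule has_field_derivative_transform_within_open[OF DERIV_const open_sin_pi_nonzero])
       (use assms const in auto)
  moreover have "(?G has_field_derivative (Gamma z * Digamma z * Gamma (1 - z)
      + (Gamma (1 - z) * Digamma (1 - z) * (-1)) * Gamma z) * ?s
      + (?c * of_real pi) * (Gamma z * Gamma (1 - z))) (at z)"
    using z by (auto intro!: derivative_eq_intros)
  ultimately have "(Gamma z * Digamma z * Gamma (1 - z) + (Gamma (1 - z) * Digamma (1 - z) * (-1)) * Gamma z)
      * ?s
      + (?c * of_real pi) * (Gamma z * Gamma (1 - z)) = 0" by (rule DERIV_unique[symmetric])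
  then have "(Gamma z * Gamma (1 - z)) * ((Digamma z - Digamma (1 - z)) * ?s + of_real pi * ?c) = 0"
    by (simp add: algebra_simps)
  moreover have "Gamma z * Gamma (1 - z) \<noteq> 0" using const[OF assms] by auto
  ultimately have "(Digamma z - Digamma (1 - z)) * ?s + of_real pi * ?c = 0" by simp
  then have "(Digamma (1 - z) - Digamma z) * ?s = of_real pi * ?c" by (simp add: algebra_simps)
  then show ?thesis by (simp only: nonzero_eq_divide_eq[OF assms])
qed

lemma reflected_polygamma_sums:
  assumes "sin (of_real pi * z :: complex) \<noteq> 0"
  shows "(\<lambda>k. 1 / (z + of_nat k) ^ Suc n + (-1) ^ Suc n / (of_nat k + 1 - z) ^ Suc n) sums
     ((-1) ^ n / fact n * reflected_polygamma n z)"
proof -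
  note z = sin_pi_nonzero_imp[OF assms]
  have sw: "of_nat k + 1 - z = (1 - z) + of_nat k" for k by simp
  show ?thesis
  proof (cases "n = 0")
    case True
    have "(\<lambda>k. (inverse (of_nat (Suc k)) - inverse ((1 - z) + of_nat k))
        - (inverse (of_nat (Suc k)) - inverse (z + of_nat k)))
       sums ((Digamma (1 - z) + euler_mascheroni) - (Digamma z + euler_mascheroni))"
      using summable_sums[OF summable_Digamma[OF z(4)]] summable_sums[OF summable_Digamma[OF z(5)]]
      by (intro sums_diff) (simp_all add: Digamma_def)
    then show ?thesis using True unfolding sw by (simp add: reflected_polygamma_def divide_inverse)
  next
    case False
    have "(\<lambda>k. inverse ((z + of_nat k) ^ Suc n) + (-1) ^ Suc n * inverse (((1 - z) + of_nat k) ^ Suc n)) sums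
      ((-1) ^ Suc n * Polygamma n z / fact n + (-1) ^ Suc n * ((-1) ^ Suc n * Polygamma n (1 - z) / fact n))"
      using False z by (intro sums_add sums_mult Polygamma_LIMSEQ) auto
    moreover have "(-1) ^ Suc n * Polygamma n z / fact n + (-1) ^ Suc n
        * ((-1) ^ Suc n * Polygamma n (1 - z) / fact n)
      = (-1) ^ n / fact n * reflected_polygamma n z"
      by (cases "even n") (simp_all add: reflected_polygamma_def diff_divide_distrib add_divide_distrib)
    ultimately show ?thesis unfolding sw by (simp only: divide_inverse mult_1)
  qed
qed

lemma reflected_polygamma_deriv:
  assumes "sin (of_real pi * z :: complex) \<noteq> 0"
  shows "(reflected_polygamma n has_field_derivative reflected_polygamma (Suc n) z) (at z)"
proof -
  note z = sin_pi_nonzero_imp[OF assms]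
  have "((\<lambda>z. (-1) ^ n * Polygamma n (1 - z) - Polygamma n z) has_field_derivative
      (-1) ^ n * (Polygamma (Suc n) (1 - z) * (-1)) - Polygamma (Suc n) z) (at z)"
    using z by (auto intro!: derivative_eq_intros DERIV_chain2[OF has_field_derivative_Polygamma])
  then show ?thesis by (simp add: reflected_polygamma_def[abs_def])
qed

lemma Rats_in_poly_pderiv: "Rats.in_poly p \<Longrightarrow> Rats.in_poly (pderiv p)"
  by (auto simp: Rats.in_poly_def coeff_pderiv)

text \<open>
  With \<open>w = exp (2 \<pi> \<i> z)\<close> one has \<open>\<pi> cot (\<pi> z) = \<i> \<pi> (w + 1) / (w - 1)\<close>, and differentiation with respect to \<open>z\<close> is
  \<open>2 \<pi> \<i> w\<close> times differentiation with respect to \<open>w\<close>.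
\<close>

lemma reflected_polygamma_rational:
  "\<exists>P. Rats.in_poly P \<and> (\<forall>z. sin (of_real pi * z) \<noteq> 0 \<longrightarrow>
     reflected_polygamma n z = (\<i> * of_real pi) ^ Suc n
         * (poly P (exp (2 * of_real pi * \<i> * z)) / (exp (2 * of_real pi * \<i> * z) - 1) ^ Suc n))"
proof (induction n)
  case 0
  have "reflected_polygamma 0 z = (\<i> * of_real pi)
      * ((exp (2 * of_real pi * \<i> * z) + 1) / (exp (2 * of_real pi * \<i> * z) - 1))"
    if z: "sin (of_real pi * z) \<noteq> 0" for z
  proof -
    define u where "u = exp (\<i> * (of_real pi * z))"
    have u0: "u \<noteq> 0" by (simp add: u_def)
    have w: "exp (2 * of_real pi * \<i> * z) = u * u" by (simp add: u_def mult_ac flip: exp_add)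
    have s: "sin (of_real pi * z) = (u - inverse u) / (2 * \<i>)"
      by (simp add: sin_exp_eq u_def exp_minus)
    have c: "cos (of_real pi * z) = (u + inverse u) / 2"
      by (simp add: cos_exp_eq u_def exp_minus)
    have "u - inverse u \<noteq> 0" using z s by auto
    then have ne: "u * u - 1 \<noteq> 0" using u0 by (auto simp: field_simps)
    have "reflected_polygamma 0 z = of_real pi * cos (of_real pi * z) / sin (of_real pi * z)"
      using Digamma_reflection[OF z] by (simp add: reflected_polygamma_def)
    also have "\<dots> = of_real pi * \<i> * ((u + inverse u) / (u - inverse u))"
    proof -
      have "x * (e / 2) / (d / (2 * \<i>)) = x * \<i> * (e / d)" for x e d :: complex
        by (cases "d = 0") (simp_all add: field_simps)
      then show ?thesis unfolding s c .
    qed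
    also have "(u + inverse u) / (u - inverse u) = (u * u + 1) / (u * u - 1)"
    proof -
      have 1: "u + inverse u = (u * u + 1) / u" and 2: "u - inverse u = (u * u - 1) / u"
        using u0 by (simp_all add: add_divide_distrib diff_divide_distrib inverse_eq_divide)
      have "(x / u) / (y / u) = x / y" for x y using u0 by simp
      then show ?thesis unfolding 1 2 .
    qed
    finally show ?thesis unfolding w by (simp only: mult_ac)
  qed
  then show ?case by (intro exI[of _ "[:1, 1:]"]) (auto simp: Rats.in_poly_pCons_iff add.commute)
next
  case (Suc n)
  then obtain P where P: "Rats.in_poly P" "\<And>z. sin (of_real pi * z) \<noteq> 0 \<Longrightarrow>
     reflected_polygamma n z = (\<i> * of_real pi) ^ Suc n
         * (poly P (exp (2 * of_real pi * \<i> * z)) / (exp (2 * of_real pi * \<i> * z) - 1) ^ Suc n)" by blast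
  \<comment> \<open>From \<open>2 w d/dw (P / (w - 1) ^ k) = P' / (w - 1) ^ (k + 1)\<close> with \<open>k = n + 1\<close>.\<close>
  define P' where "P' = [:0, 2:] * (pderiv P * [:-1, 1:] - smult (of_nat (Suc n)) P)"
  have inP': "Rats.in_poly P'" unfolding P'_def
    by (intro Rats.in_poly_mult Rats.in_poly_diff Rats.in_poly_smult Rats_in_poly_pderiv P(1))
       (auto simp: Rats.in_poly_pCons_iff)
  have "reflected_polygamma (Suc n) z = (\<i> * of_real pi) ^ Suc (Suc n)
      * (poly P' (exp (2 * of_real pi * \<i> * z)) / (exp (2 * of_real pi * \<i> * z) - 1) ^ Suc (Suc n))"
    if z: "sin (of_real pi * z) \<noteq> 0" for z
  proof -
    let ?w = "\<lambda>z. exp (2 * of_real pi * \<i> * z)"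
    let ?F = "\<lambda>z. (\<i> * of_real pi) ^ Suc n * (poly P (?w z) / (?w z - 1) ^ Suc n)"
    have w1: "?w z - 1 \<noteq> 0"
    proof
      assume "?w z - 1 = 0"
      then have "?w z = 1" by simp
      then obtain k :: int where k: "Re (2 * of_real pi * \<i> * z) = 0" "Im (2 * of_real pi * \<i> * z)
          = of_int (2 * k) * pi"
        by (auto simp: exp_eq_1)
      then have "z = of_int k" by (auto simp: complex_eq_iff)
      then show False using sin_pi_nonzero_imp(1)[OF z] by simp
    qed
    have dw: "(?w has_field_derivative ?w z * (2 * of_real pi * \<i>)) (at z)"
      by (auto intro!: derivative_eq_intros)
    have d1: "((\<lambda>z. poly P (?w z)) has_field_derivative poly (pderiv P) (?w z)
        * (?w z * (2 * of_real pi * \<i>))) (at z)"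
      by (rule DERIV_chain2[OF poly_DERIV dw])
    have d2: "((\<lambda>z. (?w z - 1) ^ Suc n) has_field_derivative of_nat (Suc n)
        * ((?w z * (2 * of_real pi * \<i>)) * (?w z - 1) ^ n)) (at z)"
      using DERIV_power[OF DERIV_diff[OF dw DERIV_const[of 1]], of "Suc n"] by simp
    let ?a = "poly P (?w z)" and ?a' = "poly (pderiv P) (?w z) * (?w z * (2 * of_real pi * \<i>))"
      and ?b = "(?w z - 1) ^ Suc n" and ?b' = "of_nat (Suc n)
          * ((?w z * (2 * of_real pi * \<i>)) * (?w z - 1) ^ n)"
    have b0: "?b \<noteq> 0" using w1 by simp
    have dF: "(?F has_field_derivative (\<i> * of_real pi) ^ Suc n * ((?a' * ?b - ?a * ?b') / (?b * ?b))) (at z)"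
      by (rule DERIV_cmult[OF DERIV_divide[OF d1 d2 b0]])
    have "(reflected_polygamma n has_field_derivative (\<i> * of_real pi) ^ Suc n
        * ((?a' * ?b - ?a * ?b') / (?b * ?b))) (at z)"
      by (rule has_field_derivative_transform_within_open[OF dF open_sin_pi_nonzero]) (use z P(2) in auto)
    with reflected_polygamma_deriv[OF z] have "reflected_polygamma (Suc n) z
        = (\<i> * of_real pi) ^ Suc n * ((?a' * ?b - ?a * ?b') / (?b * ?b))"
      by (rule DERIV_unique)
    also have "(?a' * ?b - ?a * ?b') / (?b * ?b)
        = (\<i> * of_real pi) * (poly P' (?w z) / (?w z - 1) ^ Suc (Suc n))"
    proof -
      define x where "x = ?w z"
      define y where "y = x - 1"
      have y0: "y \<noteq> 0" using w1 by (simp add: x_def y_def)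
      have P': "poly P' x = 2 * x * (poly (pderiv P) x * y - of_nat (Suc n) * poly P x)"
        by (simp add: P'_def y_def algebra_simps)
      have "?a' * ?b - ?a * ?b' = (\<i> * of_real pi) * poly P' x * y ^ n"
        unfolding P' x_def[symmetric] y_def[symmetric] by (simp add: algebra_simps)
      moreover have "?b * ?b = y ^ Suc (Suc n) * y ^ n" by (simp add: x_def y_def)
      ultimately show ?thesis using y0 unfolding x_def[symmetric] y_def[symmetric] by simp
    qed
    finally show ?thesis by (simp only: power_Suc2 mult.assoc)
  qed
  then show ?case using inP' by blast
qed

lemma zeta_power_n: "n > 0 \<Longrightarrow> zeta n ^ n = 1"
  by (simp add: zeta_def flip: exp_of_nat_mult)

lemma zeta_power: "zeta n ^ k = exp (2 * of_real pi * \<i> * (of_nat k / of_nat n))"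
  by (simp add: zeta_def mult_ac flip: exp_of_nat_mult)

lemma zeta_power_neq_1:
  assumes "0 < k" "k < n"
  shows "zeta n ^ k \<noteq> 1"
proof -
  have "zeta n ^ k = exp (2 * of_real pi * \<i> * of_nat k / of_nat n)" by (simp add: zeta_power)
  then show ?thesis using complex_root_unity_eq_1[of n k] assms by (auto dest: dvd_imp_le)
qed

text \<open>
  Removes the denominators \<open>w - 1\<close>, so that the cotangent numbers become polynomials in \<open>\<zeta> ^ j\<close>.
\<close>

lemma inverse_root_of_unity_minus_1:
  fixes w :: complex
  assumes "w ^ n = 1" "w \<noteq> 1" "n > 0"
  shows "1 / (w - 1) = (\<Sum>i<n. of_nat i * w ^ i) / of_nat n"
proof -
  have "(w - 1) * (\<Sum>i<m. of_nat i * w ^ i) = of_nat m * w ^ m - (\<Sum>i<m. w ^ Suc i)" for m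
    by (induction m) (auto simp: algebra_simps)
  from this[of n] have "(w - 1) * (\<Sum>i<n. of_nat i * w ^ i) = of_nat n - w * (\<Sum>i<n. w ^ i)"
    using assms by (simp add: sum_distrib_left)
  also have "(\<Sum>i<n. w ^ i) = 0" using assms by (simp add: geometric_sum)
  finally show ?thesis using assms by (simp add: field_simps)
qed

lemma parity_indicator_block:
  assumes a: "0 < a" "a < n" "a \<noteq> n - a"
  shows "(\<Sum>m\<in>{k * n..<k * n + n}. parity_indicator \<eta> n (int a) (int m) / of_nat m ^ r)
    = 1 / of_nat (k * n + a) ^ r + \<eta> / of_nat (k * n + (n - a)) ^ r"
proof -
  have "(\<Sum>m\<in>{k * n..<k * n + n}. parity_indicator \<eta> n (int a) (int m) / of_nat m ^ r)
     = (\<Sum>i<n. parity_indicator \<eta> n (int a) (int (k * n + i)) / of_nat (k * n + i) ^ r)"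
    using sum.shift_bounds_nat_ivl[of "\<lambda>m. parity_indicator \<eta> n (int a) (int m) / of_nat m ^ r" 0 "k * n" n]
    by (simp add: add.commute atLeast0LessThan)
  also have "\<dots> = (\<Sum>i<n. (if i = a then 1 / of_nat (k * n + a) ^ r else 0) + (if i
      = n - a then \<eta> / of_nat (k * n + (n - a)) ^ r else 0))"
  proof (rule sum.cong)
    fix i assume i: "i \<in> {..<n}"
    have iff1: "[int (k * n + i) = int a] (mod int n) \<longleftrightarrow> i = a"
      using i a by (simp add: cong_def)
    have iff2: "[int (k * n + i) = - int a] (mod int n) \<longleftrightarrow> i = n - a"
    proof -
      have "(- int a) mod int n = int n - int a"
        using a by (simp add: zmod_zminus1_eq_if)
      then show ?thesis using i a by (auto simp: cong_def)
    qed
    show "parity_indicator \<eta> n (int a) (int (k * n + i)) / of_nat (k * n + i) ^ r =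
       (if i = a then 1 / of_nat (k * n + a) ^ r else 0) + (if i
           = n - a then \<eta> / of_nat (k * n + (n - a)) ^ r else 0)"
      unfolding parity_indicator_def iff1 iff2 using a by (auto simp del: of_nat_add of_nat_mult of_nat_diff)
  qed simp
  also have "\<dots> = 1 / of_nat (k * n + a) ^ r + \<eta> / of_nat (k * n + (n - a)) ^ r"
    using a by (simp add: sum.distrib)
  finally show ?thesis .
qed

text \<open>
  Grouping the series into blocks of length \<open>n\<close> gives \<open>1 / n ^ r\<close> times the partial fraction expansion of a
  derivative of \<open>\<pi> cot (\<pi> x)\<close> at \<open>x = j / n\<close>. The polynomial \<open>U\<close> is the same for all \<open>j\<close>, which is what makes the
  cotangent numbers conjugate to each other.
\<close>

theorem cot_value_cyclotomic:
  assumes n: "n \<ge> 3" and r: "r \<ge> 1"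
  obtains U where "Rats.in_poly U"
    "\<And>j c. coprime j (int n) \<Longrightarrow> (\<lambda>m. parity_indicator ((-1) ^ r) n j (int m) / of_nat m ^ r) sums c \<Longrightarrow>
       c = (\<i> * of_real pi) ^ r * poly U (zeta n ^ nat (j mod int n))"
proof -
  obtain q where q: "r = Suc q" using r by (cases r) auto
  obtain P where P: "Rats.in_poly P" "\<And>z. sin (of_real pi * z) \<noteq> 0 \<Longrightarrow>
     reflected_polygamma q z = (\<i> * of_real pi) ^ Suc q
         * (poly P (exp (2 * of_real pi * \<i> * z)) / (exp (2 * of_real pi * \<i> * z) - 1) ^ Suc q)"
    using reflected_polygamma_rational by blast
  \<comment> \<open>A polynomial that equals \<open>1 / (w - 1)\<close> at the \<open>n\<close>-th roots of unity \<open>w \<noteq> 1\<close>.\<close>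
  define V where "V = smult (1 / of_nat n) (\<Sum>i<n. monom (of_nat i) i :: complex poly)"
  define U where "U = smult ((-1) ^ q / (fact q * of_nat n ^ r)) (P * V ^ r)"
  have "Rats.in_poly V"
    by (auto simp: V_def Rats.in_poly_def coeff_sum coeff_monom intro!: Rats_mult Rats_divide Rats_sum)
  moreover have "(fact q :: complex) \<in> \<rat>" by (metis Rats_of_nat of_nat_fact)
  ultimately have U: "Rats.in_poly U" unfolding U_def
    by (intro Rats.in_poly_smult Rats.in_poly_mult Rats.in_poly_power P(1))
        (auto intro!: Rats_divide Rats_mult Rats_power)
  have V_eval: "poly V w = 1 / (w - 1)" if "w ^ n = 1" "w \<noteq> 1" for w
    using inverse_root_of_unity_minus_1[OF that] n by (simp add: V_def poly_sum poly_monom)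
  have "c = (\<i> * of_real pi) ^ r * poly U (zeta n ^ nat (j mod int n))"
    if j: "coprime j (int n)" and c: "(\<lambda>m. parity_indicator ((-1) ^ r) n j (int m) / of_nat m ^ r) sums c"
        for j c
  proof -
    define a where "a = nat (j mod int n)"
    have aj: "[j = int a] (mod int n)" using n by (simp add: a_def cong_def)
    have an: "a < n" using n by (simp add: a_def nat_less_iff)
    have cop: "coprime a n" using j cong_imp_coprime[OF aj] by simp
    have a0: "0 < a" using cop n by (intro Nat.gr0I) auto
    have ana: "a \<noteq> n - a"
    proof
      assume "a = n - a"
      then have "n = 2 * a" using an by simp
      then have "a = 1" using cop by simp
      then show False using \<open>n = 2 * a\<close> n by simp
    qed
    define z where "z = (of_nat a / of_nat n :: complex)"
    have sin0: "sin (of_real pi * z) \<noteq> 0"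
    proof -
      have "of_real pi * z = of_real (pi * (real a / real n))" by (simp add: z_def)
      then have "sin (of_real pi * z) = of_real (sin (pi * (real a / real n)))" by (simp only: sin_of_real)
      moreover have "sin (pi * (real a / real n)) > 0"
        using a0 an n by (intro sin_gt_zero) (auto simp: field_simps)
      ultimately show ?thesis by (metis less_irrefl of_real_eq_0_iff)
    qed
    have "(\<lambda>m. parity_indicator ((-1) ^ r) n (int a) (int m) / of_nat m ^ r) sums c"
      using c parity_indicator_cong[OF aj cong_refl] by simp
    then have "(\<lambda>k. \<Sum>m\<in>{k * n..<k * n + n}. parity_indicator ((-1) ^ r) n (int a) (int m) / of_nat m ^ r)
        sums c"
      using n by (intro sums_group) auto
    then have s1: "(\<lambda>k. 1 / of_nat (k * n + a) ^ r + (-1) ^ r / of_nat (k * n + (n - a)) ^ r) sums c"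
      by (simp only: parity_indicator_block[OF a0 an ana])
    have s2: "(\<lambda>k. (1 / of_nat n ^ r) * (1 / (z + of_nat k) ^ Suc q + (-1) ^ Suc q / (of_nat k + 1 - z) ^ Suc
        q)) sums
      ((1 / of_nat n ^ r) * ((-1) ^ q / fact q * reflected_polygamma q z))"
      by (intro sums_mult reflected_polygamma_sums sin0)
    have eqk: "(1 / of_nat n ^ r) * (1 / (z + of_nat k) ^ Suc q + (-1) ^ Suc q / (of_nat k + 1 - z) ^ Suc q)
       = 1 / of_nat (k * n + a) ^ r + (-1) ^ r / of_nat (k * n + (n - a)) ^ r" for k
    proof -
      have n0: "of_nat n \<noteq> (0 :: complex)" using n by simp
      have 1: "of_nat (k * n + a) = of_nat n * (z + of_nat k)" using n0
          by (simp add: z_def distrib_left mult.commute)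
      have 2: "of_nat (k * n + (n - a)) = of_nat n * (of_nat k + 1 - z)" using n0 an
          by (simp add: z_def distrib_left right_diff_distrib of_nat_diff mult.commute)
      show ?thesis unfolding 1 2 q[symmetric] power_mult_distrib by (simp add: distrib_left)
    qed
    have "c = (1 / of_nat n ^ r) * ((-1) ^ q / fact q * reflected_polygamma q z)"
      by (rule sums_unique2[OF s1 s2[unfolded eqk]])
    moreover have w: "exp (2 * of_real pi * \<i> * z) = zeta n ^ a" by (simp add: zeta_power z_def)
    moreover have "poly V (zeta n ^ a) = 1 / (zeta n ^ a - 1)"
    proof (rule V_eval)
      show "(zeta n ^ a) ^ n = 1" using zeta_power_n[of n] n
          by (metis mult.commute power_mult power_one gr0I not_numeral_le_zero)
      show "zeta n ^ a \<noteq> 1" using zeta_power_neq_1 a0 an by blast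
    qed
    then have "poly U (zeta n ^ a) = (-1) ^ q / (fact q * of_nat n ^ r)
        * (poly P (zeta n ^ a) / (zeta n ^ a - 1) ^ r)"
      by (simp add: U_def power_divide)
    ultimately show ?thesis
    proof -
      assume c1: "c = (1 / of_nat n ^ r) * ((-1) ^ q / fact q * reflected_polygamma q z)"
        and w: "exp (2 * of_real pi * \<i> * z) = zeta n ^ a"
        and pU: "poly U (zeta n ^ a) = (-1) ^ q / (fact q * of_nat n ^ r)
            * (poly P (zeta n ^ a) / (zeta n ^ a - 1) ^ r)"
      have "(1 / x1) * (x2 / x3 * (x4 * x5)) = x4 * (x2 / (x3 * x1) * x5)" for x1 x2 x3 x4 x5 :: complex
        by (simp add: mult_ac)
      then show ?thesis unfolding a_def[symmetric] pU c1 P(2)[OF sin0] w q .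
    qed
  qed
  then show ?thesis using that U by blast
qed

section \<open>The Galois action on the inverse cotangent numbers\<close>

lemma sum_unit_residues_mult:
  assumes "coprime t (int n)" "n > 0" and per: "\<And>a b. [a = b] (mod int n) \<Longrightarrow> F a = F b"
  shows "(\<Sum>k\<in>unit_residues n. F (t * k)) = (\<Sum>k\<in>unit_residues n. F k :: complex)"
proof -
  let ?r = "\<lambda>k. (t * k) mod int n"
  have c: "[?r k = t * k] (mod int n)" for k by (simp add: cong_def)
  have "inj_on ?r (unit_residues n)"
  proof (rule inj_onI)
    fix x y assume xy: "x \<in> unit_residues n" "y \<in> unit_residues n" "?r x = ?r y"
    then have "[t * x = t * y] (mod int n)" by (simp add: cong_def)
    then have "[x = y] (mod int n)" using assms(1) by (simp add: cong_mult_lcancel)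
    then show "x = y" using xy by (simp add: unit_residues_def cong_def)
  qed
  moreover have "?r ` unit_residues n \<subseteq> unit_residues n"
  proof
    fix y assume "y \<in> ?r ` unit_residues n"
    then obtain k where k: "k \<in> unit_residues n" "y = ?r k" by blast
    then have "coprime (t * k) (int n)" using assms(1) by (simp add: unit_residues_def)
    then have "coprime (?r k) (int n)" using cong_imp_coprime[OF cong_sym[OF c]] by blast
    then show "y \<in> unit_residues n" using k assms(2) by (simp add: unit_residues_def)
  qed
  ultimately have "bij_betw ?r (unit_residues n) (unit_residues n)"
    by (simp add: bij_betw_def endo_inj_surj)
  then have "(\<Sum>k\<in>unit_residues n. F (?r k)) = (\<Sum>k\<in>unit_residues n. F k)"
    by (rule sum.reindex_bij_betw)
  then show ?thesis using per[OF c] by simp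
qed

lemma modular_inverse_cancel:
  assumes "coprime t (int n)" "coprime k (int n)"
  shows "[(modular_inverse (int n) (t * k)) * (t * j) = (modular_inverse (int n) k) * j] (mod int n)"
proof -
  let ?a = "modular_inverse (int n) (t * k)" and ?b = "modular_inverse (int n) k"
  have "coprime (t * k) (int n)" using assms by simp
  then have 1: "[(t * k) * ?a = 1] (mod int n)" by (rule modular_inverse_coprime)
  have 2: "[k * ?b = 1] (mod int n)" by (rule modular_inverse_coprime[OF assms(2)])
  have "[k * (?a * (t * j)) = ((t * k) * ?a) * j] (mod int n)" by (simp add: mult_ac)
  also have "[((t * k) * ?a) * j = 1 * j] (mod int n)" by (rule cong_mult[OF 1 cong_refl])
  also have "[1 * j = (k * ?b) * j] (mod int n)" by (rule cong_mult[OF cong_sym[OF 2] cong_refl])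
  finally have "[k * (?a * (t * j)) = k * (?b * j)] (mod int n)" by (simp only: mult.assoc)
  then show ?thesis using assms(2) by (simp only: cong_mult_lcancel)
qed

text \<open>
  The algebraic situation to which the analytic part leads: \<open>e\<close> is the normalised inverse cotangent number and
  \<open>U\<close> at \<open>\<zeta> ^ j\<close> the normalised cotangent number. The exponent is reduced modulo \<open>n\<close> to a natural number so that
  \<open>U\<close> at \<open>\<zeta> ^ j\<close> is a polynomial in \<open>\<zeta>\<close>.
\<close>

locale parity_system =
  fixes n :: nat and \<eta> :: complex and e :: "int \<Rightarrow> complex" and U :: "complex poly"
  assumes n: "n \<ge> 3" and eta: "\<eta> = 1 \<or> \<eta> = -1" and U: "Rats.in_poly U"
    and e_periodic: "[a = b] (mod int n) \<Longrightarrow> e a = e b"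
    and e_parity: "coprime a (int n) \<Longrightarrow> e (- a) = \<eta> * e a"
    and convolution: "coprime j (int n) \<Longrightarrow>
      (\<Sum>k\<in>unit_residues n. e k * poly U (zeta n ^ nat ((modular_inverse (int n) k * j) mod int n)))
          = 2 * parity_indicator \<eta> n j 1"
begin

definition u :: "int \<Rightarrow> complex" where "u j = poly U (zeta n ^ nat (j mod int n))"

abbreviation "iv \<equiv> modular_inverse (int n)"
abbreviation "G \<equiv> unit_residues n"

lemma npos: "n > 0" using n by simp

lemma eta_sq: "\<eta> * \<eta> = 1" using eta by auto

lemma eta_rat: "\<eta> \<in> \<rat>" using eta by auto

lemma u_periodic: "[a = b] (mod int n) \<Longrightarrow> u a = u b"
  by (simp add: u_def cong_def)

lemma conv: "coprime j (int n) \<Longrightarrow> (\<Sum>k\<in>G. e k * u (iv k * j)) = 2 * parity_indicator \<eta> n j 1"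
  using convolution by (simp add: u_def)

lemma G_coprime: "k \<in> G \<Longrightarrow> coprime k (int n)"
  by (simp add: unit_residues_def)

lemma mod_in_G: "coprime k (int n) \<Longrightarrow> k mod int n \<in> G"
  using npos by (simp add: unit_residues_def)

lemma iv_coprime: "coprime k (int n) \<Longrightarrow> coprime (iv k) (int n)"
  by (rule modular_inverse_coprime)

text \<open>
  Convolving the equations with \<open>e\<close> inverts \<open>u\<close>: it turns the left-hand side into \<open>2 (y a + \<eta> * y (- a))\<close>, which is
  \<open>4 * y a\<close> for a function of parity \<open>\<eta>\<close>.
\<close>

lemma homogeneous_solution_zero:
  assumes per: "\<And>a b. [a = b] (mod int n) \<Longrightarrow> y a = y b"
    and par: "\<And>a. coprime a (int n) \<Longrightarrow> y (- a) = \<eta> * y a"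
    and hom: "\<And>j. coprime j (int n) \<Longrightarrow> (\<Sum>k\<in>G. y k * u (iv k * j)) = 0"
    and a: "coprime a (int n)"
  shows "y a = 0"
proof -
  have "(\<Sum>b\<in>G. y b * (2 * parity_indicator \<eta> n (iv b * a) 1))
      = (\<Sum>b\<in>G. y b * (\<Sum>k\<in>G. e k * u (iv k * (iv b * a))))"
    using a G_coprime iv_coprime by (intro sum.cong refl) (simp add: conv)
  also have "\<dots> = (\<Sum>b\<in>G. \<Sum>k\<in>G. e k * (y b * u (iv b * (iv k * a))))"
    by (simp add: sum_distrib_left mult_ac)
  also have "\<dots> = (\<Sum>k\<in>G. \<Sum>b\<in>G. e k * (y b * u (iv b * (iv k * a))))" by (rule sum.swap)
  also have "\<dots> = (\<Sum>k\<in>G. e k * (\<Sum>b\<in>G. y b * u (iv b * (iv k * a))))" by (simp add: sum_distrib_left)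
  also have "\<dots> = 0"
  proof (rule sum.neutral, rule ballI)
    fix k assume "k \<in> G"
    then have "coprime (iv k * a) (int n)" using a G_coprime iv_coprime by simp
    then show "e k * (\<Sum>b\<in>G. y b * u (iv b * (iv k * a))) = 0" using hom by simp
  qed
  finally have z: "(\<Sum>b\<in>G. y b * (2 * parity_indicator \<eta> n (iv b * a) 1)) = 0" .
  have "(\<Sum>b\<in>G. y b * (2 * parity_indicator \<eta> n (iv b * a) 1))
     = (\<Sum>b\<in>G. 2 * (of_bool ([a = b] (mod int n)) * y b) + 2 * (\<eta> * (of_bool ([- a = b] (mod int n)) * y b)))"
  proof (rule sum.cong)
    fix b assume "b \<in> G"
    then have "parity_indicator \<eta> n (iv b * a) 1 = parity_indicator \<eta> n a b"
      using parity_indicator_inverse[of b n \<eta> a 1] G_coprime by simp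
    also have "\<dots> = of_bool ([a = b] (mod int n)) + \<eta> * of_bool ([- a = b] (mod int n))"
      by (simp add: parity_indicator_def cong_sym_eq)
    finally show "y b * (2 * parity_indicator \<eta> n (iv b * a) 1)
        = 2 * (of_bool ([a = b] (mod int n)) * y b) + 2 * (\<eta> * (of_bool ([- a = b] (mod int n)) * y b))"
      by (simp add: algebra_simps)
  qed simp
  also have "\<dots> = 2 * y a + 2 * (\<eta> * y (- a))"
    unfolding sum.distrib sum_distrib_left[symmetric]
    using a npos per by (subst (1 2) sum_unit_residues_of_bool) auto
  also have "\<dots> = 4 * y a" using par[OF a] eta_sq by (simp add: mult.assoc[symmetric])
  finally show ?thesis using z by simp
qed

text \<open>
  The convolution equations together with the parity conditions form a linear system over \<open>\<rat>(\<zeta>)\<close> with solution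
  \<open>e\<close>. It has a solution in \<open>\<rat>(\<zeta>)\<close>, and the difference of the two solves the homogeneous system.
\<close>

lemma values_in_cyclotomic_field:
  assumes "k \<in> G"
  shows "e k \<in> rat_adjoin (zeta n)"
proof -
  interpret K: complex_subfield "rat_adjoin (zeta n)" by (rule rat_adjoin_subfield)
  \<comment> \<open>The equations are indexed by two copies of \<open>G\<close>: \<open>Inl\<close> for the convolution, \<open>Inr\<close> for the parity.\<close>
  define a :: "int + int \<Rightarrow> int \<Rightarrow> complex" where
    "a i k = (case i of Inl j \<Rightarrow> u (iv k * j) | Inr b \<Rightarrow> of_bool (k = (- b) mod int n) - \<eta> * of_bool (k = b))"
        for i k
  define b where "b i = (case i of Inl j \<Rightarrow> 2 * parity_indicator \<eta> n j 1 | Inr b \<Rightarrow> 0)" for i :: "int + int"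
  have uK: "u j \<in> rat_adjoin (zeta n)" for j
  proof -
    have "K.in_poly U" using U K.rats by (auto simp: K.in_poly_def Rats.in_poly_def)
    then show ?thesis unfolding u_def by (intro K.poly_in_poly K.power rat_adjoin_self)
  qed
  have etaK: "\<eta> \<in> rat_adjoin (zeta n)" using eta_rat K.rats by blast
  have neg: "(- c) mod int n \<in> G" if "c \<in> G" for c using that G_coprime mod_in_G by simp
  have d1: "(\<Sum>k\<in>G. of_bool (k = c) * z k) = z c" if "c \<in> G" for c and z :: "int \<Rightarrow> complex"
  proof -
    have "(\<Sum>k\<in>G. of_bool (k = c) * z k) = (\<Sum>k\<in>G. if k = c then z k else 0)" by (rule sum.cong) auto
    then show ?thesis using that by simp
  qed
  have Inr: "(\<Sum>k\<in>G. a (Inr c) k * z k) = z ((- c) mod int n) - \<eta> * z c" if "c \<in> G" for c z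
  proof -
    have "(\<Sum>k\<in>G. a (Inr c) k * z k) = (\<Sum>k\<in>G. of_bool (k = (- c) mod int n) * z k) - \<eta> * (\<Sum>k\<in>G. of_bool (k
        = c) * z k)"
      by (simp only: a_def sum.case left_diff_distrib sum_subtractf sum_distrib_left mult.assoc)
    then show ?thesis using that neg by (simp only: d1)
  qed
  have "\<exists>y. (\<forall>k\<in>G. y k \<in> rat_adjoin (zeta n)) \<and> (\<forall>i\<in>Inl ` G \<union> Inr ` G. (\<Sum>k\<in>G. a i k * y k) = b i)"
  proof (rule K.linear_system_solution[where x = e])
    show "a i k \<in> rat_adjoin (zeta n)" if "i \<in> Inl ` G \<union> Inr ` G" "k \<in> G" for i k
      using uK etaK by (auto simp: a_def split: sum.split intro!: K.diff K.mult K.minus)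
    show "b i \<in> rat_adjoin (zeta n)" if "i \<in> Inl ` G \<union> Inr ` G" for i
      using etaK K.of_nat[of 2] by (auto simp: b_def parity_indicator_def split: sum.split intro!: K.add K.mult)
    show "(\<Sum>k\<in>G. a i k * e k) = b i" if "i \<in> Inl ` G \<union> Inr ` G" for i
      using that
    proof
      assume "i \<in> Inl ` G"
      then obtain j where "j \<in> G" "i = Inl j" by blast
      then show ?thesis using conv[OF G_coprime] by (simp add: a_def b_def mult.commute)
    next
      assume "i \<in> Inr ` G"
      then obtain c where c: "c \<in> G" "i = Inr c" by blast
      have "e ((- c) mod int n) = e (- c)" by (rule e_periodic) (simp add: cong_def)
      then show ?thesis using Inr[OF c(1), of e] e_parity[OF G_coprime[OF c(1)]] c by (simp add: b_def)
    qed
  qed simp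
  then obtain y where y: "\<And>k. k \<in> G \<Longrightarrow> y k \<in> rat_adjoin (zeta n)"
    and eqs: "\<And>i. i \<in> Inl ` G \<union> Inr ` G \<Longrightarrow> (\<Sum>k\<in>G. a i k * y k) = b i" by blast
  define z where "z j = e j - y (j mod int n)" for j
  have Gmod: "k mod int n = k" if "k \<in> G" for k using that by (simp add: unit_residues_def)
  have "z k = 0"
  proof (rule homogeneous_solution_zero)
    show "z a = z b" if "[a = b] (mod int n)" for a b
      using e_periodic[OF that] that by (simp add: z_def cong_def)
    show "z (- a) = \<eta> * z a" if "coprime a (int n)" for a
    proof -
      have "y ((- (a mod int n)) mod int n) - \<eta> * y (a mod int n) = 0"
        using eqs[of "Inr (a mod int n)"] Inr[of "a mod int n" y] mod_in_G[OF that] by (simp add: b_def)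
      then have "y ((- a) mod int n) = \<eta> * y (a mod int n)" by (simp add: mod_minus_eq)
      then show ?thesis using e_parity[OF that] by (simp add: z_def right_diff_distrib)
    qed
    show "(\<Sum>k\<in>G. z k * u (iv k * j)) = 0" if j: "coprime j (int n)" for j
    proof -
      have "(\<Sum>k\<in>G. z k * u (iv k * j)) = (\<Sum>k\<in>G. e k * u (iv k * j)) - (\<Sum>k\<in>G. y k * u (iv k * j))"
        by (simp add: z_def Gmod left_diff_distrib sum_subtractf)
      also have "(\<Sum>k\<in>G. y k * u (iv k * j)) = (\<Sum>k\<in>G. a (Inl (j mod int n)) k * y k)"
      proof (rule sum.cong)
        fix k assume "k \<in> G"
        have "u (iv k * (j mod int n)) = u (iv k * j)"
            by (rule u_periodic) (simp add: cong_def mod_mult_right_eq)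
        then show "y k * u (iv k * j) = a (Inl (j mod int n)) k * y k" by (simp add: a_def)
      qed simp
      also have "\<dots> = 2 * parity_indicator \<eta> n (j mod int n) 1"
        using eqs[of "Inl (j mod int n)"] mod_in_G[OF j] by (simp add: b_def)
      also have "\<dots> = 2 * parity_indicator \<eta> n j 1"
        using parity_indicator_cong[of "j mod int n" j n 1 1 \<eta>] by (simp add: cong_def)
      finally show ?thesis using conv[OF j] by simp
    qed
  qed (rule G_coprime[OF assms])
  then show ?thesis using y[OF assms] Gmod[OF assms] by (simp add: z_def)
qed

lemma rational_representation:
  obtains p where "\<And>k. Rats.in_poly (p k)" "\<And>k. coprime k (int n) \<Longrightarrow> e k = poly (p k) (zeta n)"
proof -
  have "\<exists>p. Rats.in_poly p \<and> (coprime k (int n) \<longrightarrow> e k = poly p (zeta n))" for k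
  proof (cases "coprime k (int n)")
    case True
    have "e k = e (k mod int n)" by (rule e_periodic) (simp add: cong_def)
    then have "e k \<in> rat_adjoin (zeta n)" using values_in_cyclotomic_field[OF mod_in_G[OF True]] by simp
    then show ?thesis using rat_adjoin_poly[OF npos zeta_power_n[OF npos]] by metis
  next
    case False
    then show ?thesis using Rats.in_poly_0 by blast
  qed
  then show ?thesis using that by metis
qed

lemma zeta_power_mod:
  assumes "t > 0"
  shows "(zeta n ^ t) ^ nat (i mod int n) = zeta n ^ nat ((int t * i) mod int n)"
proof -
  have z: "zeta n ^ (a mod n) = zeta n ^ a" for a
  proof -
    have "zeta n ^ a = zeta n ^ (n * (a div n) + a mod n)" by simp
    also have "\<dots> = (zeta n ^ n) ^ (a div n) * zeta n ^ (a mod n)" by (simp only: power_add power_mult)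
    finally show ?thesis using zeta_power_n[OF npos] by simp
  qed
  have "nat ((int t * i) mod int n) = (t * nat (i mod int n)) mod n"
  proof -
    have "(int t * i) mod int n = (int t * int (nat (i mod int n))) mod int n"
      using npos by (simp add: mod_mult_right_eq)
    also have "\<dots> = int ((t * nat (i mod int n)) mod n)" by (simp add: zmod_int)
    finally show ?thesis by simp
  qed
  then show ?thesis using z by (simp add: power_mult)
qed

text \<open>
  Here \<open>\<zeta> \<mapsto> \<zeta> ^ t\<close> acts on \<open>e k\<close> through any polynomial \<open>p k\<close> representing it. Applied to the convolution equations it
  multiplies the argument of \<open>u\<close> by \<open>t\<close>; re-indexing the sum shows that \<open>k \<mapsto> e (t\<^sup>-\<^sup>1 k)\<close> solves the resulting
  equations as well, so both agree by uniqueness.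
\<close>

lemma galois_action:
  assumes p: "\<And>k. Rats.in_poly (p k)" "\<And>k. coprime k (int n) \<Longrightarrow> e k = poly (p k) (zeta n)"
    and t: "coprime t n" "t > 0" and k: "coprime k (int n)"
  shows "poly (p k) (zeta n ^ t) = e (iv (int t) * k)"
proof -
  have ct: "coprime (int t) (int n)" using t by simp
  have tr: "poly q (zeta n ^ t) = 0" if "Rats.in_poly q" "poly q (zeta n) = 0" for q
    by (rule rational_poly_conjugate_root[OF npos zeta_power_n[OF npos] t that])
  define y where "y j = poly (p (j mod int n)) (zeta n ^ t) - e (iv (int t) * j)" for j
  have Gmod: "j mod int n = j" if "j \<in> G" for j using that by (simp add: unit_residues_def)
  have emod: "e (j mod int n) = e j" for j by (rule e_periodic) (simp add: cong_def)
  have "y k = 0"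
  proof (rule homogeneous_solution_zero)
    show "y a = y b" if "[a = b] (mod int n)" for a b
      using e_periodic[OF cong_mult[OF cong_refl that], of "iv (int t)"] that by (simp add: y_def cong_def)
    show "y (- a) = \<eta> * y a" if a: "coprime a (int n)" for a
    proof -
      have "poly (p ((- a) mod int n) - smult \<eta> (p (a mod int n))) (zeta n) = 0"
        using p(2)[OF G_coprime[OF mod_in_G[of "- a"]]] p(2)[OF G_coprime[OF mod_in_G[OF a]]] a emod[of "- a"]
            emod[of a] e_parity[OF a] by simp
      then have "poly (p ((- a) mod int n) - smult \<eta> (p (a mod int n))) (zeta n ^ t) = 0"
        by (intro tr Rats.in_poly_diff Rats.in_poly_smult p eta_rat)
      moreover have "e (iv (int t) * (- a)) = \<eta> * e (iv (int t) * a)"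
        using e_parity[of "iv (int t) * a"] a iv_coprime[OF ct] by simp
      ultimately show ?thesis by (simp add: y_def right_diff_distrib)
    qed
    show "(\<Sum>k\<in>G. y k * u (iv k * j)) = 0" if j: "coprime j (int n)" for j
    proof -
      define j' where "j' = iv (int t) * j"
      have j': "coprime j' (int n)" using j iv_coprime[OF ct] by (simp add: j'_def)
      have tj: "[int t * j' = j] (mod int n)"
        using cong_mult[OF modular_inverse_coprime(2)[OF ct] cong_refl[of j]] by (simp add: j'_def mult.assoc)
      \<comment> \<open>The convolution equation at \<open>j'\<close> as a rational polynomial relation for \<open>\<zeta>\<close>.\<close>
      define R where "R = (\<Sum>k\<in>G. p k * pcompose U (monom 1 (nat ((iv k * j') mod int n))))
          - [:2 * parity_indicator \<eta> n j' 1:]"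
      have rat: "2 * parity_indicator \<eta> n j' 1 \<in> \<rat>" using eta_rat by (auto simp: parity_indicator_def)
      have sumR: "Rats.in_poly (\<Sum>k\<in>A. q k)" if "\<And>k. Rats.in_poly (q k)" for q :: "int \<Rightarrow> complex poly" and A
        by (induction A rule: infinite_finite_induct) (auto intro: Rats.in_poly_add that)
      have "Rats.in_poly R" unfolding R_def
        using rat by (intro Rats.in_poly_diff sumR Rats.in_poly_mult p(1) Rats.in_poly_pcompose U
            Rats.in_poly_monom Rats.in_poly_pCons) auto
      moreover have Rev: "poly R w = (\<Sum>k\<in>G. poly (p k) w * poly U (w ^ nat ((iv k * j') mod int n))) - 2
          * parity_indicator \<eta> n j' 1" for w
        by (simp add: R_def poly_sum poly_pcompose poly_monom)
      moreover have "poly R (zeta n) = 0"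
        unfolding Rev using conv[OF j'] G_coprime by (simp add: p(2)[symmetric] u_def)
      ultimately have "poly R (zeta n ^ t) = 0" by (intro tr)
      then have "(\<Sum>k\<in>G. poly (p k) (zeta n ^ t) * u (int t * (iv k * j'))) = 2 * parity_indicator \<eta> n j' 1"
        unfolding Rev by (simp add: zeta_power_mod[OF t(2)] u_def)
      moreover have "u (int t * (iv k * j')) = u (iv k * j)" for k
        using cong_mult[OF cong_refl tj, of "iv k"] by (intro u_periodic) (simp add: mult_ac)
      ultimately have 1: "(\<Sum>k\<in>G. poly (p k) (zeta n ^ t) * u (iv k * j)) = 2 * parity_indicator \<eta> n j' 1"
          by simp
      have "(\<Sum>k\<in>G. e (iv (int t) * k) * u (iv k * j)) = (\<Sum>k\<in>G. e k * u (iv k * j'))"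
      proof -
        let ?F = "\<lambda>k. e k * u (iv (int t * k) * j)"
        have tt: "[int t * (iv (int t) * k) = k] (mod int n)" for k
          using cong_mult[OF modular_inverse_coprime(2)[OF ct] cong_refl[of k]] by (simp add: mult.assoc)
        have ivc: "iv a = iv b" if "[a = b] (mod int n)" "coprime a (int n)" for a b
        proof -
          have cb: "coprime b (int n)" using cong_imp_coprime[OF that] .
          have "[a * iv a = a * iv b] (mod int n)"
            using modular_inverse_coprime(2)[OF that(2)] modular_inverse_coprime(2)[OF cb]
                cong_mult[OF that(1) cong_refl[of "iv b"]]
            by (meson cong_sym cong_trans)
          then have "[iv a = iv b] (mod int n)" using that(2) by (simp add: cong_mult_lcancel)
          then show ?thesis using npos by (simp add: cong_def modular_inverse_int_less
              modular_inverse_int_nonneg)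
        qed
        have "(\<Sum>k\<in>G. e (iv (int t) * k) * u (iv k * j))
            = (\<Sum>k\<in>G. e ((iv (int t) * k) mod int n) * u (iv (int t * ((iv (int t) * k) mod int n)) * j))"
        proof (rule sum.cong)
          fix k assume kG: "k \<in> G"
          have "[int t * ((iv (int t) * k) mod int n) = k] (mod int n)"
            using tt[of k] by (simp add: cong_def mod_mult_right_eq)
          then have "iv (int t * ((iv (int t) * k) mod int n)) = iv k"
            using G_coprime[OF kG] ivc[OF cong_sym] by metis
          then show "e (iv (int t) * k) * u (iv k * j)
              = e ((iv (int t) * k) mod int n) * u (iv (int t * ((iv (int t) * k) mod int n)) * j)"
            by (simp add: emod)
        qed simp
        also have "\<dots> = (\<Sum>k\<in>G. e (k mod int n) * u (iv (int t * (k mod int n)) * j))"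
          by (rule sum_unit_residues_mult[OF iv_coprime[OF ct] npos, where F
              = "\<lambda>k. e (k mod int n) * u (iv (int t * (k mod int n)) * j)"])
             (simp add: cong_def)
        also have "\<dots> = (\<Sum>k\<in>G. e k * u (iv k * j'))"
        proof (rule sum.cong)
          fix k assume kG: "k \<in> G"
          have "[iv (int t * k) * j = iv (int t * k) * (int t * j')] (mod int n)"
            by (rule cong_mult[OF cong_refl cong_sym[OF tj]])
          also have "[iv (int t * k) * (int t * j') = iv k * j'] (mod int n)"
            by (rule modular_inverse_cancel[OF ct G_coprime[OF kG]])
          finally have "u (iv (int t * k) * j) = u (iv k * j')" by (rule u_periodic)
          then show "e (k mod int n) * u (iv (int t * (k mod int n)) * j) = e k * u (iv k * j')"
              by (simp add: Gmod[OF kG])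
        qed simp
        finally show ?thesis .
      qed
      then show ?thesis using 1 conv[OF j'] by (simp add: y_def Gmod left_diff_distrib sum_subtractf)
    qed
  qed (rule k)
  moreover have "poly (p (k mod int n)) (zeta n ^ t) = poly (p k) (zeta n ^ t)"
  proof -
    have "poly (p (k mod int n) - p k) (zeta n) = 0"
        using p(2)[OF k] p(2)[OF G_coprime[OF mod_in_G[OF k]]] emod[of k] by simp
    then have "poly (p (k mod int n) - p k) (zeta n ^ t) = 0" by (intro tr Rats.in_poly_diff p)
    then show ?thesis by simp
  qed
  ultimately show ?thesis by (simp add: y_def)
qed

end

section \<open>The fields generated by the inverse cotangent numbers\<close>

lemma rat_adjoin_smult:
  assumes "q \<in> \<rat>" "q \<noteq> 0"
  shows "rat_adjoin (q * x) = rat_adjoin x"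
proof
  interpret A: complex_subfield "rat_adjoin x" by (rule rat_adjoin_subfield)
  interpret B: complex_subfield "rat_adjoin (q * x)" by (rule rat_adjoin_subfield)
  show "rat_adjoin (q * x) \<subseteq> rat_adjoin x"
    using assms A.rats by (intro rat_adjoin_least[OF rat_adjoin_subfield] A.mult rat_adjoin_self) auto
  have "inverse q * (q * x) \<in> rat_adjoin (q * x)"
    using assms B.rats by (intro B.mult B.inverse rat_adjoin_self) auto
  moreover have "inverse q * (q * x) = x" using assms by (simp add: field_simps)
  ultimately have "x \<in> rat_adjoin (q * x)" by (simp only:)
  then show "rat_adjoin x \<subseteq> rat_adjoin (q * x)" by (rule rat_adjoin_least[OF rat_adjoin_subfield])
qed

text \<open>
  The roots of \<open>x ^ n - 1\<close> are simple.
\<close>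

lemma root_of_unity_poly_split:
  assumes m: "m dvd monom 1 n - 1" "lead_coeff m = 1" and n: "n > 0" and r: "poly m \<alpha> = 0"
  obtains m' :: "complex poly" where "m = [:- \<alpha>, 1:] * m'" "m' dvd monom 1 n - 1" "lead_coeff m'
      = 1" "poly m' \<alpha> \<noteq> 0"
proof -
  obtain m' where m': "m = [:- \<alpha>, 1:] * m'" using r by (meson dvd_def poly_eq_0_iff_dvd)
  have d: "m' dvd monom 1 n - 1" using m(1) m' by (metis dvd_mult_right)
  have lc: "lead_coeff m' = 1" using m(2) unfolding m' by (subst (asm) lead_coeff_mult) simp
  have "poly m' \<alpha> \<noteq> 0"
  proof
    assume z: "poly m' \<alpha> = 0"
    obtain q where q: "monom 1 n - 1 = m * q" using m(1) by blast
    have "monom 1 n - 1 = [:- \<alpha>, 1:] * (m' * q)" unfolding q m' by (simp only: mult.assoc)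
    then have "pderiv (monom 1 n - 1) = [:- \<alpha>, 1:] * pderiv (m' * q) + (m' * q) * pderiv [:- \<alpha>, 1:]"
        by (simp only: pderiv_mult)
    from arg_cong[OF this, of "\<lambda>f. poly f \<alpha>"]
    have "poly (pderiv (monom 1 n - 1)) \<alpha> = 0" unfolding poly_add poly_mult z by simp
    then have "of_nat n * \<alpha> ^ (n - 1) = 0" by (simp add: pderiv_diff pderiv_monom poly_monom)
    then have "\<alpha> = 0" using n by simp
    moreover have "poly (monom 1 n - 1) \<alpha> = 0" using r by (simp add: q)
    ultimately show False using n by (simp add: poly_monom power_0_left)
  qed
  then show ?thesis using that m' d lc by blast
qed

lemma monic_no_root_eq_1:
  assumes "lead_coeff m = 1" "\<And>z. poly m z \<noteq> (0 :: complex)"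
  shows "m = 1"
proof -
  have "constant (poly m)" using Fundamental_Theorem_Algebra.fundamental_theorem_of_algebra[of m] assms(2)
      by blast
  then have "degree m = 0" by (simp add: constant_degree)
  then obtain c where "m = [:c:]" by (metis degree_eq_zeroE)
  then show ?thesis using assms(1) by (simp add: one_pCons)
qed

context parity_system begin

text \<open>
  If \<open>e (s * j) = e j\<close> for one unit \<open>j\<close>, where \<open>s\<close> is the inverse of \<open>t\<close>, the Galois action gives it for all units.
  Re-indexing the convolution equation at \<open>s\<close> then turns it into the equation at \<open>1\<close>, so the right-hand side takes the
  same value at \<open>s\<close> and at \<open>1\<close>.
\<close>

lemma stabilizer:
  assumes p: "\<And>k. Rats.in_poly (p k)" "\<And>k. coprime k (int n) \<Longrightarrow> e k = poly (p k) (zeta n)"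
    and t: "coprime t n" "t > 0" and j: "coprime j (int n)" and eq: "poly (p j) (zeta n ^ t) = e j"
  shows "[int t = 1] (mod int n) \<or> (\<eta> = 1 \<and> [int t = -1] (mod int n))"
proof -
  define s where "s = iv (int t)"
  have ct: "coprime (int t) (int n)" using t by simp
  have cs: "coprime s (int n)" unfolding s_def by (rule iv_coprime[OF ct])
  have ts: "[int t * s = 1] (mod int n)" unfolding s_def by (rule modular_inverse_coprime[OF ct])
  have sj: "e (s * j) = e j" using galois_action[OF p t j] eq by (simp add: s_def)
  have inv: "e (s * b) = e b" if b: "coprime b (int n)" for b
  proof -
    define a where "a = nat ((iv b * j) mod int n)"
    have c: "coprime ((iv b * j) mod int n) (int n)" using b j iv_coprime mod_in_G G_coprime by simp
    have ia: "int a = (iv b * j) mod int n" using npos by (simp add: a_def)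
    have ca: "coprime a n" using c unfolding ia[symmetric] by simp
    have a0: "a > 0" using ca n by (intro Nat.gr0I) auto
    have "poly (p (s * j) - p j) (zeta n) = 0" using p(2)[of "s * j"] p(2)[of j] cs j sj by simp
    then have "poly (p (s * j) - p j) (zeta n ^ a) = 0"
      by (intro rational_poly_conjugate_root[OF npos zeta_power_n[OF npos] ca a0] Rats.in_poly_diff p)
    then have e1: "e (iv (int a) * (s * j)) = e (iv (int a) * j)"
      using galois_action[OF p ca a0, of "s * j"] galois_action[OF p ca a0, of j] cs j by simp
    have "[b * (iv b * j) = 1 * j] (mod int n)"
      unfolding mult.assoc[symmetric] by (rule cong_mult[OF modular_inverse_coprime(2)[OF b] cong_refl])
    moreover have "[b * int a = b * (iv b * j)] (mod int n)" unfolding ia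
        by (simp add: cong_def mod_mult_right_eq)
    ultimately have "[int a * b = j] (mod int n)" by (metis cong_trans mult.commute mult_1)
    then have "[iv (int a) * (int a * b) = iv (int a) * j] (mod int n)" by (rule cong_mult[OF cong_refl])
    moreover have "[iv (int a) * (int a * b) = b] (mod int n)"
    proof -
      have "coprime (int a) (int n)" using ca by simp
      from cong_mult[OF modular_inverse_coprime(2)[OF this] cong_refl[of b]]
      show ?thesis by (simp add: mult_ac)
    qed
    ultimately have bj: "[iv (int a) * j = b] (mod int n)" by (meson cong_sym cong_trans)
    have "e (s * b) = e (s * (iv (int a) * j))" by (rule e_periodic[OF cong_mult[OF cong_refl cong_sym[OF bj]]])
    also have "\<dots> = e (iv (int a) * (s * j))" by (simp only: mult_ac)
    also have "\<dots> = e (iv (int a) * j)" by (rule e1)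
    also have "\<dots> = e b" by (rule e_periodic[OF bj])
    finally show ?thesis .
  qed
  have Gmod: "k mod int n = k" if "k \<in> G" for k using that by (simp add: unit_residues_def)
  have "2 * parity_indicator \<eta> n s 1 = (\<Sum>k\<in>G. e k * u (iv k * s))" using conv[OF cs] by simp
  also have "\<dots> = (\<Sum>k\<in>G. e (k mod int n) * u (iv (k mod int n) * s))" by (rule sum.cong) (auto simp: Gmod)
  also have "\<dots> = (\<Sum>k\<in>G. e ((s * k) mod int n) * u (iv ((s * k) mod int n) * s))"
    by (rule sum_unit_residues_mult[OF cs npos, symmetric]) (simp add: cong_def)
  also have "\<dots> = (\<Sum>k\<in>G. e k * u (iv k * 1))"
  proof (rule sum.cong)
    fix k assume kG: "k \<in> G"
    have ck: "coprime (s * k) (int n)" using cs G_coprime[OF kG] by simp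
    have m: "[(s * k) mod int n = s * k] (mod int n)" by (simp add: cong_def)
    have "e ((s * k) mod int n) = e k" using e_periodic[OF m] inv[OF G_coprime[OF kG]] by simp
    moreover have "[iv ((s * k) mod int n) * s = iv k * 1] (mod int n)"
    proof -
      have "[(s * k) * iv ((s * k) mod int n) = 1] (mod int n)"
        using modular_inverse_coprime(2)[OF G_coprime[OF mod_in_G[OF ck]]] cong_mult[OF m cong_refl]
        by (meson cong_sym cong_trans)
      moreover have "[k * iv k = 1] (mod int n)" by (rule modular_inverse_coprime[OF G_coprime[OF kG]])
      ultimately have "[k * (iv ((s * k) mod int n) * s) = k * (iv k * 1)] (mod int n)"
        by (metis cong_sym cong_trans mult.commute mult.left_commute mult_1)
      then show ?thesis using G_coprime[OF kG] by (simp only: cong_mult_lcancel)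
    qed
    then have "u (iv ((s * k) mod int n) * s) = u (iv k * 1)" by (rule u_periodic)
    ultimately show "e ((s * k) mod int n) * u (iv ((s * k) mod int n) * s) = e k * u (iv k * 1)" by simp
  qed simp
  also have "\<dots> = 2 * parity_indicator \<eta> n 1 1" by (rule conv) simp
  finally have eps: "parity_indicator \<eta> n s 1 = parity_indicator \<eta> n 1 1" by simp
  have "\<not> [1 = - 1] (mod int n)"
  proof
    assume "[1 = - 1] (mod int n)"
    then have "int n dvd 2" by (simp add: cong_iff_dvd_diff)
    then show False using n by (auto dest: zdvd_imp_le)
  qed
  then have "parity_indicator \<eta> n 1 1 = 1" by (simp add: parity_indicator_def)
  then have "parity_indicator \<eta> n s 1 = 1" using eps by simp
  then have "[1 = s] (mod int n) \<or> (\<eta> = 1 \<and> [1 = - s] (mod int n))"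
    using eta by (auto simp: parity_indicator_def of_bool_def split: if_splits)
  then show ?thesis
  proof
    assume "[1 = s] (mod int n)"
    then have "[int t * 1 = int t * s] (mod int n)" by (rule cong_mult[OF cong_refl])
    then show ?thesis using ts by (metis cong_trans mult.right_neutral)
  next
    assume a: "\<eta> = 1 \<and> [1 = - s] (mod int n)"
    then have "[int t * 1 = int t * (- s)] (mod int n)" using cong_mult[OF cong_refl] by blast
    moreover have "[int t * (- s) = -1] (mod int n)" using ts cong_minus_minus_iff[of "int t * s" 1 "int n"]
        by simp
    ultimately show ?thesis using a by (metis cong_trans mult.right_neutral)
  qed
qed

lemma zeta_nonzero: "zeta n \<noteq> 0"
  by (simp add: zeta_def)

text \<open>
  A conjugate \<open>w\<close> of \<open>\<zeta>\<close> over \<open>\<rat>(e j)\<close> is a primitive \<open>n\<close>-th root of unity, say \<open>\<zeta> ^ t\<close>, and the polynomial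
  \<open>p j - e j\<close>, having coefficients in \<open>\<rat>(e j)\<close> and the root \<open>\<zeta>\<close>, vanishes at \<open>w\<close> too. So \<open>t\<close> fixes \<open>e j\<close>.
\<close>

lemma minimal_poly_roots:
  assumes p: "\<And>k. Rats.in_poly (p k)" "\<And>k. coprime k (int n) \<Longrightarrow> e k = poly (p k) (zeta n)"
    and j: "coprime j (int n)"
    and m: "complex_subfield.minimal_poly (rat_adjoin (e j)) (zeta n) m" and w: "poly m w = 0"
  shows "w = zeta n \<or> (\<eta> = 1 \<and> w = inverse (zeta n))"
proof -
  interpret L: complex_subfield "rat_adjoin (e j)" by (rule rat_adjoin_subfield)
  have in_L: "L.in_poly q" if "Rats.in_poly q" for q
    using that L.rats by (auto simp: L.in_poly_def Rats.in_poly_def)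
  have xn: "L.in_poly (monom 1 k - 1)" for k by (intro L.in_poly_diff L.in_poly_monom) auto
  have "w ^ n = 1"
  proof -
    have "m dvd monom 1 n - 1"
      using L.minimal_poly_dvd[OF m xn[of n]] zeta_power_n[OF npos]
          by (metis dvd_triv_right poly_diff poly_1 poly_monom mult_1 right_minus_eq)
    then obtain k where k: "monom 1 n - 1 = m * k" by (elim dvdE)
    have "poly (monom 1 n - 1) w = 0" unfolding k poly_mult w by simp
    then show ?thesis by (simp add: poly_monom)
  qed
  then obtain t where t: "t < n" "w = zeta n ^ t"
    using complex_roots_unity[of n] npos by (auto simp: zeta_power mult_ac)
  have prim: "w ^ k \<noteq> 1" if "0 < k" "k < n" for k
  proof
    assume "w ^ k = 1"
    then have "poly (monom 1 k - 1) w = 0" by (simp add: poly_monom)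
    then have "poly (monom 1 k - 1) (zeta n) = 0" by (rule L.minimal_poly_conjugate[OF m w xn])
    then show False using zeta_power_neq_1[OF that] by (simp add: poly_monom)
  qed
  have cop: "coprime t n"
  proof (rule ccontr)
    assume nc: "\<not> coprime t n"
    define g where "g = gcd t n"
    have g: "g > 1" using nc npos by (metis coprime_iff_gcd_eq_1 g_def gcd_pos_nat nat_neq_iff less_one not_gr0)
    have "g dvd n" "g dvd t" by (simp_all add: g_def)
    then obtain a b where ab: "n = g * a" "t = g * b" by (auto elim!: dvdE)
    have "a > 0" "a < n" using ab g npos by auto
    moreover have "w ^ a = 1"
    proof -
      have "w ^ a = (zeta n ^ n) ^ b" unfolding t(2) power_mult[symmetric] using ab by (simp add: mult_ac)
      then show ?thesis using zeta_power_n[OF npos] by simp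
    qed
    ultimately show False using prim by blast
  qed
  have t0: "t > 0" using cop n by (intro Nat.gr0I) auto
  have "poly (p j - [:e j:]) w = 0"
  proof -
    have "L.in_poly (p j - [:e j:])"
      by (intro L.in_poly_diff in_L p L.in_poly_pCons rat_adjoin_self) simp
    moreover have "poly (p j - [:e j:]) (zeta n) = 0" using p(2)[OF j] by simp
    ultimately obtain q where "p j - [:e j:] = q * m" using L.minimal_poly_dvd[OF m] by blast
    then show ?thesis using w by simp
  qed
  then have "poly (p j) (zeta n ^ t) = e j" using t by simp
  from stabilizer[OF p cop t0 j this] show ?thesis
  proof
    assume "[int t = 1] (mod int n)"
    then have "t = 1" using t n by (simp add: cong_def)
    then show ?thesis using t by simp
  next
    assume a: "\<eta> = 1 \<and> [int t = -1] (mod int n)"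
    then have "int n dvd int t + 1" by (simp add: cong_iff_dvd_diff)
    then have "n dvd Suc t" by (metis int_dvd_int_iff of_nat_Suc add.commute)
    then have "Suc t = n" using t by (auto dest: dvd_imp_le)
    then have "zeta n * w = 1" using t zeta_power_n[OF npos] by (metis power_Suc)
    then show ?thesis using a zeta_nonzero by (simp add: inverse_unique)
  qed
qed

text \<open>
  The roots of the minimal polynomial \<open>m\<close> of \<open>\<zeta>\<close> over \<open>\<rat>(e j)\<close> are simple and known, so \<open>m\<close> is \<open>x - \<zeta>\<close> or, possibly,
  \<open>(x - \<zeta>) (x - \<zeta>\<^sup>-\<^sup>1)\<close> when \<open>\<eta> = 1\<close>. Conversely, for \<open>\<eta> = 1\<close> the number \<open>e j\<close> is fixed by \<open>\<zeta> \<mapsto> \<zeta>\<^sup>-\<^sup>1\<close> and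
  therefore a rational combination of the \<open>\<zeta> ^ i + \<zeta> ^ (- i)\<close>, which are polynomials in \<open>\<zeta> + \<zeta>\<^sup>-\<^sup>1\<close>.
\<close>

theorem generated_field:
  assumes j: "coprime j (int n)"
  shows "rat_adjoin (e j) = (if \<eta> = 1 then rat_adjoin (zeta n + inverse (zeta n)) else rat_adjoin (zeta n))"
proof -
  let ?z = "zeta n"
  obtain p where p: "\<And>k. Rats.in_poly (p k)" "\<And>k. coprime k (int n) \<Longrightarrow> e k = poly (p k) ?z"
    using rational_representation by metis
  interpret L: complex_subfield "rat_adjoin (e j)" by (rule rat_adjoin_subfield)
  have xn: "L.in_poly (monom 1 n - 1)" by (intro L.in_poly_diff L.in_poly_monom) auto
  have zn: "poly (monom 1 n - 1) ?z = 0" using zeta_power_n[OF npos] by (simp add: poly_monom)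
  have "monom 1 n - 1 \<noteq> (0 :: complex poly)" using degree_monom_minus_1(2)[OF npos, where ?'a = complex]
      by force
  then obtain m where m: "L.minimal_poly ?z m" using L.minimal_poly_exists[OF xn _ zn] by blast
  note roots = minimal_poly_roots[OF p j m]
  have md: "m dvd monom 1 n - 1" using L.minimal_poly_dvd[OF m xn zn] by (metis dvd_triv_right)
  have mL: "coeff m i \<in> rat_adjoin (e j)" for i using m by (simp add: L.minimal_poly_def L.in_poly_def)
  obtain m1 where m1: "m = [:- ?z, 1:] * m1" "m1 dvd monom 1 n - 1" "lead_coeff m1 = 1" "poly m1 ?z \<noteq> 0"
    using root_of_unity_poly_split[OF md _ npos, of ?z] m unfolding L.minimal_poly_def by blast
  have z_in: "?z \<in> rat_adjoin (e j)" if "m1 = 1"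
  proof -
    have "- ?z \<in> rat_adjoin (e j)" using mL[of 0] m1(1) that by simp
    then show ?thesis using L.minus[of "- ?z"] by (simp only: minus_minus)
  qed
  show ?thesis
  proof (cases "\<eta> = 1")
    case False
    have "m1 = 1"
    proof (rule monic_no_root_eq_1[OF m1(3)])
      fix w show "poly m1 w \<noteq> 0" using roots[of w] m1 False by auto
    qed
    then have "rat_adjoin ?z \<subseteq> rat_adjoin (e j)" by (intro rat_adjoin_least[OF rat_adjoin_subfield] z_in)
    moreover have "e j \<in> rat_adjoin ?z"
    proof -
      have "e j = e (j mod int n)" by (rule e_periodic) (simp add: cong_def)
      then show ?thesis using values_in_cyclotomic_field[OF mod_in_G[OF j]] by simp
    qed
    then have "rat_adjoin (e j) \<subseteq> rat_adjoin ?z" by (rule rat_adjoin_least[OF rat_adjoin_subfield])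
    ultimately show ?thesis using False by simp
  next
    case True
    let ?b = "?z + inverse ?z"
    have "?b \<in> rat_adjoin (e j)"
    proof (cases "poly m1 (inverse ?z) = 0")
      case True
      obtain m2 where m2: "m1 = [:- inverse ?z, 1:] * m2" "lead_coeff m2 = 1" "poly m2 (inverse ?z) \<noteq> 0"
        using root_of_unity_poly_split[OF m1(2,3) npos True] by blast
      have "m2 = 1"
      proof (rule monic_no_root_eq_1[OF m2(2)])
        fix w show "poly m2 w \<noteq> 0" using roots[of w] m1 m2 by auto
      qed
      then have "coeff m 1 = - ?b" using m1(1) m2(1) by simp
      then have "- ?b \<in> rat_adjoin (e j)" using mL[of 1] by simp
      then show ?thesis using L.minus[of "- ?b"] by (simp only: minus_minus)
    next
      case False
      have "m1 = 1"
      proof (rule monic_no_root_eq_1[OF m1(3)])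
        fix w show "poly m1 w \<noteq> 0" using roots[of w] m1 False by auto
      qed
      then show ?thesis by (intro L.add L.inverse z_in)
    qed
    then have sub1: "rat_adjoin ?b \<subseteq> rat_adjoin (e j)" by (rule rat_adjoin_least[OF rat_adjoin_subfield])
    interpret B: complex_subfield "rat_adjoin ?b" by (rule rat_adjoin_subfield)
    have cheb: "?z ^ i + inverse ?z ^ i \<in> rat_adjoin ?b \<and> ?z ^ Suc i + inverse ?z ^ Suc i \<in> rat_adjoin ?b" for i
    proof (induction i)
      case 0
      have "(2::complex) \<in> rat_adjoin ?b" using B.of_nat[of 2] by simp
      then show ?case using rat_adjoin_self[of ?b] by simp
    next
      case (Suc i)
      have "?z ^ Suc (Suc i) + inverse ?z ^ Suc (Suc i)
          = ?b * (?z ^ Suc i + inverse ?z ^ Suc i) - (?z ^ i + inverse ?z ^ i)"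
      proof -
        have "(x + y) * (x ^ Suc i + y ^ Suc i)
            = x ^ Suc (Suc i) + y ^ Suc (Suc i) + (x * y) * (x ^ i + y ^ i)" for x y :: complex
          by (simp add: algebra_simps)
        from this[of ?z "inverse ?z"] show ?thesis using zeta_nonzero by simp
      qed
      then show ?case using Suc B.mult B.diff rat_adjoin_self[of ?b] by metis
    qed
    have inv_pow: "inverse ?z = ?z ^ (n - 1)"
    proof -
      have "?z * ?z ^ (n - 1) = 1" using zeta_power_n[OF npos] npos by (metis Suc_diff_1 power_Suc)
      then show ?thesis by (rule inverse_unique)
    qed
    have "poly (p j) (inverse ?z) = e j"
    proof -
      have c: "coprime (n - 1) n" using npos by (rule coprime_diff_one_left_nat)
      have ci: "coprime (int (n - 1)) (int n)" using c by simp
      have "poly (p j) (?z ^ (n - 1)) = e (iv (int (n - 1)) * j)"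
        using n by (intro galois_action[OF p c _ j]) auto
      moreover have "[iv (int (n - 1)) = -1] (mod int n)"
      proof -
        have a: "[int (n - 1) = -1] (mod int n)" using npos by (simp add: cong_iff_dvd_diff of_nat_diff)
        have "[(-1) * iv (int (n - 1)) = int (n - 1) * iv (int (n - 1))] (mod int n)"
          by (rule cong_mult[OF cong_sym[OF a] cong_refl])
        also have "[int (n - 1) * iv (int (n - 1)) = 1] (mod int n)" by (rule modular_inverse_coprime[OF ci])
        finally show ?thesis using cong_minus_iff[of "iv (int (n - 1))" 1 "int n"] by simp
      qed
      then have "e (iv (int (n - 1)) * j) = e ((-1) * j)" by (intro e_periodic cong_mult cong_refl)
      ultimately show ?thesis using e_parity[OF j] True by (simp add: inv_pow)
    qed
    then have "2 * e j = poly (p j) ?z + poly (p j) (inverse ?z)" using p(2)[OF j] by simp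
    also have "\<dots> = (\<Sum>i\<le>degree (p j). coeff (p j) i * (?z ^ i + inverse ?z ^ i))"
      by (simp add: poly_altdef sum.distrib distrib_left)
    also have "\<dots> \<in> rat_adjoin ?b"
      using p(1)[of j] B.rats cheb by (intro B.sum B.mult) (auto simp: Rats.in_poly_def)
    finally have "2 * e j \<in> rat_adjoin ?b" .
    moreover have "(2::complex) \<in> rat_adjoin ?b" using B.of_nat[of 2] by simp
    ultimately have "(2 * e j) / 2 \<in> rat_adjoin ?b" by (rule B.divide)
    then have "rat_adjoin (e j) \<subseteq> rat_adjoin ?b" by (intro rat_adjoin_least[OF rat_adjoin_subfield]) simp
    then show ?thesis using sub1 True by auto
  qed
qed

end

lemma moebius_series_cong:
  "[a = b] (mod int n) \<Longrightarrow> moebius_series n r a = moebius_series n r b"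
  by (simp add: moebius_series_def cong_def)

lemma moebius_series_minus:
  assumes n: "n > 0" and r: "r \<ge> 1" and j: "coprime j (int n)"
  shows "of_real (moebius_series n r (- j)) = (-1) ^ r * (of_real (moebius_series n r j) :: complex)"
proof -
  have par: "inverse_cot_series \<eta> n (- j) s = \<eta> * inverse_cot_series \<eta> n j s"
    if \<eta>: "\<eta> * \<eta> = 1" "norm \<eta> = 1" and s: "Re s > 1" for \<eta> s
  proof -
    have "summable (\<lambda>m. of_int (moebius_mu m) * parity_indicator \<eta> n j (int m) * of_nat m powr (-s))"
      by (rule summable_norm_cancel[OF summable_dirichlet_bounded[OF
          moebius_bounded[OF norm_parity_indicator[OF \<eta>(2)]] s]])
    then show ?thesis
      unfolding inverse_cot_series_def parity_indicator_uminus_left[OF \<eta>(1)]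
      by (subst suminf_mult[symmetric]) (simp_all add: mult_ac)
  qed
  show ?thesis
  proof (cases "r = 1")
    case True
    have "((\<lambda>s::real. (-1) * inverse_cot_series (-1) n j (of_real s))
        \<longlongrightarrow> (-1) * of_real (moebius_series n 1 j)) (at_right 1)"
      by (intro tendsto_mult tendsto_const moebius_series_1 n j)
    moreover have "\<forall>\<^sub>F s::real in at_right 1. (-1) * inverse_cot_series (-1) n j (of_real s)
        = inverse_cot_series (-1) n (- j) (of_real s)"
      using eventually_at_right_less[of 1]
    proof eventually_elim
      case (elim s)
      then show ?case using par[of "-1" "of_real s"] by simp
    qed
    ultimately have "((\<lambda>s::real. inverse_cot_series (-1) n (- j) (of_real s))
        \<longlongrightarrow> (-1) * of_real (moebius_series n 1 j)) (at_right 1)"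
      by (rule Lim_transform_eventually)
    moreover have "((\<lambda>s::real. inverse_cot_series (-1) n (- j) (of_real s))
        \<longlongrightarrow> of_real (moebius_series n 1 (- j))) (at_right 1)"
      using j by (intro moebius_series_1 n) simp
    ultimately have "of_real (moebius_series n 1 (- j)) = (-1) * (of_real (moebius_series n 1 j) :: complex)"
      using tendsto_unique trivial_limit_at_right_real by blast
    then show ?thesis using True by simp
  next
    case False
    then have r2: "r \<ge> 2" using r by simp
    have "((-1) ^ r :: complex) * (-1) ^ r = 1" by (simp flip: power_mult_distrib)
    then show ?thesis using par[of "(-1) ^ r" "of_nat r"] r2
        by (simp add: moebius_series_abs_convergent[OF r2 n] norm_power)
  qed
qed

theorem proposition2:
  fixes n r :: nat and j :: int
  assumes "n \<ge> 3" and "r \<ge> 1" and "coprime j (int n)"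
  shows "rat_adjoin (inverse_cot_number n r j) =
           (if odd r then rat_adjoin (zeta n) else rat_adjoin (zeta n + inverse (zeta n)))"
proof -
  have n: "n > 0" using assms(1) by simp
  obtain c where c: "\<And>j. coprime j (int n) \<Longrightarrow> (\<lambda>m. parity_indicator ((-1) ^ r) n j (int m) / of_nat m ^ r)
      sums c j"
    "\<And>j. coprime j (int n) \<Longrightarrow> (\<Sum>k\<in>unit_residues n. of_real (moebius_series n r k)
        * c (modular_inverse (int n) k * j))
       = 2 * parity_indicator ((-1) ^ r) n j 1"
    using moebius_series_convolution[OF n assms(2)] by blast
  obtain U where U: "Rats.in_poly U"
    "\<And>j c. coprime j (int n) \<Longrightarrow> (\<lambda>m. parity_indicator ((-1) ^ r) n j (int m) / of_nat m ^ r) sums c \<Longrightarrow>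
       c = (\<i> * of_real pi) ^ r * poly U (zeta n ^ nat (j mod int n))"
    using cot_value_cyclotomic[OF assms(1,2)] by blast
  define e where "e k = (\<i> * of_real pi) ^ r * of_real (moebius_series n r k)" for k
  interpret parity_system n "(-1) ^ r" e U
  proof
    show "(-1 :: complex) ^ r = 1 \<or> (-1 :: complex) ^ r = -1" by (cases "even r") auto
    show "e a = e b" if "[a = b] (mod int n)" for a b
      using moebius_series_cong[OF that] by (simp add: e_def)
    show "e (- a) = (-1) ^ r * e a" if "coprime a (int n)" for a
      using moebius_series_minus[OF n assms(2) that] by (simp add: e_def mult_ac)
    show "(\<Sum>k\<in>unit_residues n. e k * poly U (zeta n ^ nat ((modular_inverse (int n) k * j) mod int n)))
        = 2 * parity_indicator ((-1) ^ r) n j 1"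
      if j: "coprime j (int n)" for j
    proof -
      have "e k * poly U (zeta n ^ nat ((modular_inverse (int n) k * j) mod int n))
          = of_real (moebius_series n r k) * c (modular_inverse (int n) k * j)"
        if "k \<in> unit_residues n" for k
      proof -
        have "coprime (modular_inverse (int n) k * j) (int n)"
          using that j modular_inverse_coprime(1)[of k n] by (simp add: unit_residues_def)
        from U(2)[OF this c(1)[OF this]] show ?thesis by (simp add: e_def mult_ac)
      qed
      then show ?thesis using c(2)[OF j] by simp
    qed
  qed (use assms U in auto)
  define q where "q = - 1 / (fact (r - 1) * of_nat n ^ r :: complex)"
  have "(fact (r - 1) :: complex) \<in> \<rat>" by (metis Rats_of_nat of_nat_fact)
  then have q: "q \<in> \<rat>" "q \<noteq> 0" using n by (auto simp: q_def intro!: Rats_divide Rats_mult Rats_power)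
  have "inverse_cot_number n r j = q * e j"
    by (simp add: inverse_cot_number_def q_def e_def power_mult_distrib)
  then have "rat_adjoin (inverse_cot_number n r j) = rat_adjoin (e j)" using rat_adjoin_smult[OF q] by simp
  also have "\<dots> = (if (-1 :: complex) ^ r = 1 then rat_adjoin (zeta n + inverse (zeta n)) else rat_adjoin
      (zeta n))"
    by (rule generated_field[OF assms(3)])
  also have "((-1 :: complex) ^ r = 1) = even r" by (cases "even r") auto
  finally show ?thesis by simp
qed

end
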